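(* Let $k$ be a finite field of odd characteristic. Let $\Pi$ be an irreducible generic cuspidal representation of $\mathrm{G}_2(k)$ and let $\tau$ be an irreducible generic representation of $\mathrm{GL}_2(k)$. Then $$\dim \mathrm{Hom}_{\mathrm{G}_2(k)}(I(\tau)|_{\mathrm{G}_2(k)},\Pi)=1,$$ where $I(\tau)=\mathrm{Ind}_{\widetilde P}^{\mathrm{SO}_7(k)}(\tau\otimes 1_{\mathrm{SO}_3})$.
   Context: All representations are complex and finite dimensional; $\psi$ is a fixed nontrivial additive character of $k$. $E_{ij}$ are the $7\times 7$ matrix units, $I=I_7$. For $r\in k$ put $\mathbf{x}_\alpha(r)=I-2rE_{24}-r^2E_{26}+rE_{46}-rE_{51}-rE_{73}$, $\mathbf{x}_{-\alpha}(r)=I-rE_{15}-rE_{37}-rE_{42}-r^2E_{62}+2rE_{64}$, $\mathbf{x}_\beta(r)=I+rE_{12}-rE_{67}$, $\mathbf{x}_{-\beta}(r)={}^t\mathbf{x}_\beta(r)$, $\mathbf{x}_{\alpha+\beta}(r)=I-2rE_{14}-r^2E_{17}+rE_{47}+rE_{52}+rE_{63}$, $\mathbf{x}_{2\alpha+\beta}(r)=I-rE_{16}+rE_{27}-rE_{43}+r^2E_{53}-2rE_{54}$, $\mathbf{x}_{3\alpha+\beta}(r)=I+rE_{23}+rE_{56}$, $\mathbf{x}_{3\alpha+2\beta}(r)=I+rE_{13}+rE_{57}$. $\mathrm{G}_2(k)\subset \mathrm{GL}_7(k)$ is the group generated by all $\mathbf{x}_{\pm\alpha}(r),\mathbf{x}_{\pm\beta}(r)$;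 it is the split group of type $\mathrm{G}_2$ with short simple root $\alpha$ and long simple root $\beta$, and is contained in $\mathrm{SO}_7(k)=\{g\in \mathrm{GL}_7(k): {}^tgQg=Q,\det g=1\}$, where $Q=E_{17}+E_{26}-E_{35}+2E_{44}-E_{53}+E_{62}+E_{71}$. Let $U_\gamma=\{\mathbf{x}_\gamma(r)\}$ and let $U$ be generated by all $U_\gamma$, $\gamma$ positive. $\psi_U$ is the character of $U$ with $\psi_U(\mathbf{x}_\alpha(r))=\psi_U(\mathbf{x}_\beta(r))=\psi(r)$, trivial on the other positive root subgroups. An irreducible representation $\Pi$ of $\mathrm{G}_2(k)$ is generic if $\mathrm{Hom}_U(\Pi,\psi_U)\ne0$. Genericity for $\mathrm{GL}_2(k)$ is with respect to a nontrivial character of the upper triangular unipotent subgroup. For $a\in\mathrm{GL}_2(k)$ put $a^*=\begin{pmatrix}0&1\\1&0\end{pmatrix}{}^ta^{-1}\begin{pmatrix}0&1\\1&0\end{pmatrix}$. $\widetilde P\subset\mathrm{SO}_7(k)$ is the parabolic subgroup of block upper triangular matrices with diagonal blocks of sizes $2,3,2$; its Levi subgroup consists of $\mathrm{diag}(a,b,a^* )$ with $a\in\mathrm{GL}_2(k)$, $b\in\mathrm{SO}_3(k)$ (special orthogonal group of $\begin{pmatrix}&&-1\\&2&\\-1&&\end{pmatrix}$). $\tau\otimes1_{\mathrm{SO}_3}$ is the representation $\mathrm{diag}(a,b,a^* )\mapsto\tau(a)$ of the Levi subgroup, extended trivially to the unipotent radical. *)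

theory Defs
  imports
    "HOL-Analysis.Analysis"
    "HOL-Algebra.Generated_Groups"
    "HOL-Library.Function_Algebras"
begin

section \<open>Finite-dimensional complex representations\<close>

text \<open>
  A representation lives on a linear subspace \<open>vspace\<close> of an ambient complex vector space
  (an additive group type with scalar multiplication \<open>smult\<close>), so that spaces of functions,
  such as those of induced representations, are covered. The action is only meaningful for
  elements of the group acting on vectors of \<open>vspace\<close>; restriction to a subgroup therefore needs
  no notation of its own.
\<close>

record ('g, 'v) rep =
  vspace :: "'v set"
  smult :: "complex \<Rightarrow> 'v \<Rightarrow> 'v"
  act :: "'g \<Rightarrow> 'v \<Rightarrow> 'v"

definition fin_dim :: "(complex \<Rightarrow> 'v \<Rightarrow> 'v) \<Rightarrow> 'v::ab_group_add set \<Rightarrow> bool" where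
  "fin_dim s V \<longleftrightarrow> (\<exists>B. finite B \<and> B \<subseteq> V \<and> module.span s B = V)"

definition linear_on :: "'v set \<Rightarrow> (complex \<Rightarrow> 'v \<Rightarrow> 'v) \<Rightarrow> (complex \<Rightarrow> 'w \<Rightarrow> 'w)
    \<Rightarrow> ('v::ab_group_add \<Rightarrow> 'w::ab_group_add) \<Rightarrow> bool" where
  "linear_on V s t T \<longleftrightarrow>
     (\<forall>v\<in>V. \<forall>w\<in>V. T (v + w) = T v + T w) \<and> (\<forall>c. \<forall>v\<in>V. T (s c v) = t c (T v))"

definition representation :: "('g, 'b) monoid_scheme \<Rightarrow> ('g, 'v::ab_group_add) rep \<Rightarrow> bool" where
  "representation G \<pi> \<longleftrightarrow>
     group G \<and> vector_space (smult \<pi>) \<and> module.subspace (smult \<pi>) (vspace \<pi>) \<and>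
     fin_dim (smult \<pi>) (vspace \<pi>) \<and>
     (\<forall>g\<in>carrier G. act \<pi> g ` vspace \<pi> \<subseteq> vspace \<pi> \<and>
        linear_on (vspace \<pi>) (smult \<pi>) (smult \<pi>) (act \<pi> g)) \<and>
     (\<forall>v\<in>vspace \<pi>. act \<pi> \<one>\<^bsub>G\<^esub> v = v) \<and>
     (\<forall>g\<in>carrier G. \<forall>h\<in>carrier G. \<forall>v\<in>vspace \<pi>.
        act \<pi> (g \<otimes>\<^bsub>G\<^esub> h) v = act \<pi> g (act \<pi> h v))"

definition irreducible_rep :: "('g, 'b) monoid_scheme \<Rightarrow> ('g, 'v::ab_group_add) rep \<Rightarrow> bool" where
  "irreducible_rep G \<pi> \<longleftrightarrow>
     representation G \<pi> \<and> vspace \<pi> \<noteq> {0} \<and>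
     (\<forall>W. module.subspace (smult \<pi>) W \<and> W \<subseteq> vspace \<pi> \<and>
          (\<forall>g\<in>carrier G. act \<pi> g ` W \<subseteq> W) \<longrightarrow> W = {0} \<or> W = vspace \<pi>)"

text \<open>Intertwining maps are normalised to vanish outside the source space.\<close>

definition hom_space :: "('g, 'b) monoid_scheme \<Rightarrow> ('g, 'v::ab_group_add) rep
    \<Rightarrow> ('g, 'w::ab_group_add) rep \<Rightarrow> ('v \<Rightarrow> 'w) set" where
  "hom_space G \<pi> \<sigma> =
     {T. T ` vspace \<pi> \<subseteq> vspace \<sigma> \<and> linear_on (vspace \<pi>) (smult \<pi>) (smult \<sigma>) T \<and>
         (\<forall>g\<in>carrier G. \<forall>v\<in>vspace \<pi>. T (act \<pi> g v) = act \<sigma> g (T v)) \<and>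
         (\<forall>v. v \<notin> vspace \<pi> \<longrightarrow> T v = 0)}"

definition hom_dim :: "('g, 'b) monoid_scheme \<Rightarrow> ('g, 'v::ab_group_add) rep
    \<Rightarrow> ('g, 'w::ab_group_add) rep \<Rightarrow> nat" where
  "hom_dim G \<pi> \<sigma> = vector_space.dim (\<lambda>c T v. smult \<sigma> c (T v)) (hom_space G \<pi> \<sigma>)"

text \<open>Functions in the induced space are normalised to vanish outside \<open>G\<close>.\<close>

definition induced_rep :: "('g, 'b) monoid_scheme \<Rightarrow> 'g set \<Rightarrow> ('g, 'v::ab_group_add) rep
    \<Rightarrow> ('g, 'g \<Rightarrow> 'v) rep" where
  "induced_rep G P \<sigma> =
     \<lparr>vspace = {f. (\<forall>g\<in>carrier G. f g \<in> vspace \<sigma>) \<and> (\<forall>g. g \<notin> carrier G \<longrightarrow> f g = 0) \<and>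
                  (\<forall>p\<in>P. \<forall>g\<in>carrier G. f (p \<otimes>\<^bsub>G\<^esub> g) = act \<sigma> p (f g))},
      smult = (\<lambda>c f g. smult \<sigma> c (f g)),
      act = (\<lambda>h f g. if g \<in> carrier G then f (g \<otimes>\<^bsub>G\<^esub> h) else 0)\<rparr>"

definition Cstar :: "complex monoid" where
  "Cstar = \<lparr>carrier = {z. z \<noteq> 0}, mult = (*), one = 1\<rparr>"

definition char_rep :: "('g \<Rightarrow> complex) \<Rightarrow> ('g, complex) rep" where
  "char_rep \<theta> = \<lparr>vspace = UNIV, smult = (*), act = (\<lambda>g z. \<theta> g * z)\<rparr>"

definition nontrivial_additive_char :: "('k::ab_group_add \<Rightarrow> complex) \<Rightarrow> bool" where
  "nontrivial_additive_char \<psi> \<longleftrightarrow>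
     \<psi> 0 = 1 \<and> (\<forall>x y. \<psi> (x + y) = \<psi> x * \<psi> y) \<and> (\<exists>x. \<psi> x \<noteq> 1)"


section \<open>General linear groups\<close>

definition GL :: "('k::field ^ 'n ^ 'n) monoid" where
  "GL = \<lparr>carrier = {A. invertible A}, mult = (**), one = mat 1\<rparr>"

lemma group_GL: "group (GL :: ('k::field ^ 'n ^ 'n) monoid)"
proof (rule groupI)
  fix x :: "'k ^ 'n ^ 'n"
  assume "x \<in> carrier GL"
  then show "\<exists>y\<in>carrier GL. y \<otimes>\<^bsub>GL\<^esub> x = \<one>\<^bsub>GL\<^esub>"
    by (auto simp: GL_def invertible_def)
qed (auto simp: GL_def invertible_mult matrix_mul_assoc,
     auto simp: invertible_def intro!: exI[of _ "mat 1"])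

definition N_GL2 :: "('k::field ^ 2 ^ 2) monoid" where
  "N_GL2 = GL\<lparr>carrier := {vector [vector [1, x], vector [0, 1]] |x. True}\<rparr>"

definition generic_GL2 :: "('k::field ^ 2 ^ 2, 'v::ab_group_add) rep \<Rightarrow> bool" where
  "generic_GL2 \<tau> \<longleftrightarrow>
     (\<exists>\<theta>. \<theta> \<in> hom N_GL2 Cstar \<and> (\<exists>n\<in>carrier N_GL2. \<theta> n \<noteq> 1) \<and>
          hom_space N_GL2 \<tau> (char_rep \<theta>) \<noteq> {0})"


section \<open>The split group of type \<open>G\<^sub>2\<close>\<close>

text \<open>
  Rows and columns of seven-by-seven matrices are indexed by the numerals \<open>1, \<dots>, 7\<close> of type
  \<open>7\<close>. In this type \<open>7 = 0\<close>, so the order of the type is not used.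
\<close>

text \<open>\<open>E7 i j c\<close> is \<open>c\<close> times the matrix unit \<open>E\<^bsub>ij\<^esub>\<close>.\<close>

definition E7 :: "7 \<Rightarrow> 7 \<Rightarrow> 'k \<Rightarrow> 'k::field ^ 7 ^ 7" where
  "E7 i j c = (\<chi> a b. if a = i \<and> b = j then c else 0)"

text \<open>The positive roots; \<open>Alpha\<close> is the short and \<open>Beta\<close> the long simple root.\<close>

datatype pos_root = Alpha | Beta | Alpha_Beta | TwoAlpha_Beta | ThreeAlpha_Beta | ThreeAlpha_TwoBeta

primrec x_pos :: "pos_root \<Rightarrow> 'k \<Rightarrow> 'k::field ^ 7 ^ 7" where
  "x_pos Alpha r = mat 1 - E7 2 4 (2 * r) - E7 2 6 (r^2) + E7 4 6 r - E7 5 1 r - E7 7 3 r"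
| "x_pos Beta r = mat 1 + E7 1 2 r - E7 6 7 r"
| "x_pos Alpha_Beta r =
     mat 1 - E7 1 4 (2 * r) - E7 1 7 (r^2) + E7 4 7 r + E7 5 2 r + E7 6 3 r"
| "x_pos TwoAlpha_Beta r =
     mat 1 - E7 1 6 r + E7 2 7 r - E7 4 3 r + E7 5 3 (r^2) - E7 5 4 (2 * r)"
| "x_pos ThreeAlpha_Beta r = mat 1 + E7 2 3 r + E7 5 6 r"
| "x_pos ThreeAlpha_TwoBeta r = mat 1 + E7 1 3 r + E7 5 7 r"

definition x_neg_alpha :: "'k \<Rightarrow> 'k::field ^ 7 ^ 7" where
  "x_neg_alpha r = mat 1 - E7 1 5 r - E7 3 7 r - E7 4 2 r - E7 6 2 (r^2) + E7 6 4 (2 * r)"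

definition x_neg_beta :: "'k \<Rightarrow> 'k::field ^ 7 ^ 7" where
  "x_neg_beta r = transpose (x_pos Beta r)"

definition G2 :: "('k::field ^ 7 ^ 7) monoid" where
  "G2 = GL\<lparr>carrier := generate GL
     (range (x_pos Alpha) \<union> range x_neg_alpha \<union> range (x_pos Beta) \<union> range x_neg_beta)\<rparr>"

definition root_generated :: "pos_root set \<Rightarrow> ('k::field ^ 7 ^ 7) monoid" where
  "root_generated S = GL\<lparr>carrier := generate GL (\<Union>\<gamma>\<in>S. range (x_pos \<gamma>))\<rparr>"

abbreviation U_G2 :: "('k::field ^ 7 ^ 7) monoid" where
  "U_G2 \<equiv> root_generated UNIV"

definition is_psi_U :: "('k \<Rightarrow> complex) \<Rightarrow> ('k::field ^ 7 ^ 7 \<Rightarrow> complex) \<Rightarrow> bool" where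
  "is_psi_U \<psi> \<theta> \<longleftrightarrow> \<theta> \<in> hom U_G2 Cstar \<and> \<theta> \<in> extensional (carrier U_G2) \<and>
     (\<forall>\<gamma> r. \<theta> (x_pos \<gamma> r) = (if \<gamma> \<in> {Alpha, Beta} then \<psi> r else 1))"

text \<open>See \<open>is_psi_U_psi_U\<close> and \<open>ex1_psi_U\<close> below for existence and uniqueness.\<close>

definition psi_U :: "('k \<Rightarrow> complex) \<Rightarrow> 'k::field ^ 7 ^ 7 \<Rightarrow> complex" where
  "psi_U \<psi> = (THE \<theta>. is_psi_U \<psi> \<theta>)"

definition generic_G2 :: "('k::field \<Rightarrow> complex) \<Rightarrow> ('k ^ 7 ^ 7, 'v::ab_group_add) rep \<Rightarrow> bool" where
  "generic_G2 \<psi> \<pi> \<longleftrightarrow> hom_space U_G2 \<pi> (char_rep (psi_U \<psi>)) \<noteq> {0}"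

text \<open>
  Up to conjugacy, the proper parabolic subgroups of \<open>G\<^sub>2(k)\<close> are the standard ones attached to
  the proper subsets \<open>J\<close> of the simple roots. The unipotent radical for \<open>J\<close> is generated by the
  root subgroups of the positive roots outside the span of \<open>J\<close>; the only positive roots in this
  span are the elements of \<open>J\<close> itself, since \<open>J\<close> has at most one element.
\<close>

definition cuspidal_G2 :: "('k::field ^ 7 ^ 7, 'v::ab_group_add) rep \<Rightarrow> bool" where
  "cuspidal_G2 \<pi> \<longleftrightarrow>
     (\<forall>J \<in> {{}, {Alpha}, {Beta}}. \<forall>g\<in>carrier G2.
        {v \<in> vspace \<pi>. \<forall>n\<in>carrier (root_generated (- J)).
            act \<pi> (g \<otimes>\<^bsub>G2\<^esub> n \<otimes>\<^bsub>G2\<^esub> inv\<^bsub>G2\<^esub> g) v = v} = {0})"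


section \<open>The parabolic subgroup of \<open>SO\<^sub>7\<close> and the induced representation\<close>

definition Q7 :: "'k::field ^ 7 ^ 7" where
  "Q7 = E7 1 7 1 + E7 2 6 1 - E7 3 5 1 + E7 4 4 2 - E7 5 3 1 + E7 6 2 1 + E7 7 1 1"

definition Q3 :: "'k::field ^ 3 ^ 3" where
  "Q3 = vector [vector [0, 0, - 1], vector [0, 2, 0], vector [- 1, 0, 0]]"

definition SO :: "'k ^ 'n ^ 'n \<Rightarrow> ('k::field ^ 'n ^ 'n) monoid" where
  "SO Q = GL\<lparr>carrier := {g \<in> carrier GL. transpose g ** Q ** g = Q \<and> det g = 1}\<rparr>"

abbreviation SO7 :: "('k::field ^ 7 ^ 7) monoid" where
  "SO7 \<equiv> SO Q7"

abbreviation SO3 :: "('k::field ^ 3 ^ 3) monoid" where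
  "SO3 \<equiv> SO Q3"

definition blk :: "7 \<Rightarrow> nat" where
  "blk i = (if i \<in> {1, 2} then 0 else if i \<in> {3, 4, 5} then 1 else 2)"

definition P_tilde :: "('k::field ^ 7 ^ 7) set" where
  "P_tilde = {g \<in> carrier SO7. \<forall>i j. blk j < blk i \<longrightarrow> g $ i $ j = 0}"

definition N_tilde :: "('k::field ^ 7 ^ 7) set" where
  "N_tilde = {g \<in> P_tilde. \<forall>i j. blk i = blk j \<longrightarrow> g $ i $ j = (if i = j then 1 else 0)}"

definition w2 :: "'k::field ^ 2 ^ 2" where
  "w2 = vector [vector [0, 1], vector [1, 0]]"

definition star :: "'k::field ^ 2 ^ 2 \<Rightarrow> 'k ^ 2 ^ 2" where
  "star a = w2 ** matrix_inv (transpose a) ** w2"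

definition diag3 :: "'k::field ^ 2 ^ 2 \<Rightarrow> 'k ^ 3 ^ 3 \<Rightarrow> 'k ^ 2 ^ 2 \<Rightarrow> 'k ^ 7 ^ 7" where
  "diag3 a b d = vector
    [vector [a $ 1 $ 1, a $ 1 $ 2, 0, 0, 0, 0, 0],
     vector [a $ 2 $ 1, a $ 2 $ 2, 0, 0, 0, 0, 0],
     vector [0, 0, b $ 1 $ 1, b $ 1 $ 2, b $ 1 $ 3, 0, 0],
     vector [0, 0, b $ 2 $ 1, b $ 2 $ 2, b $ 2 $ 3, 0, 0],
     vector [0, 0, b $ 3 $ 1, b $ 3 $ 2, b $ 3 $ 3, 0, 0],
     vector [0, 0, 0, 0, 0, d $ 1 $ 1, d $ 1 $ 2],
     vector [0, 0, 0, 0, 0, d $ 2 $ 1, d $ 2 $ 2]]"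

text \<open>
  The \<open>GL\<^sub>2\<close>-component of an element of \<open>P_tilde\<close>, from its decomposition as a product of
  an element of the Levi subgroup and an element of the unipotent radical.
\<close>

definition GL2_part :: "'k::field ^ 7 ^ 7 \<Rightarrow> 'k ^ 2 ^ 2" where
  "GL2_part p = (THE a. a \<in> carrier GL \<and>
     (\<exists>b\<in>carrier SO3. \<exists>n\<in>N_tilde. p = diag3 a b (star a) ** n))"

definition tensor_one_SO3 :: "('k::field ^ 2 ^ 2, 'v) rep \<Rightarrow> ('k ^ 7 ^ 7, 'v) rep" where
  "tensor_one_SO3 \<tau> =
     \<lparr>vspace = vspace \<tau>, smult = smult \<tau>, act = (\<lambda>p. act \<tau> (GL2_part p))\<rparr>"

definition I_rep :: "('k::field ^ 2 ^ 2, 'v::ab_group_add) rep \<Rightarrow> ('k ^ 7 ^ 7, 'k ^ 7 ^ 7 \<Rightarrow> 'v) rep" where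
  "I_rep \<tau> = induced_rep SO7 P_tilde (tensor_one_SO3 \<tau>)"


section \<open>Well-definedness of \<open>psi_U\<close> and \<open>GL2_part\<close>\<close>

lemma exhaust_7:
  fixes x :: 7
  shows "x = 1 \<or> x = 2 \<or> x = 3 \<or> x = 4 \<or> x = 5 \<or> x = 6 \<or> x = 7"
proof (induct x)
  case (of_int z)
  then have "0 \<le> z" and "z < 7" by simp_all
  then have "z = 0 \<or> z = 1 \<or> z = 2 \<or> z = 3 \<or> z = 4 \<or> z = 5 \<or> z = 6" by arith
  then show ?case by auto
qed

lemma UNIV_7: "UNIV = {1, 2, 3, 4, 5, 6, 7 :: 7}"
  using exhaust_7 by auto

lemma forall_7:
  "(\<forall>i::7. P i) \<longleftrightarrow> P 1 \<and> P 2 \<and> P 3 \<and> P 4 \<and> P 5 \<and> P 6 \<and> P 7"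
  by (metis exhaust_7)

lemma sum_7:
  "(\<Sum>i\<in>(UNIV::7 set). f i) = f 1 + (f 2 + (f 3 + (f 4 + (f 5 + (f 6 + f 7)))))"
  unfolding UNIV_7 by simp

lemma E7_mult:
  "E7 i j a ** E7 k l b = (if j = k then E7 i l (a * b) else 0)"
proof -
  have "(\<Sum>m\<in>UNIV. (if p = i \<and> m = j then a else 0) * (if m = k \<and> q = l then b else 0)) =
      (\<Sum>m\<in>UNIV. if m = j then (if j = k \<and> p = i \<and> q = l then a * b else 0) else 0)" for p q
    by (rule sum.cong) auto
  then show ?thesis
    by (auto simp: vec_eq_iff matrix_matrix_mult_def E7_def)
qed

lemma E7_minus: "A - E7 i j a = A + E7 i j (- a)"
  by (simp add: vec_eq_iff E7_def)

lemma E7_add: "E7 i j a + E7 i j b = E7 i j (a + b)"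
  "E7 i j a + (E7 i j b + C) = E7 i j (a + b) + C"
  by (simp_all add: vec_eq_iff E7_def)

lemma E7_zero: "E7 i j 0 = 0"
  by (simp add: vec_eq_iff E7_def)

lemma matrix_add_rdist7: "(A + B) ** C = A ** C + B ** (C :: 'k::field ^ 7 ^ 7)"
  by (simp add: vec_eq_iff matrix_matrix_mult_def distrib_right sum.distrib)

lemma x_pos_inverse:
  "x_pos \<gamma> r ** x_pos \<gamma> (- r) = mat 1"
  by (cases \<gamma>) (simp_all add: E7_minus matrix_add_ldistrib matrix_add_rdist7 E7_mult add_ac,
    auto simp: vec_eq_iff E7_def power2_eq_square algebra_simps)

lemma x_pos_GL: "x_pos \<gamma> r \<in> carrier GL"
  using x_pos_inverse[of \<gamma> r] x_pos_inverse[of \<gamma> "- r"] by (auto simp: GL_def invertible_def)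

lemma inv_x_pos: "inv\<^bsub>GL\<^esub> (x_pos \<gamma> r) = x_pos \<gamma> (- r)"
proof -
  interpret group "GL :: ('a^7^7) monoid" by (rule group_GL)
  show ?thesis
    by (rule inv_equality) (use x_pos_inverse[of \<gamma> "- r"] x_pos_GL in \<open>auto simp: GL_def\<close>)
qed

text \<open>
  \<open>U_G2\<close> becomes upper unitriangular when the indices are put in the order
  \<open>5, 1, 2, 4, 6, 7, 3\<close>.
\<close>

definition rk :: "7 \<Rightarrow> nat" where
  "rk i = (if i = 5 then 0 else if i = 1 then 1 else if i = 2 then 2 else if i = 4 then 3
     else if i = 6 then 4 else if i = 7 then 5 else 6)"

definition unitri :: "'k::field ^ 7 ^ 7 \<Rightarrow> bool" where
  "unitri u \<longleftrightarrow> (\<forall>i. u $ i $ i = 1) \<and> (\<forall>i j. rk j < rk i \<longrightarrow> u $ i $ j = 0)"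

lemma x_pos_unitri: "unitri (x_pos \<gamma> r)"
proof -
  have "rk 1 = 1" "rk 2 = 2" "rk 3 = 6" "rk 4 = 3" "rk 5 = 0" "rk 6 = 4" "rk 7 = 5"
    by (simp_all add: rk_def)
  then show ?thesis
    by (cases \<gamma>) (auto simp: unitri_def E7_def mat_def)
qed

lemma unitri_mult:
  assumes "unitri u" "unitri v"
  shows "unitri (u ** v)" and "(u ** v) $ 1 $ 2 = u $ 1 $ 2 + v $ 1 $ 2"
    and "(u ** v) $ 5 $ 1 = u $ 5 $ 1 + v $ 5 $ 1"
proof -
  have rk: "rk 1 = 1" "rk 2 = 2" "rk 3 = 6" "rk 4 = 3" "rk 5 = 0" "rk 6 = 4" "rk 7 = 5"
    by (simp_all add: rk_def)
  have rk_inj: "rk i = rk j \<longleftrightarrow> i = j" for i j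
    using exhaust_7[of i] exhaust_7[of j] by (auto simp: rk)
  have z: "u $ i $ m * v $ m $ j = 0" if "rk m < rk i \<or> rk j < rk m" for i j m
    using that assms by (auto simp: unitri_def)
  have d: "(u ** v) $ i $ i = 1" for i
  proof -
    have "(\<Sum>m\<in>UNIV. u $ i $ m * v $ m $ i) = (\<Sum>m\<in>{i}. u $ i $ m * v $ m $ i)"
      by (rule sum.mono_neutral_right) (use z rk_inj in \<open>auto, metis linorder_neqE_nat\<close>)
    then show ?thesis
      using assms by (simp add: matrix_matrix_mult_def unitri_def)
  qed
  have l: "(u ** v) $ i $ j = 0" if "rk j < rk i" for i j
  proof -
    have "u $ i $ m * v $ m $ j = 0" for m
      using that by (intro z) linarith
    then show ?thesis
      by (simp add: matrix_matrix_mult_def sum.neutral del: mult_eq_0_iff)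
  qed
  show "unitri (u ** v)"
    using d l by (auto simp: unitri_def)
  have s: "(u ** v) $ i $ j = u $ i $ j + v $ i $ j" if "rk j = Suc (rk i)" for i j
  proof -
    have "(\<Sum>m\<in>UNIV. u $ i $ m * v $ m $ j) = (\<Sum>m\<in>{i, j}. u $ i $ m * v $ m $ j)"
    proof (rule sum.mono_neutral_right)
      show "\<forall>m\<in>UNIV - {i, j}. u $ i $ m * v $ m $ j = 0"
      proof
        fix m assume "m \<in> UNIV - {i, j}"
        then have "rk m \<noteq> rk i" "rk m \<noteq> rk j" by (simp_all add: rk_inj)
        then show "u $ i $ m * v $ m $ j = 0"
          using that by (intro z) linarith
      qed
    qed auto
    moreover have "i \<noteq> j" using that by auto
    ultimately show ?thesis
      using assms by (simp add: matrix_matrix_mult_def unitri_def add.commute)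
  qed
  show "(u ** v) $ 1 $ 2 = u $ 1 $ 2 + v $ 1 $ 2" "(u ** v) $ 5 $ 1 = u $ 5 $ 1 + v $ 5 $ 1"
    by (rule s, simp add: rk)+
qed

lemma carrier_U_G2_induct [consumes 1, case_names one x_pos mult]:
  assumes "u \<in> carrier U_G2"
    and "P (mat 1)" and "\<And>\<gamma> r. P (x_pos \<gamma> r)"
    and "\<And>u v. \<lbrakk>u \<in> carrier U_G2; P u; v \<in> carrier U_G2; P v\<rbrakk> \<Longrightarrow> P (u ** v)"
  shows "P u"
proof -
  have "u \<in> generate GL (\<Union>\<gamma>. range (x_pos \<gamma>))"
    using assms(1) by (simp add: root_generated_def)
  then show ?thesis
  proof induction
    case one
    show ?case using assms(2) by (simp add: GL_def)
  next
    case (incl h)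
    then show ?case using assms(3) by auto
  next
    case (inv h)
    then show ?case using assms(3) by (auto simp: inv_x_pos)
  next
    case (eng h1 h2)
    then show ?case using assms(4)[of h1 h2] by (simp add: root_generated_def GL_def)
  qed
qed

lemma x_pos_U_G2: "x_pos \<gamma> r \<in> carrier U_G2"
  by (auto simp: root_generated_def intro!: generate.incl)

lemma unitri_U_G2: "u \<in> carrier U_G2 \<Longrightarrow> unitri u"
  by (induction rule: carrier_U_G2_induct)
    (auto simp: unitri_mult x_pos_unitri, auto simp: unitri_def mat_def)

lemma ex1_psi_U:
  assumes "nontrivial_additive_char \<psi>"
  shows "\<exists>!\<theta>. is_psi_U \<psi> \<theta>"
proof (rule ex_ex1I)
  have \<psi>: "\<psi> 0 = 1" "\<psi> (x + y) = \<psi> x * \<psi> y" for x y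
    using assms by (auto simp: nontrivial_additive_char_def)
  have nz: "\<psi> x \<noteq> 0" for x
    using \<psi>(2)[of x "- x"] \<psi>(1) by auto
  define \<theta> where "\<theta> = restrict (\<lambda>u. \<psi> (u $ 1 $ 2 - u $ 5 $ 1)) (carrier U_G2)"
  have mult_closed: "u ** v \<in> carrier U_G2" if "u \<in> carrier U_G2" "v \<in> carrier U_G2" for u v :: "'a^7^7"
    using that generate.eng[of u GL _ v] by (simp add: root_generated_def GL_def)
  have "\<theta> \<in> hom U_G2 Cstar"
  proof (rule homI)
    fix u v :: "'a^7^7" assume uv: "u \<in> carrier U_G2" "v \<in> carrier U_G2"
    have "u \<otimes>\<^bsub>U_G2\<^esub> v = u ** v" by (simp add: root_generated_def GL_def)
    moreover have "u $ 1 $ 2 + v $ 1 $ 2 - (u $ 5 $ 1 + v $ 5 $ 1)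
        = (u $ 1 $ 2 - u $ 5 $ 1) + (v $ 1 $ 2 - v $ 5 $ 1)"
      by simp
    ultimately show "\<theta> (u \<otimes>\<^bsub>U_G2\<^esub> v) = \<theta> u \<otimes>\<^bsub>Cstar\<^esub> \<theta> v"
      using uv mult_closed[OF uv] unitri_mult[OF uv[THEN unitri_U_G2]]
      by (simp only: \<theta>_def restrict_apply' \<psi>(2)) (simp add: Cstar_def)
  qed (simp add: \<theta>_def Cstar_def nz)
  moreover have "\<theta> (x_pos \<gamma> r) = (if \<gamma> \<in> {Alpha, Beta} then \<psi> r else 1)" for \<gamma> r
    by (cases \<gamma>) (simp_all only: \<theta>_def restrict_apply' x_pos_U_G2,
      simp_all add: E7_def mat_def \<psi>)
  ultimately show "\<exists>\<theta>. is_psi_U \<psi> \<theta>"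
    unfolding is_psi_U_def by (intro exI[of _ \<theta>]) (auto simp: \<theta>_def)
next
  fix \<theta> \<theta>' assume A: "is_psi_U \<psi> \<theta>" "is_psi_U \<psi> \<theta>'"
  have h: "f (mat 1) = 1" "f (u ** v) = f u * f v"
    if "is_psi_U \<psi> f" "u \<in> carrier U_G2" "v \<in> carrier U_G2" for f u v
  proof -
    have f: "f \<in> hom U_G2 Cstar" using that(1) by (simp add: is_psi_U_def)
    show "f (u ** v) = f u * f v"
      using hom_mult[OF f that(2,3)] by (simp add: root_generated_def GL_def Cstar_def)
    have m: "mat 1 \<in> carrier (U_G2 :: ('a^7^7) monoid)"
      using generate.one[of GL] by (simp add: root_generated_def GL_def)
    have "f (mat 1 ** mat 1) = f (mat 1) * f (mat 1)"
      using hom_mult[OF f m m] by (simp add: root_generated_def GL_def Cstar_def)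
    moreover have "f (mat 1) \<noteq> 0"
      using hom_in_carrier[OF f m] by (simp add: Cstar_def)
    ultimately show "f (mat 1) = 1" by simp
  qed
  have "\<theta> u = \<theta>' u" if "u \<in> carrier U_G2" for u
    using that
  proof (induction rule: carrier_U_G2_induct)
    case one
    then show ?case using h(1)[OF A(1) x_pos_U_G2 x_pos_U_G2] h(1)[OF A(2) x_pos_U_G2 x_pos_U_G2]
      by simp
  next
    case (x_pos \<gamma> r)
    then show ?case using A by (simp add: is_psi_U_def)
  next
    case (mult u v)
    then show ?case using h(2)[OF A(1)] h(2)[OF A(2)] by simp
  qed
  then show "\<theta> = \<theta>'"
    using A by (auto simp: is_psi_U_def intro: extensionalityI)
qed

lemma is_psi_U_psi_U: "nontrivial_additive_char \<psi> \<Longrightarrow> is_psi_U \<psi> (psi_U \<psi>)"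
  using theI'[OF ex1_psi_U] by (simp add: psi_U_def)

lemma vector_7:
  fixes x1 x2 x3 x4 x5 x6 x7 :: "'a::zero"
  shows "(vector [x1, x2, x3, x4, x5, x6, x7] :: 'a ^ 7) $ 1 = x1"
    "(vector [x1, x2, x3, x4, x5, x6, x7] :: 'a ^ 7) $ 2 = x2"
    "(vector [x1, x2, x3, x4, x5, x6, x7] :: 'a ^ 7) $ 3 = x3"
    "(vector [x1, x2, x3, x4, x5, x6, x7] :: 'a ^ 7) $ 4 = x4"
    "(vector [x1, x2, x3, x4, x5, x6, x7] :: 'a ^ 7) $ 5 = x5"
    "(vector [x1, x2, x3, x4, x5, x6, x7] :: 'a ^ 7) $ 6 = x6"
    "(vector [x1, x2, x3, x4, x5, x6, x7] :: 'a ^ 7) $ 7 = x7"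
  by (simp_all add: vector_def)

lemma diag3_N_tilde:
  assumes "n \<in> N_tilde"
  shows "(diag3 a b d ** n) $ 1 $ 1 = a $ 1 $ 1" "(diag3 a b d ** n) $ 1 $ 2 = a $ 1 $ 2"
    "(diag3 a b d ** n) $ 2 $ 1 = a $ 2 $ 1" "(diag3 a b d ** n) $ 2 $ 2 = a $ 2 $ 2"
proof -
  have "n $ i $ j = (if i = j then 1 else 0)" if "blk i = blk j" for i j
    using assms that by (simp add: N_tilde_def)
  then have "n $ 1 $ 1 = 1" "n $ 1 $ 2 = 0" "n $ 2 $ 1 = 0" "n $ 2 $ 2 = 1"
    by (simp_all add: blk_def)
  then show "(diag3 a b d ** n) $ 1 $ 1 = a $ 1 $ 1" "(diag3 a b d ** n) $ 1 $ 2 = a $ 1 $ 2"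
    "(diag3 a b d ** n) $ 2 $ 1 = a $ 2 $ 1" "(diag3 a b d ** n) $ 2 $ 2 = a $ 2 $ 2"
    by (simp_all add: matrix_matrix_mult_def sum_7 diag3_def vector_7)
qed

lemma GL2_part_eq:
  assumes "a \<in> carrier GL" "b \<in> carrier SO3" "n \<in> N_tilde"
  shows "GL2_part (diag3 a b (star a) ** n) = a"
  unfolding GL2_part_def
proof (rule the_equality)
  show "a \<in> carrier GL \<and> (\<exists>b'\<in>carrier SO3. \<exists>n'\<in>N_tilde.
      diag3 a b (star a) ** n = diag3 a b' (star a) ** n')"
    using assms by blast
next
  fix a' assume "a' \<in> carrier GL \<and> (\<exists>b'\<in>carrier SO3. \<exists>n'\<in>N_tilde.
      diag3 a b (star a) ** n = diag3 a' b' (star a') ** n')"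
  then obtain b' n' where n': "n' \<in> N_tilde"
    and eq: "diag3 a b (star a) ** n = diag3 a' b' (star a') ** n'"
    by blast
  show "a' = a"
    using diag3_N_tilde[OF assms(3), of a b "star a"] diag3_N_tilde[OF n', of a' b' "star a'"]
    unfolding eq by (simp add: vec_eq_iff forall_2)
qed

end

theory Submission
  imports Defs "HOL-Computational_Algebra.Fundamental_Theorem_Algebra"
begin

text \<open>
  By Mackey theory, the restriction of \<open>I(\<tau>)\<close> to \<open>G\<^sub>2\<close> decomposes along the two orbits of \<open>G\<^sub>2\<close> on
  the isotropic planes of the seven-dimensional quadratic space. On the closed orbit the
  stabiliser is a parabolic subgroup whose unipotent radical acts trivially on the inducing
  representation, so cuspidality of \<open>\<Pi>\<close> kills its contribution. The open orbit contributes
  the maps from \<open>\<tau>\<close> to the vectors of \<open>\<Pi>\<close> fixed by the root subgroups of \<open>2\<alpha>+\<beta>\<close>, \<open>3\<alpha>+\<beta>\<close> and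
  \<open>3\<alpha>+2\<beta>\<close> that are equivariant under the Levi subgroup \<open>GL\<^sub>2\<close> with root \<open>\<beta>\<close>. Fourier analysis
  along \<open>\<alpha>\<close>, \<open>\<alpha>+\<beta>\<close> and \<open>\<beta>\<close> and cuspidality leave only generic characters, which are conjugate
  under the Levi subgroup; hence such a map is determined by its composition with the projection
  to Whittaker vectors. Whittaker vectors are unique for both groups by Gelfand's trick, applied
  to the Bruhat decomposition. Conversely, a nonzero intertwining map is obtained by averaging a
  Whittaker functional of \<open>\<tau>\<close> against a Whittaker vector of \<open>\<Pi>\<close>.
\<close>

section \<open>Representations of finite groups\<close>

text \<open>Mackey theory enters only through the functions \<open>delta s v\<close>, each supported
  on one coset of \<open>P_tilde\<close>: an intertwining map is determined by its values on them,
  so the restricted representation never has to be decomposed. The obstacle is that the open-orbit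
  plane is not stabilised by a parabolic subgroup of \<open>G2\<close>: of the five root subgroups
  in the unipotent radical of the parabolic subgroup with Levi root \<beta>, only the three in
  \<open>U3\<close> preserve it. Cuspidality therefore does not apply directly, and the directions
  \<alpha> and \<alpha>+\<beta> are handled inside a space \<open>K\<close> whose definition already
  makes it stable under the whole parabolic subgroup. The coefficients 3 in the commutator
  relations, which vanish in characteristic 3, do no harm: they sit in the root subgroups of
  \<open>U3\<close>, which act trivially on \<open>K\<close>. The averaged map is nonzero because
  nothing cancels in the Whittaker projection of its value at \<open>delta (mat 1) v\<close>:
  irrelevant elements contribute zero, and the relevant elements of \<open>P_tilde\<close> in
  \<open>G2\<close> all lie in \<open>U_G2\<close>, where the summands are equal.\<close>

lemma exists_eigenvector:
  fixes s :: "complex \<Rightarrow> 'v::ab_group_add \<Rightarrow> 'v"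
  assumes "vector_space s" and W: "module.subspace s W" "W \<noteq> {0}"
    and B: "finite B" "W \<subseteq> module.span s B"
    and T: "T ` W \<subseteq> W" "linear_on W s s T"
  shows "\<exists>c. \<exists>v\<in>W. v \<noteq> 0 \<and> T v = s c v"
proof -
  interpret vector_space s by fact
  obtain v where v: "v \<in> W" "v \<noteq> 0"
    using W subspace_0 by blast
  have pow: "(T ^^ i) v \<in> W" for i
    by (induction i) (use v T in auto)
  have T_sum: "T (\<Sum>i\<in>I. s (c i) (x i)) = (\<Sum>i\<in>I. s (c i) (T (x i)))"
    if "finite I" "\<And>i. x i \<in> W" for I :: "nat set" and c x
    using that(1)
  proof induction
    case empty
    have "T (s 0 v) = s 0 (T v)" using T(2) v(1) unfolding linear_on_def by blast
    then show ?case by simp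
  next
    case (insert i I)
    have m: "s (c i) (x i) \<in> W" "(\<Sum>i\<in>I. s (c i) (x i)) \<in> W"
      using that(2) W by (auto intro!: subspace_sum subspace_scale)
    have "T (s (c i) (x i) + (\<Sum>i\<in>I. s (c i) (x i))) = T (s (c i) (x i)) + T (\<Sum>i\<in>I. s (c i) (x i))"
      using m T(2) unfolding linear_on_def by blast
    moreover have "T (s (c i) (x i)) = s (c i) (T (x i))"
      using that(2) T(2) unfolding linear_on_def by blast
    ultimately show ?case using insert by simp
  qed
  define ev where "ev N p = (\<Sum>i\<le>N. s (coeff p i) ((T ^^ i) v))" for N p
  have ev_degree: "ev N p = ev (degree p) p" if "degree p \<le> N" for N p
    unfolding ev_def by (rule sum.mono_neutral_right) (use that in \<open>auto simp: coeff_eq_0\<close>)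
  \<comment> \<open>The sum \<open>ev N p\<close> is p(T)v once N bounds the degree of p. The
    \<open>card B + 1\<close> vectors T^i v are either dependent or not pairwise distinct, and both
    cases give a nonzero annihilating polynomial.\<close>
  have "\<exists>p. p \<noteq> 0 \<and> ev (degree p) p = 0"
  proof -
    let ?n = "card B"
    have "\<exists>c. (\<exists>i\<le>?n. c i \<noteq> 0) \<and> (\<Sum>i\<le>?n. s (c i) ((T ^^ i) v)) = 0"
    proof (cases "inj_on (\<lambda>i. (T ^^ i) v) {..?n}")
      case True
      let ?S = "(\<lambda>i. (T ^^ i) v) ` {..?n}"
      have "dependent ?S"
      proof (rule ccontr)
        assume "independent ?S"
        then have "card ?S \<le> card B"
          using independent_span_bound[OF B(1), of ?S] pow B(2) by auto
        then show False using True by (simp add: card_image)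
      qed
      then obtain u where u: "\<exists>w\<in>?S. u w \<noteq> 0" "(\<Sum>w\<in>?S. s (u w) w) = 0"
        by (subst (asm) dependent_finite) auto
      show ?thesis
        by (rule exI[of _ "\<lambda>i. u ((T ^^ i) v)"]) (use u True in \<open>auto simp: sum.reindex\<close>)
    next
      case False
      then obtain i j where ij: "i \<le> ?n" "j \<le> ?n" "i \<noteq> j" "(T ^^ i) v = (T ^^ j) v"
        by (auto simp: inj_on_def)
      let ?c = "\<lambda>m. (if m = i then 1 else 0) + (if m = j then - 1 else 0) :: complex"
      have "(\<Sum>m\<le>?n. s (?c m) ((T ^^ m) v)) =
        (\<Sum>m\<le>?n. if m = i then (T ^^ m) v else 0) + (\<Sum>m\<le>?n. if m = j then - ((T ^^ m) v) else 0)"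
        unfolding sum.distrib[symmetric] by (rule sum.cong) (auto simp: scale_left_distrib)
      also have "\<dots> = 0" using ij by simp
      finally show ?thesis using ij by (intro exI[of _ ?c]) auto
    qed
    then obtain c i where c: "i \<le> ?n" "c i \<noteq> 0" "(\<Sum>i\<le>?n. s (c i) ((T ^^ i) v)) = 0"
      by blast
    define p where "p = (\<Sum>i\<le>?n. monom (c i) i)"
    have cf: "coeff p m = (if m \<le> ?n then c m else 0)" for m
      by (simp add: p_def coeff_sum)
    then have "degree p \<le> ?n"
      by (intro degree_le) auto
    then have "ev (degree p) p = 0"
      using ev_degree[of p ?n] c(3) by (simp add: ev_def cf)
    moreover have "p \<noteq> 0" using cf[of i] c by auto
    ultimately show ?thesis by blast
  qed
  then obtain p where p: "p \<noteq> 0" "ev (degree p) p = 0"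
    and least: "\<And>q. q \<noteq> 0 \<Longrightarrow> degree q < degree p \<Longrightarrow> ev (degree q) q \<noteq> 0"
    using arg_min_nat_lemma[of "\<lambda>p. p \<noteq> 0 \<and> ev (degree p) p = 0" _ degree]
    by (metis (no_types, lifting) not_less)
  have "degree p \<noteq> 0"
  proof
    assume "degree p = 0"
    then have "s (coeff p 0) v = 0" "coeff p 0 \<noteq> 0"
      using p leading_coeff_0_iff[of p] by (auto simp: ev_def)
    then show False using v by simp
  qed
  then obtain z where "poly p z = 0"
    using fundamental_theorem_of_algebra constant_degree by metis
  then obtain q where q: "p = [:- z, 1:] * q"
    by (metis dvdE poly_eq_0_iff_dvd)
  have q0: "q \<noteq> 0"
    using p(1) q by auto
  have dq: "degree p = Suc (degree q)"
    unfolding q using q0 by (subst degree_mult_eq) auto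
  \<comment> \<open>Since p = (X - z) q annihilates v in least degree, q(T)v is nonzero, and T - z
    kills it.\<close>
  define u where "u = ev (degree q) q"
  have "u \<in> W"
    unfolding u_def ev_def using W pow by (intro subspace_sum subspace_scale)
  moreover have "u \<noteq> 0"
    using least q0 dq unfolding u_def by simp
  moreover have "T u = s z u"
  proof -
    have cp: "coeff p i = (case i of 0 \<Rightarrow> 0 | Suc j \<Rightarrow> coeff q j) - z * coeff q i" for i
      unfolding q by (simp add: coeff_pCons)
    have "ev (Suc (degree q)) p = (\<Sum>i\<le>Suc (degree q). s (case i of 0 \<Rightarrow> 0 | Suc j \<Rightarrow> coeff q j) ((T ^^ i) v))
       - (\<Sum>i\<le>Suc (degree q). s (z * coeff q i) ((T ^^ i) v))"
      unfolding ev_def cp by (simp only: scale_left_diff_distrib sum_subtractf)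
    also have "(\<Sum>i\<le>Suc (degree q). s (case i of 0 \<Rightarrow> 0 | Suc j \<Rightarrow> coeff q j) ((T ^^ i) v)) = T u"
      unfolding sum.atMost_Suc_shift u_def ev_def using T_sum[of "{..degree q}" "\<lambda>i. (T ^^ i) v" "coeff q"] pow
      by simp
    also have "(\<Sum>i\<le>Suc (degree q). s (z * coeff q i) ((T ^^ i) v)) = s z (ev (Suc (degree q)) q)"
      unfolding ev_def scale_sum_right by simp
    also have "ev (Suc (degree q)) q = u"
      unfolding u_def by (rule ev_degree) simp
    finally show ?thesis
      using p(2) dq by simp
  qed
  ultimately show ?thesis by blast
qed

section \<open>The action of the group algebra\<close>

locale finite_rep =
  fixes G :: "('g, 'b) monoid_scheme" (structure) and \<pi> :: "('g, 'v::ab_group_add) rep"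
  assumes rep: "representation G \<pi>" and fin: "finite (carrier G)"
begin

abbreviation V where "V \<equiv> vspace \<pi>"
abbreviation sm (infixr "*v*" 75) where "sm \<equiv> smult \<pi>"

sublocale group G
  using rep by (simp add: representation_def)

sublocale vs: vector_space sm
  using rep by (simp add: representation_def)

lemma subspace_V: "vs.subspace V"
  using rep by (simp add: representation_def)

lemma act_closed [simp]: "g \<in> carrier G \<Longrightarrow> v \<in> V \<Longrightarrow> act \<pi> g v \<in> V"
  using rep unfolding representation_def by blast

lemma act_linear: "g \<in> carrier G \<Longrightarrow> linear_on V sm sm (act \<pi> g)"
  using rep by (simp add: representation_def)

lemma act_add: "g \<in> carrier G \<Longrightarrow> v \<in> V \<Longrightarrow> w \<in> V \<Longrightarrow> act \<pi> g (v + w) = act \<pi> g v + act \<pi> g w"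
  using act_linear unfolding linear_on_def by blast

lemma act_scale: "g \<in> carrier G \<Longrightarrow> v \<in> V \<Longrightarrow> act \<pi> g (c *v* v) = c *v* act \<pi> g v"
  using act_linear unfolding linear_on_def by blast

lemma act_one [simp]: "v \<in> V \<Longrightarrow> act \<pi> \<one> v = v"
  using rep by (simp add: representation_def)

lemma act_mult: "g \<in> carrier G \<Longrightarrow> h \<in> carrier G \<Longrightarrow> v \<in> V \<Longrightarrow> act \<pi> (g \<otimes> h) v = act \<pi> g (act \<pi> h v)"
  using rep by (simp add: representation_def)

lemma zero_V [simp]: "0 \<in> V"
  using vs.subspace_0[OF subspace_V] .

lemma add_V [simp]: "v \<in> V \<Longrightarrow> w \<in> V \<Longrightarrow> v + w \<in> V"
  using vs.subspace_add[OF subspace_V] .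

lemma scale_V [simp]: "v \<in> V \<Longrightarrow> c *v* v \<in> V"
  using vs.subspace_scale[OF subspace_V] .

lemma sum_V [simp]: "(\<And>i. i \<in> I \<Longrightarrow> f i \<in> V) \<Longrightarrow> sum f I \<in> V"
  using vs.subspace_sum[OF subspace_V] .

lemma act_zero [simp]: "g \<in> carrier G \<Longrightarrow> act \<pi> g 0 = 0"
  using act_scale[of g 0 0] by simp

lemma act_sum: "g \<in> carrier G \<Longrightarrow> (\<And>i. i \<in> I \<Longrightarrow> f i \<in> V) \<Longrightarrow> act \<pi> g (sum f I) = (\<Sum>i\<in>I. act \<pi> g (f i))"
  by (induction I rule: infinite_finite_induct) (auto simp: act_add)

lemma inv_mult_cancel [simp]:
  "x \<in> carrier G \<Longrightarrow> y \<in> carrier G \<Longrightarrow> inv x \<otimes> (x \<otimes> y) = y"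
  "x \<in> carrier G \<Longrightarrow> y \<in> carrier G \<Longrightarrow> x \<otimes> (inv x \<otimes> y) = y"
  by (simp_all add: m_assoc[symmetric])

lemma act_inv_cancel: "g \<in> carrier G \<Longrightarrow> v \<in> V \<Longrightarrow> act \<pi> (inv g) (act \<pi> g v) = v"
  by (metis act_mult act_one inv_closed l_inv)

lemma act_eq_0: "g \<in> carrier G \<Longrightarrow> v \<in> V \<Longrightarrow> act \<pi> g v = 0 \<longleftrightarrow> v = 0"
  by (metis act_inv_cancel act_zero inv_closed)

definition op where "op f v = (\<Sum>g\<in>carrier G. f g *v* act \<pi> g v)"

definition conv where "conv f f' z = (\<Sum>x\<in>carrier G. f x * f' (inv x \<otimes> z))" for f f' :: "'g \<Rightarrow> complex"

lemma op_closed [simp]: "v \<in> V \<Longrightarrow> op f v \<in> V"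
  by (simp add: op_def)

lemma sum_left_mult: "g \<in> carrier G \<Longrightarrow> (\<Sum>x\<in>carrier G. f (g \<otimes> x)) = (\<Sum>x\<in>carrier G. f x)"
  by (rule sum.reindex_bij_witness[of _ "\<lambda>x. inv g \<otimes> x" "\<lambda>x. g \<otimes> x"])
    (auto simp: m_assoc[symmetric])

lemma sum_right_mult: "g \<in> carrier G \<Longrightarrow> (\<Sum>x\<in>carrier G. f (x \<otimes> g)) = (\<Sum>x\<in>carrier G. f x)"
  by (rule sum.reindex_bij_witness[of _ "\<lambda>x. x \<otimes> inv g" "\<lambda>x. x \<otimes> g"])
    (auto simp: m_assoc)

lemma op_op: 
  assumes "v \<in> V"
  shows "op f (op f' v) = op (conv f f') v"
proof -
  have "op f (op f' v) = (\<Sum>x\<in>carrier G. \<Sum>y\<in>carrier G. (f x * f' y) *v* act \<pi> (x \<otimes> y) v)"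
    unfolding op_def
    by (intro sum.cong refl) (simp add: act_sum act_scale act_mult assms vs.scale_sum_right)
  also have "\<dots> = (\<Sum>x\<in>carrier G. \<Sum>z\<in>carrier G. (f x * f' (inv x \<otimes> z)) *v* act \<pi> z v)"
  proof (rule sum.cong[OF refl])
    fix x assume x: "x \<in> carrier G"
    show "(\<Sum>y\<in>carrier G. (f x * f' y) *v* act \<pi> (x \<otimes> y) v) = (\<Sum>z\<in>carrier G. (f x * f' (inv x \<otimes> z)) *v* act \<pi> z v)"
      using x by (subst sum_left_mult[OF x, symmetric]) (intro sum.cong refl, simp add: m_assoc[symmetric])
  qed
  also have "\<dots> = op (conv f f') v"
    unfolding op_def conv_def vs.scale_sum_left by (rule sum.swap)
  finally show ?thesis .
qed

end

section \<open>Eigenvectors of a character of a subgroup and their Hecke algebra\<close>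

locale twisted = finite_rep G \<pi> for G (structure) and \<pi> :: "('g, 'v::ab_group_add) rep" +
  fixes U :: "'g set" and \<theta> :: "'g \<Rightarrow> complex"
  assumes U: "subgroup U G"
    and \<theta>_nz: "u \<in> U \<Longrightarrow> \<theta> u \<noteq> 0"
    and \<theta>_mult: "u \<in> U \<Longrightarrow> u' \<in> U \<Longrightarrow> \<theta> (u \<otimes> u') = \<theta> u * \<theta> u'"
begin

lemma U_carrier [simp]: "u \<in> U \<Longrightarrow> u \<in> carrier G"
  using subgroup.mem_carrier[OF U] .

lemma U_inv [simp]: "u \<in> U \<Longrightarrow> inv u \<in> U"
  using subgroup.m_inv_closed[OF U] .

lemma U_mult [simp]: "u \<in> U \<Longrightarrow> u' \<in> U \<Longrightarrow> u \<otimes> u' \<in> U"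
  using subgroup.m_closed[OF U] .

lemma U_one [simp]: "\<one> \<in> U"
  using subgroup.one_closed[OF U] .

lemma finite_U [simp]: "finite U"
  using fin U subgroup.subset finite_subset by blast

lemma card_U: "card U \<noteq> 0"
  using U_one finite_U by (metis card_0_eq empty_iff)

lemma \<theta>_one: "\<theta> \<one> = 1"
  using \<theta>_mult[of \<one> \<one>] \<theta>_nz[of \<one>] by simp

lemma \<theta>_inv: "u \<in> U \<Longrightarrow> \<theta> (inv u) = 1 / \<theta> u"
  using \<theta>_mult[of "inv u" u] \<theta>_nz[of u] by (simp add: \<theta>_one field_simps)

definition W where "W = {v \<in> V. \<forall>u\<in>U. act \<pi> u v = \<theta> u *v* v}"

lemma W_V: "v \<in> W \<Longrightarrow> v \<in> V"
  by (simp add: W_def)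

lemma act_W: "v \<in> W \<Longrightarrow> u \<in> U \<Longrightarrow> act \<pi> u v = \<theta> u *v* v"
  by (simp add: W_def)

lemma subspace_W: "vs.subspace W"
  by (rule vs.subspaceI) (auto simp: W_def act_add act_scale vs.scale_right_distrib mult.commute)

text \<open>This is \<open>card U\<close> times the projection onto \<open>W\<close>; the missing
  division is made up for by \<open>e_W\<close> and \<open>card_U\<close>.\<close>

definition e where "e v = (\<Sum>u\<in>U. (1 / \<theta> u) *v* act \<pi> u v)"

lemma sum_U_left: "g \<in> U \<Longrightarrow> (\<Sum>x\<in>U. f (g \<otimes> x)) = (\<Sum>x\<in>U. f x)"
  by (rule sum.reindex_bij_witness[of _ "\<lambda>x. inv g \<otimes> x" "\<lambda>x. g \<otimes> x"])
    (auto simp: m_assoc[symmetric])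

lemma sum_U_right: "g \<in> U \<Longrightarrow> (\<Sum>x\<in>U. f (x \<otimes> g)) = (\<Sum>x\<in>U. f x)"
  by (rule sum.reindex_bij_witness[of _ "\<lambda>x. x \<otimes> inv g" "\<lambda>x. x \<otimes> g"])
    (auto simp: m_assoc)

lemma e_V [simp]: "v \<in> V \<Longrightarrow> e v \<in> V"
  by (simp add: e_def)

lemma e_act: "u \<in> U \<Longrightarrow> v \<in> V \<Longrightarrow> e (act \<pi> u v) = \<theta> u *v* e v"
  unfolding e_def
  by (subst (2) sum_U_right[of u, symmetric])
    (auto simp: vs.scale_sum_right act_mult \<theta>_mult \<theta>_nz intro!: sum.cong)

lemma act_e: "u \<in> U \<Longrightarrow> v \<in> V \<Longrightarrow> act \<pi> u (e v) = \<theta> u *v* e v"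
  unfolding e_def
  by (subst (2) sum_U_left[of u, symmetric])
    (auto simp: vs.scale_sum_right act_mult act_sum act_scale \<theta>_mult \<theta>_nz intro!: sum.cong)

lemma e_in_W: "v \<in> V \<Longrightarrow> e v \<in> W"
  by (simp add: W_def act_e)

lemma e_W: "v \<in> W \<Longrightarrow> e v = of_nat (card U) *v* v"
  by (simp add: e_def act_W \<theta>_nz vs.sum_constant_scale)

lemma e_add: "v \<in> V \<Longrightarrow> w \<in> V \<Longrightarrow> e (v + w) = e v + e w"
  by (simp add: e_def act_add vs.scale_right_distrib sum.distrib)

lemma e_scale: "v \<in> V \<Longrightarrow> e (c *v* v) = c *v* e v"
  by (simp add: e_def act_scale vs.scale_sum_right mult.commute)

lemma e_zero [simp]: "e 0 = 0"
  using e_scale[of 0 0] by simp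

lemma e_sum: "(\<And>i. i \<in> I \<Longrightarrow> f i \<in> V) \<Longrightarrow> e (sum f I) = (\<Sum>i\<in>I. e (f i))"
  by (induction I rule: infinite_finite_induct) (auto simp: e_add)

text \<open>The double coset of such an element supports no Whittaker function.\<close>

definition irrelevant where
  "irrelevant g \<longleftrightarrow> (\<exists>x\<in>U. \<exists>y\<in>U. g \<otimes> x = y \<otimes> g \<and> \<theta> x \<noteq> \<theta> y)"

text \<open>Writing \<open>g \<otimes> x\<close> as \<open>y \<otimes> g\<close> evaluates the same
  projection in two ways, with the factors \<open>\<theta> x\<close> and
  \<open>\<theta> y\<close>.\<close>

lemma e_irrelevant:
  assumes "g \<in> carrier G" "irrelevant g" "w \<in> W"
  shows "e (act \<pi> g w) = 0"
proof -
  obtain x y where xy: "x \<in> U" "y \<in> U" "g \<otimes> x = y \<otimes> g" "\<theta> x \<noteq> \<theta> y"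
    using assms by (auto simp: irrelevant_def)
  have "\<theta> x *v* e (act \<pi> g w) = e (act \<pi> g (act \<pi> x w))"
    using assms xy by (simp add: act_W act_scale e_scale W_V)
  also have "\<dots> = e (act \<pi> y (act \<pi> g w))"
    using assms xy by (metis act_mult U_carrier W_V)
  also have "\<dots> = \<theta> y *v* e (act \<pi> g w)"
    using assms xy by (simp add: e_act W_V)
  finally show ?thesis using xy by simp
qed

text \<open>The functions of the Hecke algebra. They transform by the inverse of \<theta> on both
  sides, because \<open>op f\<close> sums \<open>f g\<close> against the action of g and has to take
  values in \<open>W\<close>.\<close>

definition biequivariant :: "('g \<Rightarrow> complex) \<Rightarrow> bool" where
  "biequivariant f \<longleftrightarrow> (\<forall>u\<in>U. \<forall>u'\<in>U. \<forall>g\<in>carrier G. f (u \<otimes> g \<otimes> u') * \<theta> u * \<theta> u' = f g)"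

lemma biequivariant_left: "biequivariant f \<Longrightarrow> u \<in> U \<Longrightarrow> g \<in> carrier G \<Longrightarrow> f (u \<otimes> g) * \<theta> u = f g"
  unfolding biequivariant_def using \<theta>_one U_one by (metis U_carrier m_closed mult.right_neutral r_one)

lemma biequivariant_right: "biequivariant f \<Longrightarrow> u \<in> U \<Longrightarrow> g \<in> carrier G \<Longrightarrow> f (g \<otimes> u) * \<theta> u = f g"
  unfolding biequivariant_def using \<theta>_one U_one by (metis l_one mult.right_neutral)

lemma biequivariant_irrelevant:
  assumes "biequivariant f" "irrelevant g" "g \<in> carrier G"
  shows "f g = 0"
proof -
  obtain x y where xy: "x \<in> U" "y \<in> U" "g \<otimes> x = y \<otimes> g" "\<theta> x \<noteq> \<theta> y"
    using assms by (auto simp: irrelevant_def)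
  have "f g * \<theta> y = f (g \<otimes> x) * \<theta> x * \<theta> y"
    using biequivariant_right[OF assms(1) xy(1) assms(3)] by simp
  also have "\<dots> = f (y \<otimes> g) * \<theta> y * \<theta> x"
    using xy by simp
  also have "\<dots> = f g * \<theta> x"
    using biequivariant_left[OF assms(1) xy(2) assms(3)] by simp
  finally show ?thesis using xy(4) by simp
qed

lemma op_W: 
  assumes "biequivariant f" "v \<in> V"
  shows "op f v \<in> W"
proof -
  have "act \<pi> u (op f v) = \<theta> u *v* op f v" if u: "u \<in> U" for u
  proof -
    have "act \<pi> u (op f v) = (\<Sum>g\<in>carrier G. f g *v* act \<pi> (u \<otimes> g) v)"
      using assms u by (simp add: op_def act_sum act_scale act_mult)
    also have "\<dots> = (\<Sum>g\<in>carrier G. (\<theta> u * f (u \<otimes> g)) *v* act \<pi> (u \<otimes> g) v)"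
      using biequivariant_left[OF assms(1) u] by (intro sum.cong) (auto simp: mult.commute)
    also have "\<dots> = (\<Sum>g\<in>carrier G. (\<theta> u * f g) *v* act \<pi> g v)"
      using u by (intro sum_left_mult) simp
    finally show ?thesis by (simp add: op_def vs.scale_sum_right)
  qed
  then show ?thesis using assms by (simp add: W_def)
qed

lemma biequivariant_conv:
  assumes f: "biequivariant f" and f': "biequivariant f'"
  shows "biequivariant (conv f f')"
  unfolding biequivariant_def
proof (intro ballI)
  fix u u' g assume u: "u \<in> U" and u': "u' \<in> U" and g: "g \<in> carrier G"
  have "conv f f' (u \<otimes> g \<otimes> u') = (\<Sum>x\<in>carrier G. f (u \<otimes> x) * f' (inv (u \<otimes> x) \<otimes> (u \<otimes> g \<otimes> u')))"
    unfolding conv_def using u by (subst sum_left_mult[of u, symmetric]) auto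
  also have "\<dots> = (\<Sum>x\<in>carrier G. f (u \<otimes> x) * f' ((inv x \<otimes> g) \<otimes> u'))"
  proof (intro sum.cong refl)
    fix x assume x: "x \<in> carrier G"
    have "inv (u \<otimes> x) \<otimes> (u \<otimes> g \<otimes> u') = inv x \<otimes> (inv u \<otimes> u) \<otimes> g \<otimes> u'"
      using u u' g x by (simp add: inv_mult_group m_assoc)
    then show "f (u \<otimes> x) * f' (inv (u \<otimes> x) \<otimes> (u \<otimes> g \<otimes> u')) = f (u \<otimes> x) * f' ((inv x \<otimes> g) \<otimes> u')"
      using u x by simp
  qed
  finally have "conv f f' (u \<otimes> g \<otimes> u') * \<theta> u * \<theta> u' =
     (\<Sum>x\<in>carrier G. (f (u \<otimes> x) * \<theta> u) * (f' ((inv x \<otimes> g) \<otimes> u') * \<theta> u'))"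
    by (simp add: sum_distrib_left sum_distrib_right mult_ac)
  also have "\<dots> = conv f f' g"
    unfolding conv_def by (intro sum.cong) (auto simp: biequivariant_left[OF f u] biequivariant_right[OF f' u'] g)
  finally show "conv f f' (u \<otimes> g \<otimes> u') * \<theta> u * \<theta> u' = conv f f' g" .
qed

text \<open>The coefficients c are averaged over U on both sides. Right translations act on v, and
  left ones on \<open>op c v = w\<close>, by scalars that the weights cancel; so each of the
  \<open>card U\<close> squared summands yields w.\<close>

lemma exists_biequivariant:
  assumes v: "v \<in> W" and w: "w \<in> W" and wc: "w = op c v"
  shows "\<exists>f. biequivariant f \<and> op f v = w"
proof -
  define f where "f x = (\<Sum>u\<in>U. \<Sum>u'\<in>U. c (u \<otimes> x \<otimes> u') * \<theta> u * \<theta> u')" for x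
  have bi: "biequivariant f"
    unfolding biequivariant_def
  proof (intro ballI)
    fix a b g assume a: "a \<in> U" and b: "b \<in> U" and g: "g \<in> carrier G"
    have "f (a \<otimes> g \<otimes> b) * \<theta> a * \<theta> b = (\<Sum>u\<in>U. \<Sum>u'\<in>U. c ((u \<otimes> a) \<otimes> g \<otimes> (b \<otimes> u')) * \<theta> (u \<otimes> a) * \<theta> (b \<otimes> u'))"
      unfolding f_def sum_distrib_left sum_distrib_right
      using a b g by (intro sum.cong refl) (simp add: m_assoc \<theta>_mult mult_ac)
    also have "\<dots> = (\<Sum>u\<in>U. \<Sum>u'\<in>U. c (u \<otimes> g \<otimes> (b \<otimes> u')) * \<theta> u * \<theta> (b \<otimes> u'))"
      using a by (rule sum_U_right)
    also have "\<dots> = f g"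
      unfolding f_def
    proof (rule sum.cong[OF refl])
      fix u
      show "(\<Sum>u'\<in>U. c (u \<otimes> g \<otimes> (b \<otimes> u')) * \<theta> u * \<theta> (b \<otimes> u')) = (\<Sum>u'\<in>U. c (u \<otimes> g \<otimes> u') * \<theta> u * \<theta> u')"
        by (rule sum_U_left[OF b, of "\<lambda>x. c (u \<otimes> g \<otimes> x) * \<theta> u * \<theta> x"])
    qed
    finally show "f (a \<otimes> g \<otimes> b) * \<theta> a * \<theta> b = f g" .
  qed
  have "op f v = (\<Sum>x\<in>carrier G. \<Sum>u\<in>U. \<Sum>u'\<in>U. (c (u \<otimes> x \<otimes> u') * \<theta> u * \<theta> u') *v* act \<pi> x v)"
    unfolding op_def f_def vs.scale_sum_left ..
  also have "\<dots> = (\<Sum>u\<in>U. \<Sum>x\<in>carrier G. \<Sum>u'\<in>U. (c (u \<otimes> x \<otimes> u') * \<theta> u * \<theta> u') *v* act \<pi> x v)"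
    by (rule sum.swap)
  also have "\<dots> = (\<Sum>u\<in>U. \<Sum>u'\<in>U. \<Sum>x\<in>carrier G. (c (u \<otimes> x \<otimes> u') * \<theta> u * \<theta> u') *v* act \<pi> x v)"
    by (intro sum.cong refl sum.swap)
  also have "\<dots> = (\<Sum>u\<in>U. \<Sum>u'\<in>U. w)"
  proof (intro sum.cong refl)
    fix u u' assume u: "u \<in> U" and u': "u' \<in> U"
    let ?F = "\<lambda>x. (c x * \<theta> u * \<theta> u') *v* act \<pi> (inv u \<otimes> x \<otimes> inv u') v"
    have "(\<Sum>x\<in>carrier G. (c (u \<otimes> x \<otimes> u') * \<theta> u * \<theta> u') *v* act \<pi> x v) = (\<Sum>x\<in>carrier G. ?F (u \<otimes> x \<otimes> u'))"
    proof (intro sum.cong refl)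
      fix x assume x: "x \<in> carrier G"
      have "inv u \<otimes> (u \<otimes> x \<otimes> u') \<otimes> inv u' = (inv u \<otimes> u) \<otimes> x \<otimes> (u' \<otimes> inv u')"
        using u u' x by (simp add: m_assoc del: l_inv r_inv)
      then show "(c (u \<otimes> x \<otimes> u') * \<theta> u * \<theta> u') *v* act \<pi> x v = ?F (u \<otimes> x \<otimes> u')"
        using u u' x by simp
    qed
    also have "\<dots> = (\<Sum>x\<in>carrier G. ?F (x \<otimes> u'))"
      using sum_left_mult[of u "\<lambda>x. ?F (x \<otimes> u')"] u by simp
    also have "\<dots> = (\<Sum>x\<in>carrier G. ?F x)"
      using sum_right_mult[of u' ?F] u' by simp
    also have "\<dots> = (\<Sum>x\<in>carrier G. (c x * \<theta> u) *v* act \<pi> (inv u) (act \<pi> x v))"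
      using u u' v by (intro sum.cong refl)
        (simp add: act_mult W_V act_W act_scale \<theta>_inv \<theta>_nz)
    also have "\<dots> = \<theta> u *v* act \<pi> (inv u) (op c v)"
      using u v by (simp add: op_def act_sum W_V act_scale vs.scale_sum_right mult.commute)
    also have "\<dots> = w"
      using w u wc by (simp add: act_W \<theta>_inv \<theta>_nz)
    finally show "(\<Sum>x\<in>carrier G. (c (u \<otimes> x \<otimes> u') * \<theta> u * \<theta> u') *v* act \<pi> x v) = w" .
  qed
  also have "\<dots> = (of_nat (card U) * of_nat (card U)) *v* w"
    by (simp add: vs.sum_constant_scale)
  finally have eq: "op f v = (of_nat (card U) * of_nat (card U)) *v* w" .
  let ?f = "\<lambda>x. f x / (of_nat (card U) * of_nat (card U))"
  have "biequivariant ?f"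
    using bi by (simp add: biequivariant_def)
  moreover have "op ?f v = (1 / (of_nat (card U) * of_nat (card U))) *v* op f v"
    by (simp add: op_def vs.scale_sum_right)
  then have "op ?f v = w"
    using card_U by (simp add: eq)
  ultimately show ?thesis by blast
qed

end

text \<open>The vectors \<open>op c v\<close> form an invariant subspace containing v.\<close>

lemma (in finite_rep) irreducible_cyclic:
  assumes irr: "irreducible_rep G \<pi>" and v: "v \<in> V" "v \<noteq> 0" and w: "w \<in> V"
  shows "\<exists>c. w = op c v"
proof -
  let ?S = "range (\<lambda>c. op c v)"
  have sub: "vs.subspace ?S"
  proof (rule vs.subspaceI)
    show "0 \<in> ?S" by (rule range_eqI[of _ _ "\<lambda>_. 0"]) (simp add: op_def)
    show "x + y \<in> ?S" if "x \<in> ?S" "y \<in> ?S" for x y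
    proof -
      obtain c d where "x = op c v" "y = op d v" using \<open>x \<in> ?S\<close> \<open>y \<in> ?S\<close> by blast
      then show ?thesis
        by (intro range_eqI[of _ _ "\<lambda>g. c g + d g"]) (simp add: op_def vs.scale_left_distrib sum.distrib)
    qed
    show "a *v* x \<in> ?S" if "x \<in> ?S" for a x
    proof -
      obtain c where "x = op c v" using \<open>x \<in> ?S\<close> by blast
      then show ?thesis
        by (intro range_eqI[of _ _ "\<lambda>g. a * c g"]) (simp add: op_def vs.scale_sum_right)
    qed
  qed
  have "act \<pi> g (op c v) \<in> ?S" if g: "g \<in> carrier G" for g c
  proof (rule range_eqI[of _ _ "\<lambda>x. c (inv g \<otimes> x)"])
    have "act \<pi> g (op c v) = (\<Sum>x\<in>carrier G. c x *v* act \<pi> (g \<otimes> x) v)"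
      using v g by (simp add: op_def act_sum act_scale act_mult)
    also have "\<dots> = (\<Sum>x\<in>carrier G. c (inv g \<otimes> (g \<otimes> x)) *v* act \<pi> (g \<otimes> x) v)"
      using g by (intro sum.cong refl) (simp add: m_assoc[symmetric])
    also have "\<dots> = op (\<lambda>x. c (inv g \<otimes> x)) v"
      unfolding op_def by (rule sum_left_mult[OF g])
    finally show "act \<pi> g (op c v) = op (\<lambda>x. c (inv g \<otimes> x)) v" .
  qed
  then have "?S = {0} \<or> ?S = V"
    using irr sub v unfolding irreducible_rep_def by (metis (no_types, lifting) image_subsetI op_closed rangeE)
  moreover have "op (\<lambda>g. if g = \<one> then 1 else 0) v = v"
  proof -
    have "op (\<lambda>g. if g = \<one> then 1 else 0) v = (\<Sum>g\<in>carrier G. if g = \<one> then v else 0)"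
      unfolding op_def by (intro sum.cong) (use v in auto)
    then show ?thesis using fin by simp
  qed
  ultimately show ?thesis using v w by (metis (no_types, lifting) rangeI rangeE singletonD)
qed

text \<open>An anti-involution that fixes all biequivariant functions makes the Hecke algebra commutative
  (Gelfand's trick); its action on \<open>W\<close> is then irreducible and commutative.\<close>

lemma (in twisted) multiplicity_one:
  assumes irr: "irreducible_rep G \<pi>"
    and closed: "\<And>g. g \<in> carrier G \<Longrightarrow> \<iota> g \<in> carrier G"
    and anti: "\<And>g h. g \<in> carrier G \<Longrightarrow> h \<in> carrier G \<Longrightarrow> \<iota> (g \<otimes> h) = \<iota> h \<otimes> \<iota> g"
    and invol: "\<And>g. g \<in> carrier G \<Longrightarrow> \<iota> (\<iota> g) = g"
    and fixed: "\<And>f g. biequivariant f \<Longrightarrow> g \<in> carrier G \<Longrightarrow> f (\<iota> g) = f g"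
    and v: "v \<in> W" "v \<noteq> 0" and w: "w \<in> W"
  shows "\<exists>c. w = c *v* v"
proof -
  have comm: "op f (op f' x) = op f' (op f x)" if f: "biequivariant f" and f': "biequivariant f'" and x: "x \<in> V" for f f' x
  proof -
    \<comment> \<open>The map \<iota> reverses products and fixes f, f' and their convolution, which
      is again biequivariant; substituting \<iota> in the sum therefore exchanges the two
      factors.\<close>
    have "conv f f' z = conv f' f z" if z: "z \<in> carrier G" for z
    proof -
      have "\<iota> \<one> \<otimes> \<iota> \<one> = \<iota> \<one>" using anti[of \<one> \<one>] by simp
      then have one: "\<iota> \<one> = \<one>" using closed[of \<one>] by simp
      have inv: "inv (\<iota> y) = \<iota> (inv y)" if "y \<in> carrier G" for y
        using that anti[of y "inv y"] closed one by (intro inv_equality) auto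
      have "conv f f' z = conv f f' (\<iota> z)"
        using fixed[OF biequivariant_conv[OF f f'] z] by simp
      also have "\<dots> = (\<Sum>y\<in>carrier G. f (\<iota> y) * f' (inv (\<iota> y) \<otimes> \<iota> z))"
        unfolding conv_def
        by (rule sum.reindex_bij_witness[of _ \<iota> \<iota>]) (auto simp: closed invol)
      also have "\<dots> = (\<Sum>y\<in>carrier G. f y * f' (z \<otimes> inv y))"
      proof (intro sum.cong refl)
        fix y assume y: "y \<in> carrier G"
        have "inv (\<iota> y) \<otimes> \<iota> z = \<iota> (z \<otimes> inv y)"
          using y z by (simp add: inv anti)
        then show "f (\<iota> y) * f' (inv (\<iota> y) \<otimes> \<iota> z) = f y * f' (z \<otimes> inv y)"
          using y z fixed[OF f y] fixed[OF f', of "z \<otimes> inv y"] by simp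
      qed
      also have "\<dots> = (\<Sum>x\<in>carrier G. f' x * f (inv x \<otimes> z))"
        using z by (intro sum.reindex_bij_witness[of _ "\<lambda>x. inv x \<otimes> z" "\<lambda>y. z \<otimes> inv y"])
          (auto simp: m_assoc inv_mult_group)
      finally show ?thesis by (simp add: conv_def)
    qed
    then have "op (conv f f') x = op (conv f' f) x"
      unfolding op_def by (intro sum.cong) auto
    then show ?thesis using x by (simp add: op_op)
  qed
  have gen: "\<exists>f. biequivariant f \<and> op f x = y" if "x \<in> W" "x \<noteq> 0" "y \<in> W" for x y
    using irreducible_cyclic[OF irr W_V[OF that(1)] that(2) W_V[OF that(3)]]
      exists_biequivariant[OF that(1,3)] by blast
  obtain f where f: "biequivariant f" "op f v = w"
    using gen v w by blast
  obtain B where B: "finite B" "B \<subseteq> V" "vs.span B = V"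
    using rep by (auto simp: representation_def fin_dim_def)
  have "\<exists>c. \<exists>x\<in>W. x \<noteq> 0 \<and> op f x = c *v* x"
  proof (rule exists_eigenvector[OF vs.vector_space_axioms subspace_W _ B(1)])
    show "W \<noteq> {0}" using v by auto
    show "W \<subseteq> vs.span B" using B W_V by auto
    show "op f ` W \<subseteq> W" using op_W[OF f(1)] W_V by auto
    show "linear_on W sm sm (op f)"
      by (auto simp: linear_on_def op_def W_V act_add act_scale vs.scale_right_distrib sum.distrib
          vs.scale_sum_right mult.commute)
  qed
  then obtain c x where x: "x \<in> W" "x \<noteq> 0" "op f x = c *v* x" by blast
  \<comment> \<open>Schur's argument: v is obtained from the eigenvector x by a Hecke operator,
    which commutes with \<open>op f\<close> and so carries the eigenvalue c from x to v.\<close>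
  obtain f' where f': "biequivariant f'" "op f' x = v"
    using gen x v by blast
  have "w = op f (op f' x)" using f f' by simp
  also have "\<dots> = op f' (c *v* x)"
    using comm[OF f(1) f'(1)] x by (simp add: W_V)
  also have "\<dots> = c *v* v"
    using f'(2) x by (simp add: op_def W_V act_scale vs.scale_sum_right mult.commute flip: f'(2))
  finally show ?thesis ..
qed

section \<open>Root subgroups as matrices\<close>

definition V7 :: "'a \<Rightarrow> 'a \<Rightarrow> 'a \<Rightarrow> 'a \<Rightarrow> 'a \<Rightarrow> 'a \<Rightarrow> 'a \<Rightarrow> 'a::zero ^ 7" where
  "V7 a b c d e f g = vector [a, b, c, d, e, f, g]"

lemma V7_nth [simp]:
  "V7 a b c d e f g $ 1 = a" "V7 a b c d e f g $ 2 = b" "V7 a b c d e f g $ 3 = c"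
  "V7 a b c d e f g $ 4 = d" "V7 a b c d e f g $ 5 = e" "V7 a b c d e f g $ 6 = f"
  "V7 a b c d e f g $ 7 = g"
  by (simp_all add: V7_def vector_7)

lemma V7_eq_iff [simp]:
  "V7 a b c d e f g = V7 a' b' c' d' e' f' g' \<longleftrightarrow>
     a = a' \<and> b = b' \<and> c = c' \<and> d = d' \<and> e = e' \<and> f = f' \<and> g = g'"
  by (auto simp: vec_eq_iff forall_7)

lemma V7_cases: obtains a b c d e f g where "v = V7 a b c d e f g"
  using that[of "v $ 1" "v $ 2" "v $ 3" "v $ 4" "v $ 5" "v $ 6" "v $ 7"]
  by (simp add: vec_eq_iff forall_7)

text \<open>Identities between words in the generators are checked on a generic vector: one
  simplification rule per generator suffices, and no product of seven-by-seven matrices is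
  expanded.\<close>

lemma matrix7_eqI:
  fixes A B :: "'k::field ^ 7 ^ 7"
  assumes "\<And>a b c d e f g. A *v V7 a b c d e f g = B *v V7 a b c d e f g"
  shows "A = B"
  unfolding matrix_eq by (metis V7_cases assms)

lemma x_pos_V7 [simp]:
  "x_pos Alpha r *v V7 a b c d e f g =
     V7 a (b - 2 * r * d - r\<^sup>2 * f) c (d + r * f) (e - r * a) f (g - r * c)"
  "x_pos Beta r *v V7 a b c d e f g = V7 (a + r * b) b c d e (f - r * g) g"
  "x_pos Alpha_Beta r *v V7 a b c d e f g =
     V7 (a - 2 * r * d - r\<^sup>2 * g) b c (d + r * g) (e + r * b) (f + r * c) g"
  "x_pos TwoAlpha_Beta r *v V7 a b c d e f g =
     V7 (a - r * f) (b + r * g) c (d - r * c) (e + r\<^sup>2 * c - 2 * r * d) f g"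
  "x_pos ThreeAlpha_Beta r *v V7 a b c d e f g = V7 a (b + r * c) c d (e + r * f) f g"
  "x_pos ThreeAlpha_TwoBeta r *v V7 a b c d e f g = V7 (a + r * c) b c d (e + r * g) f g"
  by (simp_all add: vec_eq_iff forall_7 matrix_vector_mult_def sum_7 E7_def mat_def)

lemma x_neg_V7 [simp]:
  "x_neg_alpha r *v V7 a b c d e f g =
     V7 (a - r * e) b (c - r * g) (d - r * b) e (f - r\<^sup>2 * b + 2 * r * d) g"
  "x_neg_beta r *v V7 a b c d e f g = V7 a (b + r * a) c d e f (g - r * f)"
  by (simp_all add: vec_eq_iff forall_7 matrix_vector_mult_def sum_7 E7_def mat_def
      x_neg_alpha_def x_neg_beta_def transpose_def)

declare x_pos.simps [simp del]

lemmas mvm = matrix_vector_mul_assoc[symmetric]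

text \<open>The usual representative of the simple reflection in the rank one subgroup of
  \<alpha>.\<close>

definition n_alpha :: "'k::field ^ 7 ^ 7" where
  "n_alpha = x_pos Alpha 1 ** x_neg_alpha (- 1) ** x_pos Alpha 1"

definition n_beta :: "'k::field ^ 7 ^ 7" where
  "n_beta = x_pos Beta 1 ** x_neg_beta (- 1) ** x_pos Beta 1"

text \<open>This element rotates the root system by 60 degrees.\<close>

definition coxeter :: "'k::field ^ 7 ^ 7" where
  "coxeter = n_alpha ** n_beta"

text \<open>The simple roots \<open>\<alpha>\<close> and \<open>\<beta>\<close> take the values \<open>a\<close> and \<open>b\<close> on this element.\<close>

definition torus :: "'k \<Rightarrow> 'k \<Rightarrow> 'k::field ^ 7 ^ 7" where
  "torus a b = (\<chi> i j. if i = j then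
     V7 (a * b) a (1 / (a\<^sup>2 * b)) 1 (a\<^sup>2 * b) (1 / a) (1 / (a * b)) $ i else 0)"

lemma torus_V7 [simp]:
  "torus a b *v V7 v1 v2 v3 v4 v5 v6 v7 = V7 (a * b * v1) (a * v2) (1 / (a\<^sup>2 * b) * v3) v4
     (a\<^sup>2 * b * v5) (1 / a * v6) (1 / (a * b) * v7)"
  by (simp add: vec_eq_iff forall_7 matrix_vector_mult_def sum_7 torus_def)

lemma n_V7 [simp]:
  "n_alpha *v V7 a b c d e f g = V7 e (- f) g (- d) (- a) (- b) (- c)"
  "n_beta *v V7 a b c d e f g = V7 b (- a) c d e (- g) f"
  by (simp_all add: n_alpha_def n_beta_def mvm algebra_simps)

lemma coxeter_V7 [simp]: "coxeter *v V7 a b c d e f g = V7 e g f (- d) (- b) a (- c)"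
  by (simp add: coxeter_def mvm)

fun mpow :: "'k::field ^ 'n ^ 'n \<Rightarrow> nat \<Rightarrow> 'k ^ 'n ^ 'n" where
  "mpow A 0 = mat 1"
| "mpow A (Suc k) = A ** mpow A k"

lemma mpow_add: "mpow A (k + l) = mpow A k ** mpow A l"
  by (induction k) (simp_all add: matrix_mul_assoc)

lemma mpow_Suc_right: "mpow A (Suc k) = mpow A k ** A"
  using mpow_add[of A k 1] by simp

lemma coxeter_pow6: "mpow coxeter 6 = mat 1"
  by (rule matrix7_eqI) (simp add: eval_nat_numeral mvm)

lemma coxeter_pow_mod: "mpow (coxeter :: 'k::field ^ 7 ^ 7) k = mpow coxeter (k mod 6)"
proof -
  have "mpow (coxeter :: 'k ^ 7 ^ 7) (6 * m) = mat 1" for m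
  proof (induction m)
    case (Suc m)
    then show ?case
      using mpow_add[of "coxeter :: 'k ^ 7 ^ 7" 6 "6 * m"] by (simp add: coxeter_pow6)
  qed simp
  moreover have "mpow (coxeter :: 'k ^ 7 ^ 7) k = mpow coxeter (6 * (k div 6) + k mod 6)"
    by simp
  ultimately show ?thesis unfolding mpow_add by simp
qed

lemma torus_mult: "torus a b ** torus c d = torus (a * c) (b * d)"
  by (rule matrix7_eqI) (simp add: mvm field_simps power2_eq_square)

lemma torus_one: "torus 1 1 = mat 1"
  by (rule matrix7_eqI) simp

lemma torus_x_pos:
  assumes "a \<noteq> 0" "b \<noteq> 0"
  shows "torus a b ** x_pos Alpha r = x_pos Alpha (a * r) ** torus a b"
    "torus a b ** x_pos Beta r = x_pos Beta (b * r) ** torus a b"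
    "torus a b ** x_pos Alpha_Beta r = x_pos Alpha_Beta (a * b * r) ** torus a b"
    "torus a b ** x_pos TwoAlpha_Beta r = x_pos TwoAlpha_Beta (a\<^sup>2 * b * r) ** torus a b"
    "torus a b ** x_pos ThreeAlpha_Beta r = x_pos ThreeAlpha_Beta (a ^ 3 * b * r) ** torus a b"
    "torus a b ** x_pos ThreeAlpha_TwoBeta r = x_pos ThreeAlpha_TwoBeta (a ^ 3 * b\<^sup>2 * r) ** torus a b"
  using assms by (auto intro!: matrix7_eqI simp: mvm field_simps power2_eq_square power3_eq_cube)

lemma torus_n_alpha:
  assumes "a \<noteq> 0" "b \<noteq> 0"
  shows "torus a b ** n_alpha = n_alpha ** torus (1 / a) (a ^ 3 * b)"
  using assms by (auto intro!: matrix7_eqI simp: mvm field_simps power2_eq_square power3_eq_cube)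

lemma torus_n_beta:
  assumes "a \<noteq> 0" "b \<noteq> 0"
  shows "torus a b ** n_beta = n_beta ** torus (a * b) (1 / b)"
  using assms by (auto intro!: matrix7_eqI simp: mvm field_simps power2_eq_square power3_eq_cube)

lemma n_square: "n_alpha ** n_alpha = torus 1 (- 1)" "n_beta ** n_beta = torus (- 1) 1"
  by (rule matrix7_eqI; simp add: mvm)+

text \<open>In the Weyl group c = s_\<alpha> s_\<beta> has order 6, so s_\<beta> = c^5 s_\<alpha>;
  the torus factor corrects the chosen representatives.\<close>

lemma n_beta_coxeter: "n_beta = mpow coxeter 5 ** n_alpha ** torus (- 1) 1"
  by (rule matrix7_eqI) (simp add: eval_nat_numeral mvm)

text \<open>The torus factors are the coroots of \<alpha> and \<beta> evaluated at r: on them the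
  pair (\<alpha>, \<beta>) takes the values (r^2, r^-3) and (r^-1, r^2).\<close>

lemma rank_one:
  assumes "r \<noteq> 0"
  shows "x_pos Alpha r ** n_alpha =
      n_alpha ** x_pos Alpha (- 1 / r) ** n_alpha ** torus (r\<^sup>2) (1 / r ^ 3) ** x_pos Alpha (- 1 / r)"
    "x_pos Beta r ** n_beta =
      n_beta ** x_pos Beta (- 1 / r) ** n_beta ** torus (1 / r) (r\<^sup>2) ** x_pos Beta (- 1 / r)"
  using assms by (auto intro!: matrix7_eqI simp: mvm field_simps power2_eq_square power3_eq_cube)

lemma x_neg_conj:
  "x_neg_alpha r = n_alpha ** n_alpha ** n_alpha ** x_pos Alpha (- r) ** n_alpha"
  "x_neg_beta r = n_beta ** n_beta ** n_beta ** x_pos Beta (- r) ** n_beta"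
  by (auto intro!: matrix7_eqI simp: mvm field_simps power2_eq_square)

text \<open>Steinberg's formula for coroot values. Multiplying by \<open>n_alpha\<close> or
  \<open>n_beta\<close> instead of its inverse yields the coroot at \<open>- a\<close> or
  \<open>- b\<close>, whence the minus signs.\<close>

lemma torus_generation:
  assumes "a \<noteq> 0" "b \<noteq> 0"
  shows "torus (a\<^sup>2) (- 1 / a ^ 3) = x_pos Alpha a ** x_neg_alpha (- 1 / a) ** x_pos Alpha a ** n_alpha"
    "torus (- 1 / b) (b\<^sup>2) = x_pos Beta b ** x_neg_beta (- 1 / b) ** x_pos Beta b ** n_beta"
  using assms by (auto intro!: matrix7_eqI simp: mvm field_simps power2_eq_square power3_eq_cube)

lemma x_pos_add: "x_pos \<gamma> r ** x_pos \<gamma> s = x_pos \<gamma> (r + s)"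
  by (cases \<gamma>) (auto intro!: matrix7_eqI simp: mvm algebra_simps power2_eq_square)

lemma x_pos_zero: "x_pos \<gamma> 0 = mat 1"
  by (cases \<gamma>) (auto intro!: matrix7_eqI)

section \<open>Commutator relations and the Weyl group action on root subgroups\<close>

lemma conj_Alpha:
  "x_pos Alpha r ** x_pos Beta s = x_pos Beta s ** x_pos Alpha_Beta (- r * s) **
     x_pos TwoAlpha_Beta (r\<^sup>2 * s) ** x_pos ThreeAlpha_Beta (r ^ 3 * s) **
     x_pos ThreeAlpha_TwoBeta (r ^ 3 * s\<^sup>2) ** x_pos Alpha r"
  "x_pos Alpha r ** x_pos Alpha_Beta s = x_pos Alpha_Beta s ** x_pos TwoAlpha_Beta (- 2 * r * s) **
     x_pos ThreeAlpha_Beta (- 3 * r\<^sup>2 * s) ** x_pos ThreeAlpha_TwoBeta (3 * r * s\<^sup>2) ** x_pos Alpha r"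
  "x_pos Alpha r ** x_pos TwoAlpha_Beta s = x_pos TwoAlpha_Beta s ** x_pos ThreeAlpha_Beta (3 * r * s) **
     x_pos Alpha r"
  "x_pos Alpha r ** x_pos ThreeAlpha_Beta s = x_pos ThreeAlpha_Beta s ** x_pos Alpha r"
  "x_pos Alpha r ** x_pos ThreeAlpha_TwoBeta s = x_pos ThreeAlpha_TwoBeta s ** x_pos Alpha r"
  by (auto intro!: matrix7_eqI simp: mvm algebra_simps power2_eq_square power3_eq_cube)

lemma conj_Beta:
  "x_pos Beta r ** x_pos Alpha s = x_pos Alpha s ** x_pos Alpha_Beta (r * s) **
     x_pos TwoAlpha_Beta (r * s\<^sup>2) ** x_pos ThreeAlpha_Beta (- r * s ^ 3) **
     x_pos ThreeAlpha_TwoBeta (- 2 * r\<^sup>2 * s ^ 3) ** x_pos Beta r"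
  "x_pos Beta r ** x_pos Alpha_Beta s = x_pos Alpha_Beta s ** x_pos Beta r"
  "x_pos Beta r ** x_pos TwoAlpha_Beta s = x_pos TwoAlpha_Beta s ** x_pos Beta r"
  "x_pos Beta r ** x_pos ThreeAlpha_Beta s = x_pos ThreeAlpha_Beta s ** x_pos ThreeAlpha_TwoBeta (r * s) **
     x_pos Beta r"
  "x_pos Beta r ** x_pos ThreeAlpha_TwoBeta s = x_pos ThreeAlpha_TwoBeta s ** x_pos Beta r"
  by (auto intro!: matrix7_eqI simp: mvm algebra_simps power2_eq_square power3_eq_cube)

lemma conj_Alpha_Beta:
  "x_pos Alpha_Beta r ** x_pos TwoAlpha_Beta s =
     x_pos TwoAlpha_Beta s ** x_pos ThreeAlpha_TwoBeta (3 * r * s) ** x_pos Alpha_Beta r"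
  "x_pos Alpha_Beta r ** x_pos ThreeAlpha_Beta s = x_pos ThreeAlpha_Beta s ** x_pos Alpha_Beta r"
  "x_pos Alpha_Beta r ** x_pos ThreeAlpha_TwoBeta s = x_pos ThreeAlpha_TwoBeta s ** x_pos Alpha_Beta r"
  by (auto intro!: matrix7_eqI simp: mvm algebra_simps power2_eq_square power3_eq_cube)

lemma n_alpha_x_pos:
  "n_alpha ** x_pos Beta r = x_pos ThreeAlpha_Beta r ** n_alpha"
  "n_alpha ** x_pos Alpha_Beta r = x_pos TwoAlpha_Beta r ** n_alpha"
  "n_alpha ** x_pos TwoAlpha_Beta r = x_pos Alpha_Beta (- r) ** n_alpha"
  "n_alpha ** x_pos ThreeAlpha_Beta r = x_pos Beta (- r) ** n_alpha"
  "n_alpha ** x_pos ThreeAlpha_TwoBeta r = x_pos ThreeAlpha_TwoBeta r ** n_alpha"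
  by (auto intro!: matrix7_eqI simp: mvm algebra_simps)

lemma n_beta_x_pos:
  "n_beta ** x_pos Alpha r = x_pos Alpha_Beta r ** n_beta"
  "n_beta ** x_pos Alpha_Beta r = x_pos Alpha (- r) ** n_beta"
  "n_beta ** x_pos TwoAlpha_Beta r = x_pos TwoAlpha_Beta r ** n_beta"
  "n_beta ** x_pos ThreeAlpha_Beta r = x_pos ThreeAlpha_TwoBeta r ** n_beta"
  "n_beta ** x_pos ThreeAlpha_TwoBeta r = x_pos ThreeAlpha_Beta (- r) ** n_beta"
  by (auto intro!: matrix7_eqI simp: mvm algebra_simps)

lemma coxeter_x_pos:
  "mpow coxeter 1 ** x_pos Alpha r = x_pos TwoAlpha_Beta r ** mpow coxeter 1"
  "mpow coxeter 2 ** x_pos Alpha r = x_pos Alpha_Beta (- r) ** mpow coxeter 2"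
  "mpow coxeter 4 ** x_pos Beta r = x_pos ThreeAlpha_Beta r ** mpow coxeter 4"
  "mpow coxeter 5 ** x_pos Beta r = x_pos ThreeAlpha_TwoBeta r ** mpow coxeter 5"
  "mpow coxeter 3 ** n_alpha ** x_pos Alpha r = x_pos Alpha r ** (mpow coxeter 3 ** n_alpha)"
  "mpow coxeter 4 ** n_alpha ** x_pos Alpha r = x_pos TwoAlpha_Beta r ** (mpow coxeter 4 ** n_alpha)"
  "mpow coxeter 5 ** n_alpha ** x_pos Alpha r = x_pos Alpha_Beta (- r) ** (mpow coxeter 5 ** n_alpha)"
  "mpow coxeter 1 ** n_alpha ** x_pos Beta r = x_pos ThreeAlpha_TwoBeta r ** (mpow coxeter 1 ** n_alpha)"
  "mpow coxeter 2 ** n_alpha ** x_pos Beta r = x_pos Beta r ** (mpow coxeter 2 ** n_alpha)"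
  by (auto intro!: matrix7_eqI simp: mvm algebra_simps eval_nat_numeral)

section \<open>Groups generated by root subgroups\<close>

lemma GL_simps [simp]: "x \<otimes>\<^bsub>GL\<^esub> y = x ** y" "\<one>\<^bsub>GL\<^esub> = mat 1"
  by (simp_all add: GL_def)

interpretation GL: group "GL :: ('k::field ^ 'n ^ 'n) monoid"
  by (rule group_GL)

abbreviation ginv :: "'k::field ^ 'n ^ 'n \<Rightarrow> 'k ^ 'n ^ 'n" where
  "ginv g \<equiv> inv\<^bsub>GL\<^esub> g"

lemma GL_inv [simp]:
  "x \<in> carrier GL \<Longrightarrow> ginv x ** x = mat 1" "x \<in> carrier GL \<Longrightarrow> x ** ginv x = mat 1"
  using GL.l_inv GL.r_inv by simp_all

lemma GL_inv_cancel [simp]: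
  "x \<in> carrier GL \<Longrightarrow> ginv x ** (x ** y) = y" "x \<in> carrier GL \<Longrightarrow> x ** (ginv x ** y) = y"
  by (simp_all add: matrix_mul_assoc)

lemma GL_inv_vec [simp]:
  "x \<in> carrier GL \<Longrightarrow> ginv x *v (x *v y) = y" "x \<in> carrier GL \<Longrightarrow> x *v (ginv x *v y) = y"
  by (simp_all add: matrix_vector_mul_assoc)

lemma GL_mult: "x \<in> carrier GL \<Longrightarrow> y \<in> carrier GL \<Longrightarrow> x ** y \<in> carrier GL"
  using GL.m_closed[of x y] by simp

abbreviation RS :: "pos_root set \<Rightarrow> ('k::field ^ 7 ^ 7) set" where
  "RS S \<equiv> carrier (root_generated S)"

lemma subgroup_RS: "subgroup (RS S) GL"
  unfolding root_generated_def using x_pos_GL by (auto intro!: GL.generate_is_subgroup)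

lemma RS_GL: "u \<in> RS S \<Longrightarrow> u \<in> carrier GL"
  using subgroup.mem_carrier[OF subgroup_RS] .

lemma RS_one [simp]: "mat 1 \<in> RS S"
  using subgroup.one_closed[OF subgroup_RS] by simp

lemma RS_mult: "u \<in> RS S \<Longrightarrow> v \<in> RS S \<Longrightarrow> u ** v \<in> RS S"
  using subgroup.m_closed[OF subgroup_RS, of u S v] by simp

lemma RS_inv: "u \<in> RS S \<Longrightarrow> ginv u \<in> RS S"
  using subgroup.m_inv_closed[OF subgroup_RS] .

lemma x_pos_RS: "\<gamma> \<in> S \<Longrightarrow> x_pos \<gamma> r \<in> RS S"
  by (auto simp: root_generated_def intro!: generate.incl)

lemma RS_induct [consumes 1, case_names one x_pos mult]:
  assumes "u \<in> RS S"
    and "P (mat 1)" and "\<And>\<gamma> r. \<gamma> \<in> S \<Longrightarrow> P (x_pos \<gamma> r)"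
    and "\<And>u v. \<lbrakk>u \<in> RS S; P u; v \<in> RS S; P v\<rbrakk> \<Longrightarrow> P (u ** v)"
  shows "P u"
proof -
  have "u \<in> generate GL (\<Union>\<gamma>\<in>S. range (x_pos \<gamma>))"
    using assms(1) by (simp add: root_generated_def)
  then show ?thesis
  proof induction
    case (eng h1 h2)
    then show ?case using assms(4)[of h1 h2] by (simp add: root_generated_def)
  qed (use assms(2,3) in \<open>auto simp: inv_x_pos\<close>)
qed

lemma RS_mono: "u \<in> RS S \<Longrightarrow> S \<subseteq> T \<Longrightarrow> u \<in> RS T"
  by (induction rule: RS_induct) (auto intro: RS_mult x_pos_RS)

text \<open>Conjugation by g, phrased without an inverse so that compositions and generators are
  handled by rewriting alone.\<close>

definition conj_into :: "'k::field ^ 7 ^ 7 \<Rightarrow> pos_root set \<Rightarrow> pos_root set \<Rightarrow> bool" where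
  "conj_into g S T \<longleftrightarrow> (\<forall>u\<in>RS S. \<exists>v\<in>RS T. g ** u = v ** g)"

lemma conj_intoI:
  assumes "\<And>\<gamma> r. \<gamma> \<in> S \<Longrightarrow> \<exists>v\<in>RS T. g ** x_pos \<gamma> r = v ** g"
  shows "conj_into g S T"
  unfolding conj_into_def
proof
  fix u :: "'a^7^7" assume "u \<in> RS S"
  then show "\<exists>v\<in>RS T. g ** u = v ** g"
  proof (induction rule: RS_induct)
    case one
    show ?case by (intro bexI[of _ "mat 1"]) auto
  next
    case (mult u v)
    then obtain u' v' where "u' \<in> RS T" "g ** u = u' ** g" "v' \<in> RS T" "g ** v = v' ** g" by blast
    then show ?case
      by (intro bexI[of _ "u' ** v'"] RS_mult) (simp_all add: matrix_mul_assoc, metis matrix_mul_assoc)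
  qed (use assms in blast)
qed

lemma conj_intoD: "conj_into g S T \<Longrightarrow> u \<in> RS S \<Longrightarrow> \<exists>v\<in>RS T. g ** u = v ** g"
  by (simp add: conj_into_def)

lemma conj_into_mult:
  assumes "conj_into g S T" "conj_into h R S"
  shows "conj_into (g ** h) R T"
  unfolding conj_into_def
proof
  fix u :: "'a ^ 7 ^ 7" assume "u \<in> RS R"
  then obtain v where v: "v \<in> RS S" "h ** u = v ** h"
    using assms(2) by (auto simp: conj_into_def)
  then obtain w where "w \<in> RS T" "g ** v = w ** g"
    using assms(1) by (auto simp: conj_into_def)
  with v show "\<exists>v\<in>RS T. g ** h ** u = v ** (g ** h)"
    by (metis matrix_mul_assoc)
qed

lemma conj_into_member: "g \<in> RS S \<Longrightarrow> conj_into g S S"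
  unfolding conj_into_def
proof
  fix u :: "'a ^ 7 ^ 7" assume g: "g \<in> RS S" and u: "u \<in> RS S"
  show "\<exists>v\<in>RS S. g ** u = v ** g"
    by (rule bexI[of _ "g ** u ** ginv g"])
      (use g u in \<open>auto intro!: RS_mult RS_inv simp: RS_GL simp flip: matrix_mul_assoc\<close>)
qed

lemma mult_split: "a = b ** c \<Longrightarrow> b \<in> RS T \<Longrightarrow> \<exists>v\<in>RS T. a = v ** c"
  by blast

text \<open>The roots in \<open>- {Alpha}\<close> are those of the unipotent radical of the
  parabolic subgroup with Levi root \<alpha>, so all commutators with \<open>x_pos Alpha r\<close>
  stay among them.\<close>

lemma conj_into_x_Alpha: "conj_into (x_pos Alpha r) (- {Alpha}) (- {Alpha})"
proof (rule conj_intoI)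
  fix \<gamma> s assume "\<gamma> \<in> - {Alpha}"
  then show "\<exists>v\<in>RS (- {Alpha}). x_pos Alpha r ** x_pos \<gamma> s = v ** x_pos Alpha r"
    by (cases \<gamma>) (auto simp only: conj_Alpha intro!: mult_split[OF refl] RS_mult x_pos_RS)
qed

lemma conj_into_x_Beta: "conj_into (x_pos Beta r) (- {Beta}) (- {Beta})"
proof (rule conj_intoI)
  fix \<gamma> s assume "\<gamma> \<in> - {Beta}"
  then show "\<exists>v\<in>RS (- {Beta}). x_pos Beta r ** x_pos \<gamma> s = v ** x_pos Beta r"
    by (cases \<gamma>) (auto simp only: conj_Beta intro!: mult_split[OF refl] RS_mult x_pos_RS)
qed

lemma conj_into_n_alpha: "conj_into n_alpha (- {Alpha}) (- {Alpha})"
proof (rule conj_intoI)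
  fix \<gamma> s assume "\<gamma> \<in> - {Alpha}"
  then show "\<exists>v\<in>RS (- {Alpha}). n_alpha ** x_pos \<gamma> s = v ** n_alpha"
    by (cases \<gamma>) (auto simp only: n_alpha_x_pos intro!: mult_split[OF refl] RS_mult x_pos_RS)
qed

lemma conj_into_n_beta: "conj_into n_beta (- {Beta}) (- {Beta})"
proof (rule conj_intoI)
  fix \<gamma> s assume "\<gamma> \<in> - {Beta}"
  then show "\<exists>v\<in>RS (- {Beta}). n_beta ** x_pos \<gamma> s = v ** n_beta"
    by (cases \<gamma>) (auto simp only: n_beta_x_pos intro!: mult_split[OF refl] RS_mult x_pos_RS)
qed

lemma torus_x_pos': 
  assumes "a \<noteq> 0" "b \<noteq> 0"
  shows "\<exists>c. c \<noteq> 0 \<and> (\<forall>r. torus a b ** x_pos \<gamma> r = x_pos \<gamma> (c * r) ** torus a b)"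
  using assms torus_x_pos[OF assms]
  by (cases \<gamma>) (simp_all, (metis mult_eq_0_iff power_not_zero)+)

lemma conj_into_torus: "a \<noteq> 0 \<Longrightarrow> b \<noteq> 0 \<Longrightarrow> conj_into (torus a b) S S"
  by (rule conj_intoI) (metis torus_x_pos' x_pos_RS)

text \<open>These roots generate the part of the unipotent radical of the parabolic subgroup with Levi
  root \<open>\<beta>\<close> that stabilises the plane of the first two basis vectors.\<close>

abbreviation U3 :: "pos_root set" where
  "U3 \<equiv> {TwoAlpha_Beta, ThreeAlpha_Beta, ThreeAlpha_TwoBeta}"

lemma conj_into_U3:
  "conj_into (x_pos Alpha r) U3 U3" "conj_into (x_pos Beta r) U3 U3"
  "conj_into (x_pos Alpha_Beta r) U3 U3" "conj_into n_beta U3 U3"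
  by (rule conj_intoI; auto simp only: conj_Alpha conj_Beta conj_Alpha_Beta n_beta_x_pos insert_iff empty_iff;
      auto simp only: insert_iff empty_iff intro!: mult_split[OF refl] RS_mult x_pos_RS)+

text \<open>The root subgroup of a simple root normalises the product of the other positive root
  subgroups, so its elements can be collected on the left.\<close>

lemma U_split:
  assumes "u \<in> carrier U_G2" "\<delta> \<in> {Alpha, Beta}"
  shows "\<exists>r. \<exists>v\<in>RS (- {\<delta>}). u = x_pos \<delta> r ** v"
  using assms(1)
proof (induction rule: RS_induct)
  case one
  show ?case by (metis RS_one matrix_mul_lid x_pos_zero)
next
  case (x_pos \<gamma> r)
  show ?case
  proof (cases "\<gamma> = \<delta>")
    case True
    then show ?thesis by (metis RS_one matrix_mul_rid)
  next
    case False
    then have "x_pos \<gamma> r \<in> RS (- {\<delta>})" by (intro x_pos_RS) auto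
    then show ?thesis by (metis matrix_mul_lid x_pos_zero)
  qed
next
  case (mult u w)
  then obtain r v s v' where *: "v \<in> RS (- {\<delta>})" "u = x_pos \<delta> r ** v" "v' \<in> RS (- {\<delta>})" "w = x_pos \<delta> s ** v'"
    by blast
  have "conj_into (x_pos \<delta> (- s)) (- {\<delta>}) (- {\<delta>})"
    using assms(2) conj_into_x_Alpha conj_into_x_Beta by auto
  then obtain v2 where v2: "v2 \<in> RS (- {\<delta>})" "x_pos \<delta> (- s) ** v = v2 ** x_pos \<delta> (- s)"
    using *(1) by (auto simp: conj_into_def)
  have "v ** x_pos \<delta> s = x_pos \<delta> s ** (x_pos \<delta> (- s) ** v) ** x_pos \<delta> s"
    by (simp add: matrix_mul_assoc x_pos_inverse)
  also have "\<dots> = x_pos \<delta> s ** v2"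
    using x_pos_inverse[of \<delta> "- s"] by (simp add: v2(2) flip: matrix_mul_assoc)
  finally have "u ** w = x_pos \<delta> (r + s) ** (v2 ** v')"
    unfolding * x_pos_add[symmetric] by (metis matrix_mul_assoc)
  then show ?case using RS_mult[OF v2(1) *(3)] by blast
qed

lemma G2_simps [simp]: "x \<otimes>\<^bsub>G2\<^esub> y = x ** y" "\<one>\<^bsub>G2\<^esub> = mat 1"
  by (simp_all add: G2_def)

lemma x_neg_GL: "x_neg_alpha r \<in> carrier GL" "x_neg_beta r \<in> carrier GL"
proof -
  have "n_alpha ** n_alpha ** n_alpha ** n_alpha = (mat 1 :: 'a^7^7)"
    "n_beta ** n_beta ** n_beta ** n_beta = (mat 1 :: 'a^7^7)"
    by (rule matrix7_eqI; simp add: mvm)+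
  then have "n_alpha \<in> carrier (GL :: ('a^7^7) monoid)" "n_beta \<in> carrier (GL :: ('a^7^7) monoid)"
    unfolding GL_def invertible_def by (auto, (metis matrix_mul_assoc)+)
  then show "x_neg_alpha r \<in> carrier GL" "x_neg_beta r \<in> carrier GL"
    unfolding x_neg_conj by (auto intro!: GL_mult x_pos_GL)
qed

lemma subgroup_G2: "subgroup (carrier G2) (GL :: ('k::field ^ 7 ^ 7) monoid)"
  unfolding G2_def using x_pos_GL x_neg_GL by (auto intro!: GL.generate_is_subgroup)

lemma group_G2: "group G2"
  using subgroup.subgroup_is_group[OF subgroup_G2 group_GL] by (simp add: G2_def)

lemma G2_GL: "g \<in> carrier G2 \<Longrightarrow> g \<in> carrier GL"
  using subgroup.mem_carrier[OF subgroup_G2] .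

lemma G2_one [simp]: "mat 1 \<in> carrier G2"
  using subgroup.one_closed[OF subgroup_G2] by simp

lemma G2_mult: "g \<in> carrier G2 \<Longrightarrow> h \<in> carrier G2 \<Longrightarrow> g ** h \<in> carrier G2"
  using subgroup.m_closed[OF subgroup_G2, of g h] by simp

lemma G2_inv_GL: "g \<in> carrier G2 \<Longrightarrow> inv\<^bsub>G2\<^esub> g = ginv g"
  unfolding G2_def using GL.m_inv_consistent[OF subgroup_G2] by (simp add: G2_def)

lemma G2_inv: "g \<in> carrier G2 \<Longrightarrow> ginv g \<in> carrier G2"
  using subgroup.m_inv_closed[OF subgroup_G2] .

lemma x_neg_G2: "x_neg_alpha r \<in> carrier G2" "x_neg_beta r \<in> carrier G2"
  by (auto simp: G2_def intro!: generate.incl)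

lemma x_simple_G2: "x_pos Alpha r \<in> carrier G2" "x_pos Beta r \<in> carrier G2"
  by (auto simp: G2_def intro!: generate.incl)

lemma n_G2: "n_alpha \<in> carrier G2" "n_beta \<in> carrier G2"
  by (auto simp: n_alpha_def n_beta_def intro!: G2_mult x_neg_G2 x_simple_G2)

lemma torus_G2:
  assumes "a \<noteq> 0" "b \<noteq> 0"
  shows "torus a b \<in> carrier G2"
proof -
  \<comment> \<open>The element is the coroot of \<alpha> at a^2 b times the coroot of \<beta> at
    a^3 b^2; the exponents come from the inverse Cartan matrix, which is integral. The minus signs
    offset those in \<open>torus_generation\<close>.\<close>
  define r s where "r = - (a\<^sup>2 * b)" and "s = - (a ^ 3 * b\<^sup>2)"
  have "torus a b = torus (r\<^sup>2) (- 1 / r ^ 3) ** torus (- 1 / s) (s\<^sup>2)"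
    using assms by (simp add: torus_mult r_def s_def field_simps power2_eq_square power3_eq_cube)
  moreover have "r \<noteq> 0" "s \<noteq> 0" using assms by (auto simp: r_def s_def)
  ultimately show ?thesis
    using torus_generation(1)[of r r] torus_generation(2)[of s s]
    by (simp only: not_False_eq_True) (intro G2_mult x_neg_G2 x_simple_G2 n_G2)
qed

lemma x_pos_G2: "x_pos \<gamma> r \<in> carrier G2"
proof -
  have conj: "x \<in> carrier G2" if "g ** y = x ** g" "g \<in> carrier G2" "y \<in> carrier G2" for g x y :: "'a^7^7"
  proof -
    have "x = g ** y ** ginv g"
      using that(1) G2_GL[OF that(2)] by (simp flip: matrix_mul_assoc)
    then show ?thesis using that(2,3) by (metis G2_mult G2_inv)
  qed
  show ?thesis
  proof (cases \<gamma>)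
    case Alpha_Beta
    then show ?thesis using conj[OF n_beta_x_pos(1)] n_G2 x_simple_G2 by blast
  next
    case TwoAlpha_Beta
    then show ?thesis using conj[OF n_alpha_x_pos(2) n_G2(1)] conj[OF n_beta_x_pos(1)] n_G2 x_simple_G2 by blast
  next
    case ThreeAlpha_Beta
    then show ?thesis using conj[OF n_alpha_x_pos(1) n_G2(1)] n_G2 x_simple_G2 by blast
  next
    case ThreeAlpha_TwoBeta
    then show ?thesis using conj[OF n_beta_x_pos(4) n_G2(2)] conj[OF n_alpha_x_pos(1) n_G2(1)] n_G2 x_simple_G2 by blast
  qed (auto simp: x_simple_G2)
qed

lemma RS_G2: "u \<in> RS S \<Longrightarrow> u \<in> carrier G2"
  by (induction rule: RS_induct) (auto intro: G2_mult x_pos_G2)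

lemma coxeter_pow_G2: "mpow coxeter k \<in> carrier G2"
  by (induction k) (auto simp: coxeter_def intro!: G2_mult n_G2)

text \<open>Negative root elements are words in \<open>n_alpha\<close>, \<open>n_beta\<close> and
  positive simple root elements, and inverting a generator only negates its parameter. The cases are
  the ones that the Bruhat decomposition handles.\<close>

lemma G2_induct_right [consumes 1, case_names one x_Alpha x_Beta n_alpha n_beta]:
  assumes "g \<in> carrier G2"
    and "P (mat 1)" and "\<And>g r. P g \<Longrightarrow> P (g ** x_pos Alpha r)" and "\<And>g r. P g \<Longrightarrow> P (g ** x_pos Beta r)"
    and "\<And>g. P g \<Longrightarrow> P (g ** n_alpha)" "\<And>g. P g \<Longrightarrow> P (g ** n_beta)"
  shows "P g"
proof -
  have neg: "P (h ** x_neg_alpha r)" "P (h ** x_neg_beta r)" if "P h" for h and r :: 'a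
    unfolding x_neg_conj matrix_mul_assoc by (intro assms(3-6) that)+
  have inv_neg: "ginv (x_neg_alpha r) = x_neg_alpha (- r)" "ginv (x_neg_beta r) = x_neg_beta (- r)" for r :: 'a
  proof -
    have "x_neg_alpha (- r) ** x_neg_alpha r = mat 1" "x_neg_beta (- r) ** x_neg_beta r = mat 1"
      by (rule matrix7_eqI; simp add: mvm algebra_simps power2_eq_square)+
    then show "ginv (x_neg_alpha r) = x_neg_alpha (- r)" "ginv (x_neg_beta r) = x_neg_beta (- r)"
      by (auto intro!: GL.inv_equality simp: x_neg_GL)
  qed
  have "g \<in> generate GL (range (x_pos Alpha) \<union> range x_neg_alpha \<union> range (x_pos Beta) \<union> range x_neg_beta)"
    using assms(1) by (simp add: G2_def)
  then have "P h \<Longrightarrow> P (h ** g)" for h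
  proof (induction arbitrary: h)
    case (incl x)
    then show ?case using neg assms(3,4) by auto
  next
    case (inv x)
    then show ?case using neg assms(3,4) by (auto simp: inv_neg inv_x_pos)
  next
    case (eng x y)
    then show ?case by (simp add: matrix_mul_assoc)
  qed simp
  from this[OF assms(2)] show ?thesis by simp
qed

text \<open>The normaliser of the torus. The Weyl group is dihedral of order 12, with rotations
  \<open>mpow coxeter k\<close> and reflections \<open>mpow coxeter k ** n_alpha\<close>.\<close>

definition N_T :: "('k::field ^ 7 ^ 7) set" where
  "N_T = {m ** torus a b |m a b k. m \<in> {mpow coxeter k, mpow coxeter k ** n_alpha} \<and> k < 6 \<and> a \<noteq> 0 \<and> b \<noteq> 0}"

lemma N_T_intro:
  assumes "a \<noteq> 0" "b \<noteq> 0"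
  shows "mpow coxeter k ** torus a b \<in> N_T" "mpow coxeter k ** n_alpha ** torus a b \<in> N_T"
proof -
  have "k mod 6 < 6" by simp
  then show "mpow coxeter k ** torus a b \<in> N_T" "mpow coxeter k ** n_alpha ** torus a b \<in> N_T"
    unfolding N_T_def coxeter_pow_mod[of k] using assms by blast+
qed

lemma N_T_cases:
  assumes "n \<in> N_T"
  obtains (rotation) k a b where "n = mpow coxeter k ** torus a b" "k < 6" "a \<noteq> 0" "b \<noteq> 0"
  | (reflection) k a b where "n = mpow coxeter k ** n_alpha ** torus a b" "k < 6" "a \<noteq> 0" "b \<noteq> 0"
  using assms unfolding N_T_def by blast

lemma N_T_G2: "n \<in> N_T \<Longrightarrow> n \<in> carrier G2"
  by (erule N_T_cases) (auto intro!: G2_mult coxeter_pow_G2 n_G2 torus_G2)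

lemma N_T_torus:
  assumes "n \<in> N_T" "a \<noteq> 0" "b \<noteq> 0"
  shows "n ** torus a b \<in> N_T"
proof -
  obtain m c d k where m: "n = m ** torus c d" "m \<in> {mpow coxeter k, mpow coxeter k ** n_alpha}"
    "k < 6" "c \<noteq> 0" "d \<noteq> 0"
    using assms(1) unfolding N_T_def by blast
  then have "n ** torus a b = m ** torus (c * a) (d * b)"
    by (simp only: torus_mult matrix_mul_assoc[symmetric])
  then show ?thesis
    using m assms(2,3) unfolding N_T_def mem_Collect_eq by (metis mult_eq_0_iff)
qed

lemma rotation_mult:
  assumes "a \<noteq> 0" "b \<noteq> 0"
  shows "mpow coxeter k ** torus a b ** n_alpha = mpow coxeter k ** n_alpha ** torus (1 / a) (a ^ 3 * b)"
    "mpow coxeter k ** torus a b ** n_beta = mpow coxeter (k + 5) ** n_alpha ** torus (- (a * b)) (1 / b)"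
proof -
  show "mpow coxeter k ** torus a b ** n_alpha = mpow coxeter k ** n_alpha ** torus (1 / a) (a ^ 3 * b)"
    using assms by (simp add: torus_n_alpha flip: matrix_mul_assoc)
  have "mpow coxeter k ** torus a b ** n_beta = mpow coxeter k ** n_beta ** torus (a * b) (1 / b)"
    using assms by (simp add: torus_n_beta flip: matrix_mul_assoc)
  also have "\<dots> = mpow coxeter (k + 5) ** n_alpha ** (torus (- 1) 1 ** torus (a * b) (1 / b))"
    unfolding mpow_add by (subst n_beta_coxeter) (simp add: matrix_mul_assoc)
  finally show "mpow coxeter k ** torus a b ** n_beta = mpow coxeter (k + 5) ** n_alpha ** torus (- (a * b)) (1 / b)"
    by (simp add: torus_mult)
qed

lemma reflection_mult:
  assumes "a \<noteq> 0" "b \<noteq> 0"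
  shows "mpow coxeter k ** n_alpha ** torus a b ** n_alpha = mpow coxeter k ** torus (1 / a) (- (a ^ 3 * b))"
    "mpow coxeter k ** n_alpha ** torus a b ** n_beta = mpow coxeter (Suc k) ** torus (a * b) (1 / b)"
proof -
  have "mpow coxeter k ** n_alpha ** torus a b ** n_alpha = mpow coxeter k ** (n_alpha ** n_alpha) ** torus (1 / a) (a ^ 3 * b)"
    using assms by (simp add: torus_n_alpha flip: matrix_mul_assoc)
  also have "\<dots> = mpow coxeter k ** torus (1 / a) (- (a ^ 3 * b))"
    by (simp add: n_square torus_mult flip: matrix_mul_assoc)
  finally show "mpow coxeter k ** n_alpha ** torus a b ** n_alpha = mpow coxeter k ** torus (1 / a) (- (a ^ 3 * b))" .
  have "mpow coxeter k ** n_alpha ** torus a b ** n_beta = mpow coxeter k ** coxeter ** torus (a * b) (1 / b)"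
    using assms by (simp add: torus_n_beta coxeter_def flip: matrix_mul_assoc)
  then show "mpow coxeter k ** n_alpha ** torus a b ** n_beta = mpow coxeter (Suc k) ** torus (a * b) (1 / b)"
    by (simp add: mpow_Suc_right del: mpow.simps)
qed

lemma N_T_mult:
  assumes "n \<in> N_T"
  shows "n ** n_alpha \<in> N_T" "n ** n_beta \<in> N_T"
  using assms
  by (cases rule: N_T_cases; simp add: rotation_mult reflection_mult N_T_intro del: mpow.simps)+

section \<open>Bruhat decomposition\<close>

text \<open>In terms of roots: n sends \<gamma> to a positive root.\<close>

definition pos :: "'k::field ^ 7 ^ 7 \<Rightarrow> pos_root \<Rightarrow> bool" where
  "pos n \<gamma> \<longleftrightarrow> (\<forall>r. \<exists>u\<in>carrier U_G2. n ** x_pos \<gamma> r = u ** n)"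

lemma pos_torus:
  assumes "pos n \<gamma>" "a \<noteq> 0" "b \<noteq> 0"
  shows "pos (n ** torus a b) \<gamma>"
  unfolding pos_def
proof
  fix r
  obtain c where c: "\<And>r. torus a b ** x_pos \<gamma> r = x_pos \<gamma> (c * r) ** torus a b"
    using torus_x_pos'[OF assms(2,3)] by blast
  obtain u where "u \<in> carrier U_G2" "n ** x_pos \<gamma> (c * r) = u ** n"
    using assms(1) by (auto simp: pos_def)
  then show "\<exists>u\<in>carrier U_G2. n ** torus a b ** x_pos \<gamma> r = u ** (n ** torus a b)"
    by (metis c matrix_mul_assoc)
qed

lemma less6_cases: "(k::nat) < 6 \<Longrightarrow> k = 0 \<or> k = 1 \<or> k = 2 \<or> k = 3 \<or> k = 4 \<or> k = 5"
  by arith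

lemma posI:
  assumes "\<And>r. n ** x_pos \<gamma> r = x_pos \<gamma>' (f r) ** n"
  shows "pos n \<gamma>"
  unfolding pos_def using assms x_pos_RS[of \<gamma>' UNIV] by blast

lemma pos_coxeter:
  "pos (mpow coxeter 0) Alpha" "pos (mpow coxeter 1) Alpha" "pos (mpow coxeter 2) Alpha"
  "pos (mpow coxeter 0) Beta" "pos (mpow coxeter 4) Beta" "pos (mpow coxeter 5) Beta"
  "pos (mpow coxeter 3 ** n_alpha) Alpha" "pos (mpow coxeter 4 ** n_alpha) Alpha"
  "pos (mpow coxeter 5 ** n_alpha) Alpha" "pos (mpow coxeter 0 ** n_alpha) Beta"
  "pos (mpow coxeter 1 ** n_alpha) Beta" "pos (mpow coxeter 2 ** n_alpha) Beta"
proof -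
  show "pos (mpow coxeter 0) Alpha"
    by (rule posI[where \<gamma>' = Alpha and f = "\<lambda>r. r"]) simp
  show "pos (mpow coxeter 0) Beta"
    by (rule posI[where \<gamma>' = Beta and f = "\<lambda>r. r"]) simp
  show "pos (mpow coxeter 0 ** n_alpha) Beta"
    by (rule posI[where \<gamma>' = ThreeAlpha_Beta and f = "\<lambda>r. r"]) (simp add: n_alpha_x_pos)
qed (rule posI, rule coxeter_x_pos)+

lemma pos_step:
  assumes "pos m \<gamma> \<or> pos m' \<gamma>" "n = m ** torus a b" "n' = m' ** torus c d"
    "a \<noteq> 0" "b \<noteq> 0" "c \<noteq> 0" "d \<noteq> 0"
  shows "pos n \<gamma> \<or> pos n' \<gamma>"
  using assms pos_torus[of m \<gamma> a b] pos_torus[of m' \<gamma> c d] by auto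

text \<open>The two elements send \<alpha> to opposite roots, one of which is positive.\<close>

lemma pos_Alpha:
  assumes "n \<in> N_T"
  shows "pos n Alpha \<or> pos (n ** n_alpha) Alpha"
proof -
  have *: "pos (mpow (coxeter :: 'a ^ 7 ^ 7) k) Alpha \<or> pos (mpow (coxeter :: 'a ^ 7 ^ 7) k ** n_alpha) Alpha" if "k < 6" for k
    using less6_cases[OF that] pos_coxeter by metis
  from assms show ?thesis
  proof (cases rule: N_T_cases)
    case (rotation k a b)
    show ?thesis
      unfolding rotation(1) by (rule pos_step[OF *[OF rotation(2)] refl rotation_mult(1)]) (use rotation in auto)
  next
    case (reflection k a b)
    show ?thesis
      unfolding reflection(1)
      by (rule pos_step[OF *[OF reflection(2), THEN disj_commute[THEN iffD1]] refl reflection_mult(1)]) (use reflection in auto)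
  qed
qed

lemma pos_Beta:
  assumes "n \<in> N_T"
  shows "pos n Beta \<or> pos (n ** n_beta) Beta"
proof -
  have *: "pos (mpow (coxeter :: 'a ^ 7 ^ 7) k) Beta \<or> pos (mpow (coxeter :: 'a ^ 7 ^ 7) (k + 5) ** n_alpha) Beta"
    "pos (mpow (coxeter :: 'a ^ 7 ^ 7) k ** n_alpha) Beta \<or> pos (mpow (coxeter :: 'a ^ 7 ^ 7) (Suc k)) Beta" if "k < 6" for k
    unfolding coxeter_pow_mod[of "k + 5"] coxeter_pow_mod[of "Suc k"] using less6_cases[OF that]
    by (elim disjE; simp add: pos_coxeter[unfolded One_nat_def] del: mpow.simps)+
  from assms show ?thesis
  proof (cases rule: N_T_cases)
    case (rotation k a b)
    show ?thesis
      unfolding rotation(1) by (rule pos_step[OF *(1)[OF rotation(2)] refl rotation_mult(2)]) (use rotation in auto)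
  next
    case (reflection k a b)
    show ?thesis
      unfolding reflection(1) by (rule pos_step[OF *(2)[OF reflection(2)] refl reflection_mult(2)]) (use reflection in auto)
  qed
qed

definition UNU :: "('k::field ^ 7 ^ 7) set" where
  "UNU = {u ** n ** u' |u n u'. u \<in> carrier U_G2 \<and> n \<in> N_T \<and> u' \<in> carrier U_G2}"

lemma UNU_right:
  assumes "g \<in> UNU" "v \<in> carrier U_G2"
  shows "g ** v \<in> UNU"
proof -
  obtain u n u' where *: "u \<in> carrier U_G2" "n \<in> N_T" "u' \<in> carrier U_G2" "g = u ** n ** u'"
    using assms(1) by (auto simp: UNU_def)
  then have "g ** v = u ** n ** (u' ** v)" by (simp add: matrix_mul_assoc)
  then show ?thesis unfolding UNU_def using * RS_mult[OF *(3) assms(2)] by blast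
qed

text \<open>The rank one argument of a BN-pair. The right-hand factor splits as
  \<open>x_pos \<delta> r ** v\<close> and v crosses m. If n keeps \<delta> positive, the root
  element moves to the left through n; otherwise \<open>n ** m\<close> keeps \<delta> positive, and
  the rank one relation brings a root element behind \<open>n ** m\<close>.\<close>

lemma UNU_step:
  fixes m :: "'k::field ^ 7 ^ 7"
  assumes \<delta>: "\<delta> \<in> {Alpha, Beta}"
    and pos: "\<And>n. n \<in> N_T \<Longrightarrow> pos n \<delta> \<or> pos (n ** m) \<delta>"
    and closed: "\<And>n. n \<in> N_T \<Longrightarrow> n ** m \<in> N_T"
    and rank_one: "\<And>r. r \<noteq> 0 \<Longrightarrow> \<exists>s s' a b. a \<noteq> 0 \<and> b \<noteq> 0 \<and>
       x_pos \<delta> r ** m = m ** x_pos \<delta> s ** m ** torus a b ** x_pos \<delta> s'"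
    and conj: "conj_into m (- {\<delta>}) (- {\<delta>})" and m4: "m ** m ** m ** m = mat 1"
    and g: "g \<in> UNU"
  shows "g ** m \<in> UNU"
proof -
  obtain u n u' where u: "u \<in> carrier U_G2" "n \<in> N_T" "u' \<in> carrier U_G2" "g = u ** n ** u'"
    using g by (auto simp: UNU_def)
  obtain r v where v: "v \<in> RS (- {\<delta>})" "u' = x_pos \<delta> r ** v"
    using U_split[OF u(3) \<delta>] by blast
  have "conj_into (m ** m ** m) (- {\<delta>}) (- {\<delta>})"
    by (rule conj_into_mult[OF conj_into_mult[OF conj conj] conj])
  then obtain w where w: "w \<in> RS (- {\<delta>})" "m ** m ** m ** v = w ** (m ** m ** m)"
    using v(1) by (auto simp: conj_into_def)
  \<comment> \<open>The cube of m is its inverse, and conjugation by it preserves the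
    radical.\<close>
  have "v ** m = m ** (m ** m ** m ** v) ** m"
    using m4 by (metis matrix_mul_assoc matrix_mul_lid)
  also have "\<dots> = m ** w"
    unfolding w(2) using m4 by (metis matrix_mul_assoc matrix_mul_rid)
  finally have vm: "v ** m = m ** w" .
  have wU: "w \<in> carrier U_G2" using w(1) RS_mono by blast
  have gm: "g ** m = u ** (n ** x_pos \<delta> r ** m) ** w"
    unfolding u v by (metis matrix_mul_assoc vm)
  have UNUI: "g ** m \<in> UNU" if "n ** x_pos \<delta> r ** m = y ** n' ** z" "y \<in> carrier U_G2" "n' \<in> N_T" "z \<in> carrier U_G2" for y n' z
    unfolding UNU_def
    by (rule CollectI, rule exI[of _ "u ** y"], rule exI[of _ n'], rule exI[of _ "z ** w"])
      (use that u(1) wU in \<open>auto simp: gm RS_mult matrix_mul_assoc\<close>)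
  show ?thesis
  proof (cases "pos n \<delta>")
    case True
    then obtain y where "y \<in> carrier U_G2" "n ** x_pos \<delta> r = y ** n" by (auto simp: pos_def)
    then show ?thesis
      using UNUI[of y "n ** m" "mat 1"] closed[OF u(2)] by (simp add: matrix_mul_assoc)
  next
    case False
    then have p: "pos (n ** m) \<delta>" using pos u(2) by blast
    show ?thesis
    proof (cases "r = 0")
      case True
      then show ?thesis
        using UNUI[of "mat 1" "n ** m" "mat 1"] closed[OF u(2)] by (simp add: x_pos_zero)
    next
      case False
      then obtain s s' a b where *: "a \<noteq> 0" "b \<noteq> 0"
        "x_pos \<delta> r ** m = m ** x_pos \<delta> s ** m ** torus a b ** x_pos \<delta> s'" using rank_one by blast
      obtain y where y: "y \<in> carrier U_G2" "n ** m ** x_pos \<delta> s = y ** (n ** m)"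
        using p by (auto simp: pos_def)
      \<comment> \<open>After the rank one relation the root element to be moved stands behind
        \<open>n ** m\<close>, which keeps \<delta> positive.\<close>
      have "n ** x_pos \<delta> r ** m = (n ** m ** x_pos \<delta> s) ** m ** torus a b ** x_pos \<delta> s'"
        using *(3) by (metis matrix_mul_assoc)
      also have "\<dots> = y ** (n ** m ** m ** torus a b) ** x_pos \<delta> s'"
        unfolding y(2) by (simp add: matrix_mul_assoc)
      finally show ?thesis
        using UNUI y(1) N_T_torus[OF closed[OF closed[OF u(2)]] *(1,2)] x_pos_RS[of \<delta> UNIV s'] by blast
    qed
  qed
qed

lemma bruhat: "g \<in> carrier G2 \<Longrightarrow> g \<in> UNU"
proof (induction rule: G2_induct_right)
  case one
  show ?case
    unfolding UNU_def
    by (rule CollectI, rule exI[of _ "mat 1"], rule exI[of _ "mpow coxeter 0 ** torus 1 1"],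
        rule exI[of _ "mat 1"]) (use N_T_intro(1)[of 1 1 0] in \<open>simp add: torus_one\<close>)
next
  case (x_Alpha g r)
  then show ?case by (rule UNU_right) (simp add: x_pos_RS)
next
  case (x_Beta g r)
  then show ?case by (rule UNU_right) (simp add: x_pos_RS)
next
  case (n_alpha g)
  show ?case
  proof (rule UNU_step[of Alpha])
    show "n_alpha ** n_alpha ** n_alpha ** n_alpha = (mat 1 :: 'a^7^7)"
      by (rule matrix7_eqI; simp add: mvm)
    show "\<exists>s s' a b. a \<noteq> 0 \<and> b \<noteq> 0 \<and> x_pos Alpha r ** n_alpha = n_alpha ** x_pos Alpha s ** n_alpha ** torus a b ** x_pos Alpha s'"
      if "r \<noteq> 0" for r :: 'a
      using rank_one(1)[OF that] that by (intro exI conjI) auto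
  qed (use n_alpha pos_Alpha N_T_mult(1) conj_into_n_alpha in auto)
next
  case (n_beta g)
  show ?case
  proof (rule UNU_step[of Beta])
    show "n_beta ** n_beta ** n_beta ** n_beta = (mat 1 :: 'a^7^7)"
      by (rule matrix7_eqI; simp add: mvm)
    show "\<exists>s s' a b. a \<noteq> 0 \<and> b \<noteq> 0 \<and> x_pos Beta r ** n_beta = n_beta ** x_pos Beta s ** n_beta ** torus a b ** x_pos Beta s'"
      if "r \<noteq> 0" for r :: 'a
      using rank_one(2)[OF that] that by (intro exI conjI) auto
  qed (use n_beta pos_Beta N_T_mult(2) conj_into_n_beta in auto)
qed

lemma bruhat_cases:
  assumes "g \<in> carrier G2"
  obtains u n u' where "u \<in> carrier U_G2" "n \<in> N_T" "u' \<in> carrier U_G2" "g = u ** n ** u'"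
  using bruhat[OF assms] by (auto simp: UNU_def)

text \<open>Conjugation by this torus element negates the parameters of the simple root subgroups, so
  \<open>iota\<close> fixes these subgroups pointwise.\<close>

definition iota :: "'k::field ^ 7 ^ 7 \<Rightarrow> 'k ^ 7 ^ 7" where
  "iota g = torus (- 1) (- 1) ** ginv g ** torus (- 1) (- 1)"

lemma torus_neg_square: "torus (- 1) (- 1) ** torus (- 1) (- 1) = mat 1"
  by (simp add: torus_mult torus_one)

lemma torus_neg_cancel: "torus (- 1) (- 1) ** (torus (- 1) (- 1) ** x) = x"
  by (simp add: matrix_mul_assoc torus_neg_square)

lemma iota_G2: "g \<in> carrier G2 \<Longrightarrow> iota g \<in> carrier G2"
  unfolding iota_def by (intro G2_mult G2_inv torus_G2) auto

lemma iota_mult: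
  assumes "g \<in> carrier GL" "h \<in> carrier GL"
  shows "iota (g ** h) = iota h ** iota g"
proof -
  have "ginv (g ** h) = ginv h ** ginv g"
    using GL.inv_mult_group[OF assms] by simp
  then show ?thesis
    unfolding iota_def by (simp add: torus_neg_cancel flip: matrix_mul_assoc)
qed

lemma iota_eqI:
  assumes "n \<in> carrier GL" "torus (- 1) (- 1) ** m ** torus (- 1) (- 1) ** n = mat 1"
    "m \<in> carrier GL"
  shows "iota n = m"
proof -
  have t: "torus (- 1) (- 1) \<in> carrier (GL :: ('a^7^7) monoid)"
    by (intro G2_GL torus_G2) auto
  have "ginv n = torus (- 1) (- 1) ** m ** torus (- 1) (- 1)"
    using assms by (intro GL.inv_equality) (auto intro!: GL_mult t)
  then show ?thesis
    unfolding iota_def by (simp add: torus_neg_cancel torus_neg_square flip: matrix_mul_assoc)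
qed

lemma iota_iota:
  assumes "g \<in> carrier GL"
  shows "iota (iota g) = g"
proof (rule iota_eqI)
  have t: "torus (- 1) (- 1) \<in> carrier (GL :: ('a^7^7) monoid)"
    by (intro G2_GL torus_G2) auto
  show "iota g \<in> carrier GL"
    unfolding iota_def using assms t by (intro GL_mult GL.inv_closed)
  show "torus (- 1) (- 1) ** g ** torus (- 1) (- 1) ** iota g = mat 1"
    unfolding iota_def using assms by (simp add: torus_neg_cancel torus_neg_square flip: matrix_mul_assoc)
qed (rule assms)

text \<open>Inversion negates the parameter and the torus element multiplies it by -1 to the height
  of the root. Hence roots of odd height are fixed, and \<alpha>+\<beta> and 3\<alpha>+\<beta>, of
  heights 2 and 4, change sign.\<close>

lemma iota_x_pos: "iota (x_pos \<gamma> r) = x_pos \<gamma> (if \<gamma> \<in> {Alpha, Beta, ThreeAlpha_TwoBeta} then r else if \<gamma> = TwoAlpha_Beta then r else - r)"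
  by (rule iota_eqI; cases \<gamma>) (auto intro!: x_pos_GL matrix7_eqI simp: mvm algebra_simps power2_eq_square)

section \<open>Uniqueness of Whittaker vectors for \<open>G\<^sub>2\<close>\<close>

context
  fixes \<psi> :: "'k::field \<Rightarrow> complex"
  assumes \<psi>: "nontrivial_additive_char \<psi>"
begin

lemma psi_simps: "\<psi> 0 = 1" "\<psi> (x + y) = \<psi> x * \<psi> y"
  using \<psi> by (auto simp: nontrivial_additive_char_def)

lemma psi_nz [simp]: "\<psi> x \<noteq> 0"
  using psi_simps(2)[of x "- x"] psi_simps(1) by auto

lemma psi_minus: "\<psi> (- x) = 1 / \<psi> x"
  using psi_simps(2)[of x "- x"] psi_simps(1) by (simp add: field_simps)

lemma exists_psi_neq_1: "a \<noteq> 0 \<Longrightarrow> \<exists>r. \<psi> (a * r) \<noteq> 1"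
proof -
  assume a: "a \<noteq> 0"
  obtain x where "\<psi> x \<noteq> 1" using \<psi> by (auto simp: nontrivial_additive_char_def)
  then show ?thesis using a by (intro exI[of _ "x / a"]) simp
qed

lemma exists_psi_neq: "a \<noteq> b \<Longrightarrow> \<exists>r. \<psi> (a * r) \<noteq> \<psi> (b * r)"
proof -
  assume "a \<noteq> b"
  then obtain r where "\<psi> ((a - b) * r) \<noteq> 1" using exists_psi_neq_1[of "a - b"] by auto
  moreover have "\<psi> (a * r) = \<psi> ((a - b) * r) * \<psi> (b * r)"
    by (simp add: algebra_simps flip: psi_simps(2))
  ultimately have "\<psi> (a * r) \<noteq> \<psi> (b * r)" by auto
  then show ?thesis ..
qed

abbreviation \<theta> where "\<theta> \<equiv> psi_U \<psi>"

lemma psi_U_x_pos: "\<theta> (x_pos \<gamma> r) = (if \<gamma> \<in> {Alpha, Beta} then \<psi> r else 1)"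
  using is_psi_U_psi_U[OF \<psi>] by (simp add: is_psi_U_def)

lemma psi_U_mult: "u \<in> carrier U_G2 \<Longrightarrow> v \<in> carrier U_G2 \<Longrightarrow> \<theta> (u ** v) = \<theta> u * \<theta> v"
  using is_psi_U_psi_U[OF \<psi>] hom_mult[of \<theta> U_G2 Cstar u v]
  by (auto simp: is_psi_U_def root_generated_def Cstar_def)

lemma psi_U_nz: "u \<in> carrier U_G2 \<Longrightarrow> \<theta> u \<noteq> 0"
  using is_psi_U_psi_U[OF \<psi>] hom_in_carrier[of \<theta> U_G2 Cstar u]
  by (auto simp: is_psi_U_def Cstar_def)

lemma psi_U_one: "\<theta> (mat 1) = 1"
  using psi_U_mult[of "mat 1" "mat 1"] psi_U_nz[of "mat 1"] by simp

text \<open>The two entries are the coordinates along \<beta> and \<alpha>; the sign stems from the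
  entry \<open>- r\<close> of \<open>x_pos Alpha r\<close> at position (5, 1). On elements of
  \<open>P_tilde\<close> the second entry vanishes and the first one belongs to the corner.\<close>

lemma psi_U_eq: "u \<in> carrier U_G2 \<Longrightarrow> \<theta> u = \<psi> (u $ 1 $ 2 - u $ 5 $ 1)"
proof (induction rule: RS_induct)
  case one
  have "\<theta> (mat 1) = 1" by (rule psi_U_one)
  then show ?case by (simp only:) (simp add: mat_def psi_simps)
next
  case (x_pos \<gamma> r)
  show ?case
    unfolding psi_U_x_pos by (cases \<gamma>) (simp_all add: x_pos.simps E7_def mat_def psi_simps)
next
  case (mult u v)
  have "u $ 1 $ 2 + v $ 1 $ 2 - (u $ 5 $ 1 + v $ 5 $ 1) = (u $ 1 $ 2 - u $ 5 $ 1) + (v $ 1 $ 2 - v $ 5 $ 1)"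
    by simp
  then show ?case
    using mult unitri_mult(2,3)[OF unitri_U_G2[OF mult(1)] unitri_U_G2[OF mult(2)]]
    by (simp only: psi_U_mult psi_simps(2))
qed

lemma iota_U: "u \<in> carrier U_G2 \<Longrightarrow> iota u \<in> carrier U_G2 \<and> \<theta> (iota u) = \<theta> u"
proof (induction rule: RS_induct)
  case one
  have "iota (mat 1) = (mat 1 :: 'k^7^7)"
    by (rule iota_eqI) (simp_all add: torus_neg_square G2_GL)
  then show ?case by simp
next
  case (x_pos \<gamma> r)
  then show ?case by (auto simp: iota_x_pos psi_U_x_pos intro: x_pos_RS)
next
  case (mult u v)
  then show ?case by (simp add: iota_mult RS_GL RS_mult psi_U_mult)
qed

text \<open>The condition \<open>irrelevant\<close> for \<open>U_G2\<close> and its generic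
  character, stated without reference to a representation.\<close>

definition irr :: "'k ^ 7 ^ 7 \<Rightarrow> bool" where
  "irr g \<longleftrightarrow> (\<exists>x\<in>carrier U_G2. \<exists>y\<in>carrier U_G2. g ** x = y ** g \<and> \<theta> x \<noteq> \<theta> y)"

lemma psi_U_conj: 
  assumes "u \<in> carrier U_G2" "x \<in> carrier U_G2"
  shows "\<theta> (u ** x ** ginv u) = \<theta> x" "\<theta> (ginv u ** x ** u) = \<theta> x"
proof -
  have "\<theta> u * \<theta> (ginv u) = 1"
    using psi_U_mult[OF assms(1) RS_inv[OF assms(1)]] by (simp add: RS_GL[OF assms(1)] psi_U_one)
  then show "\<theta> (u ** x ** ginv u) = \<theta> x" "\<theta> (ginv u ** x ** u) = \<theta> x"
    using assms by (auto simp: psi_U_mult RS_mult RS_inv mult.commute)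
qed

lemma irr_U_mult:
  assumes "irr n" "u \<in> carrier U_G2" "u' \<in> carrier U_G2"
  shows "irr (u ** n ** u')"
proof -
  obtain x y where xy: "x \<in> carrier U_G2" "y \<in> carrier U_G2" "n ** x = y ** n" "\<theta> x \<noteq> \<theta> y"
    using assms(1) by (auto simp: irr_def)
  have 1: "ginv u' ** x ** u' \<in> carrier U_G2" "u ** y ** ginv u \<in> carrier U_G2"
    using assms xy by (auto intro!: RS_mult RS_inv)
  have "(u ** n ** u') ** (ginv u' ** x ** u') = u ** (n ** x) ** u'"
    using assms by (simp add: RS_GL flip: matrix_mul_assoc)
  also have "\<dots> = (u ** y ** ginv u) ** (u ** n ** u')"
    unfolding xy(3) using assms by (simp add: RS_GL flip: matrix_mul_assoc)
  finally show ?thesis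
    unfolding irr_def using 1 psi_U_conj(1)[OF assms(2) xy(2)] psi_U_conj(2)[OF assms(3) xy(1)] xy(4)
    by (intro bexI[OF _ 1(1)] bexI[OF _ 1(2)]) auto
qed

text \<open>Here m moves a simple root to a positive root that is not simple: the character is
  nontrivial on the source and trivial on the image.\<close>

lemma irr_I:
  assumes "\<And>r. m ** x_pos \<gamma> r = x_pos \<gamma>' (c * r) ** m" "\<gamma> \<in> {Alpha, Beta}" "\<gamma>' \<notin> {Alpha, Beta}" 
    "a \<noteq> 0" "b \<noteq> 0"
  shows "irr (m ** torus a b)"
proof -
  obtain d where d: "d \<noteq> 0" "\<And>r. torus a b ** x_pos \<gamma> r = x_pos \<gamma> (d * r) ** torus a b"
    using torus_x_pos'[OF assms(4,5)] by blast
  obtain r where r: "\<psi> (1 * r) \<noteq> 1" using exists_psi_neq_1[of 1] by auto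
  have "m ** torus a b ** x_pos \<gamma> r = (m ** x_pos \<gamma> (d * r)) ** torus a b"
    by (simp add: d flip: matrix_mul_assoc)
  also have "\<dots> = x_pos \<gamma>' (c * (d * r)) ** (m ** torus a b)"
    by (simp add: assms matrix_mul_assoc)
  finally show ?thesis
    unfolding irr_def using r assms(2,3) x_pos_RS[of _ UNIV]
    by (intro bexI[of _ "x_pos \<gamma> r"] bexI[of _ "x_pos \<gamma>' (c * (d * r))"]) (auto simp: psi_U_x_pos)
qed

text \<open>Here m centralises a simple root subgroup, so only the scaling by the torus can
  distinguish the character values, and it does so unless the factor is 1.\<close>

lemma irr_scale:
  assumes "\<And>r. m ** x_pos \<gamma> r = x_pos \<gamma> r ** m" "\<gamma> \<in> {Alpha, Beta}" 
    "a \<noteq> 0" "b \<noteq> 0" "(if \<gamma> = Alpha then a else b) \<noteq> 1"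
  shows "irr (m ** torus a b)"
proof -
  let ?c = "if \<gamma> = Alpha then a else b"
  obtain r where r: "\<psi> (?c * r) \<noteq> \<psi> (1 * r)" using exists_psi_neq[OF assms(5)] by blast
  have "m ** torus a b ** x_pos \<gamma> r = (m ** x_pos \<gamma> (?c * r)) ** torus a b"
    using assms(2) torus_x_pos[OF assms(3,4), of r] by (auto simp flip: matrix_mul_assoc)
  also have "\<dots> = x_pos \<gamma> (?c * r) ** (m ** torus a b)"
    by (simp add: assms(1) matrix_mul_assoc)
  finally show ?thesis
    unfolding irr_def using r[symmetric] assms(2) x_pos_RS[of _ UNIV]
    by (intro bexI[of _ "x_pos \<gamma> r"] bexI[of _ "x_pos \<gamma> (?c * r)"]) (auto simp: psi_U_x_pos)
qed

text \<open>The double cosets supporting Whittaker functions belong to the Weyl group elements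
  \<open>1\<close>, \<open>w\<^sub>0\<close>, and \<open>w\<^sub>0 s\<close> for the two simple reflections \<open>s\<close>.\<close>

lemma N_T_relevant:
  assumes "n \<in> N_T" "\<not> irr n"
  shows "iota n = n \<and> (n = mat 1 \<or> (\<exists>a b. a \<noteq> 0 \<and> b \<noteq> 0 \<and> n \<in> {mpow coxeter 3 ** torus a b,
     mpow coxeter 3 ** n_alpha ** torus a b, mpow coxeter 2 ** n_alpha ** torus a b}))"
  using assms(1)
proof (cases rule: N_T_cases)
  case (rotation k a b)
  \<comment> \<open>Rotations with k = 1, 2 move \<alpha>, and those with k = 4, 5 move \<beta>, to
    a positive root that is not simple. This leaves the identity and k = 3, the longest
    element.\<close>
  have "k \<noteq> 1"
    using irr_I[of "mpow coxeter 1" Alpha TwoAlpha_Beta 1 a b] coxeter_x_pos(1) rotation assms(2)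
    by (auto simp del: mpow.simps)
  moreover have "k \<noteq> 2"
    using irr_I[of "mpow coxeter 2" Alpha Alpha_Beta "- 1" a b] coxeter_x_pos(2) rotation assms(2)
    by (auto simp del: mpow.simps)
  moreover have "k \<noteq> 4"
    using irr_I[of "mpow coxeter 4" Beta ThreeAlpha_Beta 1 a b] coxeter_x_pos(3) rotation assms(2)
    by (auto simp del: mpow.simps)
  moreover have "k \<noteq> 5"
    using irr_I[of "mpow coxeter 5" Beta ThreeAlpha_TwoBeta 1 a b] coxeter_x_pos(4) rotation assms(2)
    by (auto simp del: mpow.simps)
  ultimately consider "k = 0" | "k = 3" using less6_cases[OF rotation(2)] by blast
  then show ?thesis
  proof cases
    case 1
    have "a = 1" "b = 1"
      using irr_scale[of "mat 1" Alpha a b] irr_scale[of "mat 1" Beta a b] rotation assms(2) 1 by auto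
    then have "n = mat 1" using rotation 1 by (simp add: torus_one)
    moreover have "iota (mat 1) = (mat 1 :: 'k^7^7)"
      by (rule iota_eqI) (simp_all add: torus_neg_square G2_GL)
    ultimately show ?thesis by simp
  next
    case 2
    \<comment> \<open>The longest element inverts the torus, so every n in this coset is an
      involution commuting with \<open>torus (- 1) (- 1)\<close>, whatever a and b are.\<close>
    have "torus (- 1) (- 1) ** n ** torus (- 1) (- 1) ** n = mat 1"
      using rotation 2 by (auto intro!: matrix7_eqI simp: mvm eval_nat_numeral)
    then show ?thesis
      using iota_eqI[of n n] G2_GL[OF N_T_G2[OF assms(1)]] rotation 2 by auto
  qed
next
  case (reflection k a b)
  have "irr (mpow coxeter 0 ** n_alpha ** torus a b)"
    by (rule irr_I[of _ Beta ThreeAlpha_Beta 1]) (use reflection in \<open>simp_all add: n_alpha_x_pos\<close>)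
  then have "k \<noteq> 0"
    using reflection assms(2) by metis
  moreover have "k \<noteq> 1"
    using irr_I[of "mpow coxeter 1 ** n_alpha" Beta ThreeAlpha_TwoBeta 1 a b] coxeter_x_pos(8) reflection assms(2)
    by (auto simp del: mpow.simps)
  moreover have "k \<noteq> 4"
    using irr_I[of "mpow coxeter 4 ** n_alpha" Alpha TwoAlpha_Beta 1 a b] coxeter_x_pos(6) reflection assms(2)
    by (auto simp del: mpow.simps)
  moreover have "k \<noteq> 5"
    using irr_I[of "mpow coxeter 5 ** n_alpha" Alpha Alpha_Beta "- 1" a b] coxeter_x_pos(7) reflection assms(2)
    by (auto simp del: mpow.simps)
  ultimately consider "k = 2" | "k = 3" using less6_cases[OF reflection(2)] by blast
  then show ?thesis
  proof cases
    case 1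
    \<comment> \<open>This reflection fixes \<beta>, so relevance determines the value of \<beta> on
      the torus part; the case k = 3 is the same with \<alpha>.\<close>
    have "b = 1"
      using irr_scale[of "mpow coxeter 2 ** n_alpha" Beta a b] coxeter_x_pos(9) reflection assms(2) 1
      by (auto simp del: mpow.simps)
    then have "torus (- 1) (- 1) ** n ** torus (- 1) (- 1) ** n = mat 1"
      using reflection 1 by (auto intro!: matrix7_eqI simp: mvm eval_nat_numeral power2_eq_square)
    then show ?thesis
      using iota_eqI[of n n] G2_GL[OF N_T_G2[OF assms(1)]] reflection 1 by auto
  next
    case 2
    have "a = 1"
      using irr_scale[of "mpow coxeter 3 ** n_alpha" Alpha a b] coxeter_x_pos(5) reflection assms(2) 2
      by (auto simp del: mpow.simps)
    then have "torus (- 1) (- 1) ** n ** torus (- 1) (- 1) ** n = mat 1"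
      using reflection 2 by (auto intro!: matrix7_eqI simp: mvm eval_nat_numeral power2_eq_square)
    then show ?thesis
      using iota_eqI[of n n] G2_GL[OF N_T_G2[OF assms(1)]] reflection 2 by auto
  qed
qed

end

lemma subgroup_U_G2: "subgroup (carrier U_G2) G2"
proof -
  interpret G2: group G2 by (rule group_G2)
  show ?thesis
    by (rule G2.subgroupI) (auto simp: RS_G2 G2_inv_GL RS_inv RS_mult intro: RS_one)
qed

lemma twisted_U_G2:
  fixes \<psi> :: "'k::{field, finite} \<Rightarrow> complex"
  assumes "nontrivial_additive_char \<psi>" "representation G2 \<pi>"
  shows "twisted G2 \<pi> (carrier U_G2) (psi_U \<psi>)"
proof (intro twisted.intro finite_rep.intro twisted_axioms.intro)
  show "finite (carrier (G2 :: ('k ^ 7 ^ 7) monoid))" by (rule finite_subset[OF subset_UNIV finite])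
qed (use assms subgroup_U_G2 in \<open>auto simp: psi_U_nz psi_U_mult\<close>)

text \<open>Gelfand's trick with \<open>iota\<close>. It preserves irrelevance, where biequivariant
  functions vanish. On a relevant \<open>u ** n ** u'\<close> it fixes n and exchanges the two
  unipotent factors while preserving their character values.\<close>

lemma G2_whittaker_unique:
  fixes \<psi> :: "'k::{field, finite} \<Rightarrow> complex"
  assumes \<psi>: "nontrivial_additive_char \<psi>" and "irreducible_rep G2 \<pi>"
    and "v \<in> twisted.W \<pi> (carrier U_G2) (psi_U \<psi>)" "v \<noteq> 0"
    and "w \<in> twisted.W \<pi> (carrier U_G2) (psi_U \<psi>)"
  shows "\<exists>c. w = smult \<pi> c v"
proof -
  interpret twisted G2 \<pi> "carrier U_G2" "psi_U \<psi>"
    by (rule twisted_U_G2) (use assms in \<open>auto simp: irreducible_rep_def\<close>)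
  have irr_iff: "irrelevant g \<longleftrightarrow> irr \<psi> g" for g
    by (simp add: irrelevant_def irr_def[OF \<psi>])
  have "f (iota g) = f g" if f: "biequivariant f" and g: "g \<in> carrier G2" for f and g
  proof (cases "irr \<psi> g")
    case True
    then obtain x y where xy: "x \<in> carrier U_G2" "y \<in> carrier U_G2" "g ** x = y ** g" "psi_U \<psi> x \<noteq> psi_U \<psi> y"
      by (auto simp: irr_def[OF \<psi>])
    have "iota g ** iota y = iota x ** iota g"
      using xy by (metis iota_mult G2_GL RS_GL g)
    then have "irr \<psi> (iota g)"
      unfolding irr_def[OF \<psi>] using iota_U[OF \<psi>] xy by metis
    then show ?thesis
      using biequivariant_irrelevant[OF f] True g iota_G2[OF g] irr_iff by auto
  next
    case False
    obtain u n u' where u: "u \<in> carrier U_G2" "n \<in> N_T" "u' \<in> carrier U_G2" "g = u ** n ** u'"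
      using bruhat_cases[OF g] .
    then have n: "iota n = n" "n \<in> carrier G2"
      using N_T_relevant[OF \<psi> u(2)] irr_U_mult[OF \<psi>] False N_T_G2 by blast+
    have "iota g = iota u' ** n ** iota u"
      unfolding u(4) using u n by (simp add: iota_mult GL_mult RS_GL G2_GL matrix_mul_assoc)
    moreover have "f (iota u' ** n ** iota u) * psi_U \<psi> u' * psi_U \<psi> u = f n"
      using f u n iota_U[OF \<psi>] unfolding biequivariant_def by (metis G2_simps(1))
    moreover have "f g * psi_U \<psi> u * psi_U \<psi> u' = f n"
      using f u n unfolding biequivariant_def by (metis G2_simps(1))
    ultimately have "f (iota g) * (psi_U \<psi> u * psi_U \<psi> u') = f g * (psi_U \<psi> u * psi_U \<psi> u')"
      by (simp add: mult_ac)
    then show ?thesis using u psi_U_nz[OF \<psi>] by (auto simp only: mult_cancel_right mult_eq_0_iff)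
  qed
  then show ?thesis
    using assms iota_G2 iota_mult[OF G2_GL G2_GL] iota_iota[OF G2_GL]
    by (intro multiplicity_one[of iota]) auto
qed

section \<open>Additive characters\<close>

lemma sum_additive_char:
  fixes \<phi> :: "'k::{ab_group_add, finite} \<Rightarrow> complex"
  assumes "\<And>x y. \<phi> (x + y) = \<phi> x * \<phi> y" "\<phi> r \<noteq> 1"
  shows "(\<Sum>x\<in>UNIV. \<phi> x) = 0"
proof -
  have "(\<Sum>x\<in>UNIV. \<phi> x) = (\<Sum>x\<in>UNIV. \<phi> (r + x))"
    by (rule sum.reindex_bij_witness[of _ "\<lambda>x. r + x" "\<lambda>x. x - r"]) auto
  also have "\<dots> = \<phi> r * (\<Sum>x\<in>UNIV. \<phi> x)"
    by (simp add: assms(1) sum_distrib_left)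
  finally show ?thesis using assms(2) by simp
qed

context
  fixes \<psi> :: "'k::{field, finite} \<Rightarrow> complex"
  assumes \<psi>: "nontrivial_additive_char \<psi>"
begin

lemma sum_psi: "(\<Sum>c\<in>UNIV. \<psi> (c * x)) = (if x = 0 then of_nat CARD('k) else 0)"
proof (cases "x = 0")
  case False
  then obtain r where "\<psi> (x * r) \<noteq> 1" using exists_psi_neq_1[OF \<psi>] by blast
  then have "(\<Sum>c\<in>UNIV. \<psi> (c * x)) = 0"
    by (intro sum_additive_char[of _ r]) (simp only: distrib_right psi_simps(2)[OF \<psi>], simp add: mult.commute)
  then show ?thesis using False by simp
qed (simp add: psi_simps[OF \<psi>])

text \<open>By orthogonality, the sum of all these Fourier coefficients over c is the order of the
  field times \<open>f 0\<close>.\<close>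

lemma fourier_nonzero:
  fixes s :: "complex \<Rightarrow> 'v::ab_group_add \<Rightarrow> 'v" and f :: "'k \<Rightarrow> 'v"
  assumes "vector_space s" "f 0 \<noteq> 0"
  shows "\<exists>c. (\<Sum>r\<in>UNIV. s (\<psi> (- (c * r))) (f r)) \<noteq> 0"
proof (rule ccontr)
  interpret vector_space s by fact
  assume "\<not> ?thesis"
  then have "0 = (\<Sum>c\<in>UNIV. \<Sum>r\<in>UNIV. s (\<psi> (- (c * r))) (f r))" by simp
  also have "\<dots> = (\<Sum>r\<in>UNIV. \<Sum>c\<in>UNIV. s (\<psi> (- (c * r))) (f r))" by (rule sum.swap)
  also have "\<dots> = (\<Sum>r\<in>UNIV. s (\<Sum>c\<in>UNIV. \<psi> (c * (- r))) (f r))" by (simp add: scale_sum_left)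
  also have "\<dots> = (\<Sum>r\<in>UNIV. if r = 0 then s (of_nat CARD('k)) (f r) else 0)"
    unfolding sum_psi by (rule sum.cong) auto
  also have "\<dots> = s (of_nat CARD('k)) (f 0)" by simp
  finally show False using assms(2) by simp
qed

text \<open>A nonzero Fourier coefficient of \<phi> is the sum over the field of the product of
  \<phi> with a conjugate character; that product must then be trivial.\<close>

lemma additive_char_eq_psi:
  assumes \<phi>: "\<phi> 0 = 1" "\<And>x y. \<phi> (x + y) = \<phi> x * \<phi> y"
  shows "\<exists>a. \<forall>x. \<phi> x = \<psi> (a * x)"
proof -
  have cv: "vector_space ((*) :: complex \<Rightarrow> complex \<Rightarrow> complex)"
    by unfold_locales (simp_all add: algebra_simps)
  obtain c where c: "(\<Sum>r\<in>UNIV. \<psi> (- (c * r)) * \<phi> r) \<noteq> 0"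
    using fourier_nonzero[OF cv, of \<phi>] \<phi>(1) by auto
  have "\<psi> (- (c * r)) * \<phi> r = 1" for r
  proof (rule ccontr)
    assume "\<psi> (- (c * r)) * \<phi> r \<noteq> 1"
    moreover have "\<psi> (- (c * (x + y))) = \<psi> (- (c * x)) * \<psi> (- (c * y))" for x y
      by (simp add: distrib_left flip: psi_simps[OF \<psi>])
    ultimately have "(\<Sum>r\<in>UNIV. \<psi> (- (c * r)) * \<phi> r) = 0"
      by (intro sum_additive_char[of _ r]) (simp_all add: \<phi> mult_ac)
    with c show False ..
  qed
  then have "\<phi> r = \<psi> (c * r)" for r
    using psi_minus[OF \<psi>, of "c * r"] psi_nz[OF \<psi>, of "c * r"] by (metis divide_eq_1_iff mult.commute mult.right_neutral times_divide_eq_right)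
  then show ?thesis by blast
qed

end

section \<open>Whittaker functionals for \<open>GL\<^sub>2\<close>\<close>

definition n2 :: "'k \<Rightarrow> 'k::field ^ 2 ^ 2" where
  "n2 x = vector [vector [1, x], vector [0, 1]]"

lemma mat2_eq_iff: "(A :: 'k ^ 2 ^ 2) = B \<longleftrightarrow>
    A $ 1 $ 1 = B $ 1 $ 1 \<and> A $ 1 $ 2 = B $ 1 $ 2 \<and> A $ 2 $ 1 = B $ 2 $ 1 \<and> A $ 2 $ 2 = B $ 2 $ 2"
  by (auto simp: vec_eq_iff forall_2)

lemma mat2_mult:
  "((A :: 'k::field ^ 2 ^ 2) ** B) $ 1 $ j = A $ 1 $ 1 * B $ 1 $ j + A $ 1 $ 2 * B $ 2 $ j"
  "(A ** B) $ 2 $ j = A $ 2 $ 1 * B $ 1 $ j + A $ 2 $ 2 * B $ 2 $ j"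
  by (simp_all add: matrix_matrix_mult_def sum_2)

lemma n2_nth [simp]: "n2 x $ 1 $ 1 = 1" "n2 x $ 1 $ 2 = x" "n2 x $ 2 $ 1 = 0" "n2 x $ 2 $ 2 = 1"
  by (simp_all add: n2_def)

lemma n2_add: "n2 x ** n2 y = n2 (x + y)"
  by (simp add: mat2_eq_iff mat2_mult add.commute)

lemma n2_zero: "n2 0 = mat 1"
  by (simp add: mat2_eq_iff mat_def)

lemma GL2_iff: "A \<in> carrier GL \<longleftrightarrow> A $ 1 $ 1 * A $ 2 $ 2 - A $ 1 $ 2 * A $ 2 $ 1 \<noteq> 0"
  for A :: "'k::field ^ 2 ^ 2"
  by (simp add: GL_def invertible_det_nz det_2)

lemma n2_GL: "n2 x \<in> carrier GL"
  by (simp add: GL2_iff)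

lemma carrier_N_GL2: "carrier N_GL2 = range n2"
  by (auto simp: N_GL2_def n2_def)

lemma subgroup_N_GL2: "subgroup (range n2) (GL :: ('k::field ^ 2 ^ 2) monoid)"
proof (rule GL.subgroupI)
  show "ginv a \<in> range n2" if "a \<in> range n2" for a :: "'k ^ 2 ^ 2"
  proof -
    obtain x where a: "a = n2 x" using \<open>a \<in> range n2\<close> by blast
    have "ginv (n2 x) = n2 (- x)"
      by (rule GL.inv_equality) (simp_all add: n2_add n2_zero n2_GL)
    then show ?thesis using a by simp
  qed
qed (auto simp: n2_add n2_GL)

lemma twisted_N_GL2:
  fixes \<psi> :: "'k::{field, finite} \<Rightarrow> complex"
  assumes "nontrivial_additive_char \<psi>" "representation GL \<tau>"
  shows "twisted GL \<tau> (range n2) (\<lambda>n. \<psi> (n $ 1 $ 2))"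
proof (intro twisted.intro finite_rep.intro twisted_axioms.intro)
  show "finite (carrier (GL :: ('k ^ 2 ^ 2) monoid))" by (rule finite_subset[OF subset_UNIV finite])
qed (use assms subgroup_N_GL2 in \<open>auto simp: psi_nz[OF assms(1)] psi_simps[OF assms(1)] n2_add\<close>)

lemma GL2_whittaker_unique:
  fixes \<psi> :: "'k::{field, finite} \<Rightarrow> complex"
  assumes \<psi>: "nontrivial_additive_char \<psi>" and "irreducible_rep GL \<tau>"
    and "v \<in> twisted.W \<tau> (range n2) (\<lambda>n. \<psi> (n $ 1 $ 2))" "v \<noteq> 0"
    and "w \<in> twisted.W \<tau> (range n2) (\<lambda>n. \<psi> (n $ 1 $ 2))"
  shows "\<exists>c. w = smult \<tau> c v"
proof -
  interpret twisted GL \<tau> "range n2" "\<lambda>n. \<psi> (n $ 1 $ 2)"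
    by (rule twisted_N_GL2) (use assms in \<open>auto simp: irreducible_rep_def\<close>)
  \<comment> \<open>Transposition along the antidiagonal: an anti-involution that fixes every
    \<open>n2 x\<close>.\<close>
  define \<iota> where "\<iota> A = (vector [vector [A $ 2 $ 2, A $ 1 $ 2], vector [A $ 2 $ 1, A $ 1 $ 1]] :: 'k ^ 2 ^ 2)" for A :: "'k ^ 2 ^ 2"
  have \<iota>_nth [simp]: "\<iota> A $ 1 $ 1 = A $ 2 $ 2" "\<iota> A $ 1 $ 2 = A $ 1 $ 2" "\<iota> A $ 2 $ 1 = A $ 2 $ 1" "\<iota> A $ 2 $ 2 = A $ 1 $ 1" for A
    by (simp_all add: \<iota>_def)
  have irrel: "irrelevant A" if A: "A \<in> carrier GL" "A $ 2 $ 1 = 0" "A $ 1 $ 1 \<noteq> A $ 2 $ 2" for A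
  proof -
    have nz: "A $ 2 $ 2 \<noteq> 0" using A by (auto simp: GL2_iff)
    then have "A $ 1 $ 1 / A $ 2 $ 2 \<noteq> 1" using A(3) by simp
    then obtain r where r: "\<psi> (A $ 1 $ 1 / A $ 2 $ 2 * r) \<noteq> \<psi> (1 * r)"
      using exists_psi_neq[OF \<psi>] by blast
    have "A ** n2 r = n2 (A $ 1 $ 1 / A $ 2 $ 2 * r) ** A"
      using nz A(2) by (simp add: mat2_eq_iff mat2_mult)
    then show ?thesis
      unfolding irrelevant_def using r
      by (intro bexI[of _ "n2 r"] bexI[of _ "n2 (A $ 1 $ 1 / A $ 2 $ 2 * r)"]) auto
  qed
  have \<iota>_GL: "\<iota> A \<in> carrier GL" if "A \<in> carrier GL" for A
    using that by (simp add: GL2_iff mult.commute)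
  have "f (\<iota> A) = f A" if f: "biequivariant f" and A: "A \<in> carrier GL" for f A
  proof (cases "A $ 2 $ 1 = 0")
    case True
    show ?thesis
    proof (cases "A $ 1 $ 1 = A $ 2 $ 2")
      case True
      then have "\<iota> A = A" by (simp add: mat2_eq_iff)
      then show ?thesis by simp
    next
      case False
      then show ?thesis
        using biequivariant_irrelevant[OF f irrel[OF A True]]
          biequivariant_irrelevant[OF f irrel[OF \<iota>_GL[OF A]]] True A \<iota>_GL[OF A] by simp
    qed
  next
    case False
    \<comment> \<open>Conjugation by \<open>n2 x\<close> with this x exchanges the diagonal entries,
      and the two character values it introduces cancel.\<close>
    define x where "x = (A $ 2 $ 2 - A $ 1 $ 1) / A $ 2 $ 1"
    have "\<iota> A = n2 x ** A ** n2 (- x)"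
      using False by (simp add: mat2_eq_iff mat2_mult x_def)
    then have "f (\<iota> A) * \<psi> x * \<psi> (- x) = f A"
      using f A unfolding biequivariant_def by (auto dest!: bspec[of _ _ x] bspec[of _ _ "- x"])
    then show ?thesis
      using psi_nz[OF \<psi>, of x] by (simp add: psi_minus[OF \<psi>])
  qed
  then show ?thesis
    using assms \<iota>_GL
    by (intro multiplicity_one[of \<iota>]) (auto simp: mat2_eq_iff mat2_mult algebra_simps)
qed

text \<open>Genericity provides some nontrivial character, which has the form \<psi>(a x) with a
  nonzero. Translating the functional by diag(1/a, 1) replaces that character by \<psi>.\<close>

lemma GL2_whittaker_functional:
  fixes \<psi> :: "'k::{field, finite} \<Rightarrow> complex"
  assumes \<psi>: "nontrivial_additive_char \<psi>" and \<tau>: "representation GL \<tau>" "generic_GL2 \<tau>"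
  obtains l where "\<And>v w. v \<in> vspace \<tau> \<Longrightarrow> w \<in> vspace \<tau> \<Longrightarrow> l (v + w) = l v + l w"
    "\<And>c v. v \<in> vspace \<tau> \<Longrightarrow> l (smult \<tau> c v) = c * l v"
    "\<And>x v. v \<in> vspace \<tau> \<Longrightarrow> l (act \<tau> (n2 x) v) = \<psi> x * l v"
    "\<exists>v\<in>vspace \<tau>. l v \<noteq> 0"
proof -
  interpret twisted GL \<tau> "range n2" "\<lambda>n. \<psi> (n $ 1 $ 2)"
    by (rule twisted_N_GL2) (use assms in auto)
  obtain \<theta> n T where \<theta>: "\<theta> \<in> hom N_GL2 Cstar" "n \<in> carrier N_GL2" "\<theta> n \<noteq> 1"
    and T: "T \<in> hom_space N_GL2 \<tau> (char_rep \<theta>)" "hom_space N_GL2 \<tau> (char_rep \<theta>) \<noteq> {0}"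
    and "T \<noteq> 0"
  proof -
    obtain \<theta> where \<theta>: "\<theta> \<in> hom N_GL2 Cstar" "\<exists>n\<in>carrier N_GL2. \<theta> n \<noteq> 1" "hom_space N_GL2 \<tau> (char_rep \<theta>) \<noteq> {0}"
      using \<tau>(2) by (auto simp: generic_GL2_def)
    have "0 \<in> hom_space N_GL2 \<tau> (char_rep \<theta>)"
      by (auto simp: hom_space_def char_rep_def linear_on_def)
    then obtain T where "T \<in> hom_space N_GL2 \<tau> (char_rep \<theta>)" "T \<noteq> 0" using \<theta>(3) by blast
    with that \<theta> show thesis by blast
  qed
  define \<phi> where "\<phi> x = \<theta> (n2 x)" for x
  have \<theta>_mult: "\<phi> (x + y) = \<phi> x * \<phi> y" and \<phi>_nz: "\<phi> x \<noteq> 0" for x y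
    using hom_mult[OF \<theta>(1), of "n2 x" "n2 y"] hom_in_carrier[OF \<theta>(1), of "n2 x"]
    unfolding carrier_N_GL2 by (auto simp: N_GL2_def Cstar_def n2_add \<phi>_def)
  have "\<phi> 0 = 1" using \<theta>_mult[of 0 0] \<phi>_nz[of 0] by simp
  then obtain a where a: "\<And>x. \<phi> x = \<psi> (a * x)"
    using additive_char_eq_psi[OF \<psi>, of \<phi>] \<theta>_mult by blast
  have a0: "a \<noteq> 0"
    using \<theta>(2,3) a psi_simps(1)[OF \<psi>] unfolding carrier_N_GL2 by (auto simp: \<phi>_def)
  define d where "d = (vector [vector [1 / a, 0], vector [0, 1]] :: 'k ^ 2 ^ 2)"
  have d: "d \<in> carrier GL" "d ** n2 x = n2 (x / a) ** d" for x
    using a0 by (simp_all add: d_def GL2_iff mat2_eq_iff mat2_mult)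
  have T_add: "T (v + w) = T v + T w" and T_scale: "T (smult \<tau> c v) = c * T v"
    and T_act: "T (act \<tau> (n2 x) v) = \<psi> (a * x) * T v" if "v \<in> V" "w \<in> V" for v w c x
    using T(1) that a unfolding hom_space_def carrier_N_GL2 by (auto simp: linear_on_def char_rep_def \<phi>_def)
  have "\<exists>v\<in>V. T v \<noteq> 0"
    using \<open>T \<noteq> 0\<close> T(1) by (auto simp: hom_space_def fun_eq_iff char_rep_def zero_fun_def)
  then obtain v where v: "v \<in> V" "T v \<noteq> 0" by blast
  show thesis
  proof (rule that[of "\<lambda>v. T (act \<tau> d v)"])
    fix x v assume v: "v \<in> V"
    have "act \<tau> d (act \<tau> (n2 x) v) = act \<tau> (n2 (x / a)) (act \<tau> d v)"
      using act_mult[of d "n2 x" v] act_mult[of "n2 (x / a)" d v] d n2_GL v by simp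
    then show "T (act \<tau> d (act \<tau> (n2 x) v)) = \<psi> x * T (act \<tau> d v)"
      using T_act[of "act \<tau> d v" _ "x / a"] v d a0 by simp
  next
    have "act \<tau> d (act \<tau> (ginv d) v) = v"
      using act_inv_cancel[of "ginv d" v] d v by simp
    then show "\<exists>v\<in>V. T (act \<tau> d v) \<noteq> 0"
      using v d by (intro bexI[of _ "act \<tau> (ginv d) v"]) auto
  qed (use d in \<open>simp_all add: T_add T_scale act_add act_scale\<close>)
qed

section \<open>Determinants\<close>

text \<open>A permutation p with a nonzero Leibniz term satisfies \<open>r i \<le> r (p i)\<close>
  for all i; both sides have the same sum, so equality holds and p is the identity. The function r
  takes the place of an order on the index type.\<close>

lemma det_block_unitriangular:
  fixes A :: "'k::comm_ring_1 ^ 'n ^ 'n" and r :: "'n \<Rightarrow> nat"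
  assumes lower: "\<And>i j. r j < r i \<Longrightarrow> A $ i $ j = 0"
    and diag: "\<And>i j. r i = r j \<Longrightarrow> A $ i $ j = (if i = j then 1 else 0)"
  shows "det A = 1"
proof -
  have "(\<Prod>i\<in>UNIV. A $ i $ p i) = 0" if p: "p permutes UNIV" and "p \<noteq> id" for p
  proof (rule ccontr)
    assume nz: "(\<Prod>i\<in>UNIV. A $ i $ p i) \<noteq> 0"
    then have nz: "A $ i $ p i \<noteq> 0" for i using prod_zero[of UNIV "\<lambda>i. A $ i $ p i"] by auto
    then have le: "r i \<le> r (p i)" for i using lower[of "p i" i] by (meson not_le)
    have "(\<Sum>i\<in>UNIV. r (p i)) = (\<Sum>i\<in>UNIV. r i)"
      using sum.permute[OF p, of r] by (simp add: o_def)
    then have "r i = r (p i)" for i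
      using le sum_mono_inv[of r UNIV "\<lambda>i. r (p i)" i] by simp
    then have "p i = i" for i using diag[of i "p i"] nz[of i] by (auto split: if_splits)
    then show False using \<open>p \<noteq> id\<close> by (auto simp: fun_eq_iff)
  qed
  then have "det A = (\<Sum>p\<in>{id}. of_int (sign p) * (\<Prod>i\<in>UNIV. A $ i $ p i))"
    unfolding det_def
    by (intro sum.mono_neutral_right) (auto simp: permutes_id)
  then show ?thesis using diag by (simp add: sign_id)
qed

text \<open>A trivial row forces every contributing permutation to fix its index.\<close>

lemma det_supported:
  fixes A :: "'k::comm_ring_1 ^ 'n ^ 'n"
  assumes "\<And>i j. i \<notin> S \<Longrightarrow> A $ i $ j = (if i = j then 1 else 0)"
  shows "det A = (\<Sum>p | p permutes S. of_int (sign p) * (\<Prod>i\<in>S. A $ i $ p i))"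
proof -
  have "(\<Prod>i\<in>UNIV. A $ i $ p i) = 0" if np: "\<not> p permutes S" and pu: "p permutes UNIV" for p
  proof -
    obtain i where i: "i \<notin> S" "p i \<noteq> i"
      using np permutes_superset[OF pu, of S] by blast
    then have "A $ i $ p i = 0" using assms[of i "p i"] by simp
    then show ?thesis by (intro prod_zero) auto
  qed
  moreover have "(\<Prod>i\<in>UNIV. A $ i $ p i) = (\<Prod>i\<in>S. A $ i $ p i)" if "p permutes S" for p
  proof (rule prod.mono_neutral_right)
    show "\<forall>i\<in>UNIV - S. A $ i $ p i = 1"
      using assms permutes_not_in[OF that] by simp
  qed auto
  ultimately show ?thesis
    unfolding det_def
    by (intro sum.mono_neutral_cong_right) (auto intro: permutes_subset[OF _ subset_UNIV])
qed

lemma det_supported_2: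
  fixes A :: "'k::comm_ring_1 ^ 'n ^ 'n"
  assumes "s \<noteq> t" "\<And>i j. i \<notin> {s, t} \<Longrightarrow> A $ i $ j = (if i = j then 1 else 0)"
  shows "det A = A $ s $ s * A $ t $ t - A $ s $ t * A $ t $ s"
proof -
  have f: "finite {t}" "s \<notin> {t}" using assms by auto
  show ?thesis
    unfolding det_supported[of "{s, t}" A, OF assms(2), simplified]
    unfolding sum_over_permutations_insert[OF f]
    unfolding permutes_sing
    using assms(1) by (simp add: sign_swap_id sign_id swap_id_eq)
qed

lemma det_supported_3:
  fixes A :: "'k::comm_ring_1 ^ 'n ^ 'n"
  assumes "s \<noteq> t" "s \<noteq> u" "t \<noteq> u" "\<And>i j. i \<notin> {s, t, u} \<Longrightarrow> A $ i $ j = (if i = j then 1 else 0)"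
  shows "det A = A $ s $ s * A $ t $ t * A $ u $ u + A $ s $ t * A $ t $ u * A $ u $ s +
    A $ s $ u * A $ t $ s * A $ u $ t - A $ s $ s * A $ t $ u * A $ u $ t -
    A $ s $ t * A $ t $ s * A $ u $ u - A $ s $ u * A $ t $ t * A $ u $ s"
proof -
  have f: "finite {t, u}" "s \<notin> {t, u}" "finite {u}" "t \<notin> {u}" using assms by auto
  show ?thesis
    unfolding det_supported[of "{s, t, u}" A, OF assms(4), simplified]
    unfolding sum_over_permutations_insert[OF f(1,2)]
    unfolding sum_over_permutations_insert[OF f(3,4)]
    unfolding permutes_sing
    using assms(1-3) by (simp add: sign_swap_id permutation_swap_id sign_compose sign_id swap_id_eq)
qed

section \<open>The quadratic form and \<open>SO\<^sub>7\<close>\<close>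

definition form :: "'k::field ^ 7 \<Rightarrow> 'k ^ 7 \<Rightarrow> 'k" where
  "form x y = x $ 1 * y $ 7 + x $ 2 * y $ 6 - x $ 3 * y $ 5 + 2 * x $ 4 * y $ 4 - x $ 5 * y $ 3
     + x $ 6 * y $ 2 + x $ 7 * y $ 1"

definition dotk :: "'k::field ^ 'n \<Rightarrow> 'k ^ 'n \<Rightarrow> 'k" where
  "dotk x y = (\<Sum>i\<in>UNIV. x $ i * y $ i)"

lemma dotk_transpose: "dotk (A *v x) y = dotk x (transpose A *v y)"
proof -
  have "dotk (A *v x) y = (\<Sum>i\<in>UNIV. \<Sum>j\<in>UNIV. A $ i $ j * x $ j * y $ i)"
    by (simp add: dotk_def matrix_vector_mult_def sum_distrib_right)
  also have "\<dots> = (\<Sum>j\<in>UNIV. \<Sum>i\<in>UNIV. A $ i $ j * x $ j * y $ i)" by (rule sum.swap)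
  also have "\<dots> = dotk x (transpose A *v y)"
    by (simp add: dotk_def matrix_vector_mult_def transpose_def sum_distrib_left mult_ac)
  finally show ?thesis .
qed

lemma dotk_eqI: "(\<And>x. dotk x y = dotk x z) \<Longrightarrow> y = z"
proof -
  assume *: "\<And>x. dotk x y = dotk x z"
  have "dotk (axis i 1) v = v $ i" for i v
    unfolding dotk_def axis_def by (simp add: if_distrib[of "\<lambda>x. x * _"] cong: if_cong)
  then show ?thesis using * by (metis vec_eq_iff)
qed

lemma form_dotk: "form x y = dotk x (Q7 *v y)"
  by (simp add: form_def dotk_def sum_7 matrix_vector_mult_def Q7_def E7_def algebra_simps)

lemma form_V7 [simp]: "form (V7 a b c d e f g) (V7 a' b' c' d' e' f' g') =
    a * g' + b * f' - c * e' + 2 * d * d' - e * c' + f * b' + g * a'"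
  by (simp add: form_def)

definition ortho :: "'k::field ^ 7 ^ 7 \<Rightarrow> bool" where
  "ortho g \<longleftrightarrow> (\<forall>x y. form (g *v x) (g *v y) = form x y)"

lemma ortho_iff: "ortho g \<longleftrightarrow> transpose g ** Q7 ** g = Q7"
proof
  assume "ortho g"
  then have "dotk x (transpose g *v (Q7 *v (g *v y))) = dotk x (Q7 *v y)" for x y
    unfolding ortho_def form_dotk dotk_transpose by blast
  then have "transpose g *v (Q7 *v (g *v y)) = Q7 *v y" for y by (rule dotk_eqI)
  then show "transpose g ** Q7 ** g = Q7"
    unfolding matrix_eq by (simp add: mvm)
next
  assume *: "transpose g ** Q7 ** g = Q7"
  show "ortho g"
    unfolding ortho_def form_dotk dotk_transpose by (simp add: matrix_vector_mul_assoc * matrix_mul_assoc)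
qed

lemma ortho_mult: "ortho g \<Longrightarrow> ortho h \<Longrightarrow> ortho (g ** h)"
  by (simp add: ortho_def mvm)

lemma orthoI:
  assumes "\<And>a b c d e f k a' b' c' d' e' f' k'. form (g *v V7 a b c d e f k) (g *v V7 a' b' c' d' e' f' k')
     = form (V7 a b c d e f k) (V7 a' b' c' d' e' f' k')"
  shows "ortho g"
  unfolding ortho_def by (metis V7_cases assms)

lemma zero_V7: "0 = V7 0 0 0 0 0 0 (0::'a::zero)"
  by (simp add: vec_eq_iff forall_7)

lemma form_nondegenerate:
  assumes "(2 :: 'k::field) \<noteq> 0" "\<And>y. form x y = (0 :: 'k)"
  shows "x = 0"
proof (rule V7_cases[of x])
  fix a b c d e f g assume x: "x = V7 a b c d e f g"
  show "x = 0"
    unfolding x zero_V7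
    using assms(1) assms(2)[of "V7 1 0 0 0 0 0 0"] assms(2)[of "V7 0 1 0 0 0 0 0"]
      assms(2)[of "V7 0 0 1 0 0 0 0"] assms(2)[of "V7 0 0 0 1 0 0 0"] assms(2)[of "V7 0 0 0 0 1 0 0"]
      assms(2)[of "V7 0 0 0 0 0 1 0"] assms(2)[of "V7 0 0 0 0 0 0 1"]
    by (simp add: x)
qed

lemma ortho_GL:
  fixes g :: "'k::field ^ 7 ^ 7"
  assumes "(2 :: 'k) \<noteq> 0" "ortho g"
  shows "g \<in> carrier GL"
proof -
  have "x = 0" if "g *v x = 0" for x
  proof (rule form_nondegenerate[OF assms(1)])
    fix y
    have "form x y = form (g *v x) (g *v y)" using assms(2) by (simp add: ortho_def)
    then show "form x y = 0" using that by (simp add: form_def)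
  qed
  then have "\<exists>B. B ** g = mat 1" by (simp add: matrix_left_invertible_ker)
  then show ?thesis by (simp add: GL_def invertible_left_inverse)
qed

lemma SO7_simps [simp]: "x \<otimes>\<^bsub>SO Q\<^esub> y = x ** y" "\<one>\<^bsub>SO Q\<^esub> = mat 1"
  by (simp_all add: SO_def)

lemma SO7_iff: "g \<in> carrier SO7 \<longleftrightarrow> g \<in> carrier GL \<and> ortho g \<and> det g = 1"
  by (auto simp: SO_def ortho_iff)

lemma SO7_GL: "g \<in> carrier SO7 \<Longrightarrow> g \<in> carrier GL"
  by (simp add: SO7_iff)

lemma SO7_mult: "g \<in> carrier SO7 \<Longrightarrow> h \<in> carrier SO7 \<Longrightarrow> g ** h \<in> carrier SO7"
  by (simp add: SO7_iff GL_mult ortho_mult det_mul)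

lemma ortho_inv:
  assumes "g \<in> carrier GL" "ortho g"
  shows "ortho (ginv g)"
  unfolding ortho_def
proof (intro allI)
  fix x y
  have "form (ginv g *v x) (ginv g *v y) = form (g *v (ginv g *v x)) (g *v (ginv g *v y))"
    using assms by (simp add: ortho_def del: GL_inv_vec)
  then show "form (ginv g *v x) (ginv g *v y) = form x y"
    using assms by simp
qed

lemma SO7_inv:
  assumes "g \<in> carrier SO7"
  shows "ginv g \<in> carrier SO7"
proof -
  have "ortho (ginv g)"
    using assms by (simp add: SO7_iff ortho_inv)
  moreover have "det (ginv g) * det g = 1"
    using assms by (simp add: SO7_GL flip: det_mul)
  ultimately show ?thesis using assms by (simp add: SO7_iff)
qed
lemma rk_inj: "rk i = rk j \<longleftrightarrow> i = j"
  using exhaust_7[of i] exhaust_7[of j] by (auto simp: rk_def)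

lemma det_unitri: "unitri u \<Longrightarrow> det u = 1"
  by (rule det_block_unitriangular[of rk]) (auto simp: unitri_def rk_inj)

lemma x_pos_SO7: "x_pos \<gamma> r \<in> carrier SO7"
proof -
  have "ortho (x_pos \<gamma> r)"
    by (rule orthoI, cases \<gamma>) (simp_all add: algebra_simps power2_eq_square)
  then show ?thesis by (simp add: SO7_iff x_pos_GL det_unitri x_pos_unitri)
qed

lemma n_SO7: "n_alpha \<in> carrier (SO7 :: ('a::field ^ 7 ^ 7) monoid)" "n_beta \<in> carrier (SO7 :: ('a ^ 7 ^ 7) monoid)"
proof -
  have o: "ortho (n_alpha :: 'a ^ 7 ^ 7)" "ortho (n_beta :: 'a ^ 7 ^ 7)"
    by (rule orthoI; simp add: algebra_simps)+
  have "n_alpha ** n_alpha ** n_alpha ** n_alpha = (mat 1 :: 'a^7^7)"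
    "n_beta ** n_beta ** n_beta ** n_beta = (mat 1 :: 'a^7^7)"
    by (rule matrix7_eqI; simp add: mvm)+
  \<comment> \<open>With the middle factor of \<open>n_alpha\<close> written as a conjugate of a
    unipotent element, taking determinants yields det n = det (n^4), where n^4 = 1.\<close>
  have a: "n_alpha = x_pos Alpha 1 ** (n_alpha ** n_alpha ** n_alpha ** x_pos Alpha 1 ** n_alpha) ** x_pos Alpha (1 :: 'a)"
    and b: "n_beta = x_pos Beta 1 ** (n_beta ** n_beta ** n_beta ** x_pos Beta 1 ** n_beta) ** x_pos Beta (1 :: 'a)"
    by (rule matrix7_eqI; simp add: mvm power2_eq_square)+
  have "det (n_alpha :: 'a^7^7) = det (n_alpha ** n_alpha ** n_alpha ** n_alpha :: 'a^7^7)"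
    by (subst a) (simp add: det_mul det_unitri x_pos_unitri)
  moreover have "det (n_beta :: 'a^7^7) = det (n_beta ** n_beta ** n_beta ** n_beta :: 'a^7^7)"
    by (subst b) (simp add: det_mul det_unitri x_pos_unitri)
  ultimately show "n_alpha \<in> carrier (SO7 :: ('a^7^7) monoid)" "n_beta \<in> carrier (SO7 :: ('a^7^7) monoid)"
    using o n_G2[THEN G2_GL] \<open>n_alpha ** n_alpha ** n_alpha ** n_alpha = mat 1\<close> \<open>n_beta ** n_beta ** n_beta ** n_beta = mat 1\<close>
    by (simp_all add: SO7_iff)
qed

lemma mat_1_SO7 [simp]: "mat 1 \<in> carrier SO7"
  by (simp add: SO7_iff G2_GL ortho_def)

lemma G2_SO7: "g \<in> carrier G2 \<Longrightarrow> g \<in> carrier SO7"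
  by (induction rule: G2_induct_right) (auto intro!: SO7_mult x_pos_SO7 n_SO7)

section \<open>The parabolic subgroup\<close>

lemma blk_simps [simp]: "blk 1 = 0" "blk 2 = 0" "blk 3 = 1" "blk 4 = 1" "blk 5 = 1" "blk 6 = 2" "blk 7 = 2"
  by (simp_all add: blk_def)

definition plane_stable :: "'k::field ^ 7 ^ 7 \<Rightarrow> bool" where
  "plane_stable g \<longleftrightarrow> (\<exists>a b c d. g *v V7 1 0 0 0 0 0 0 = V7 a c 0 0 0 0 0 \<and> g *v V7 0 1 0 0 0 0 0 = V7 b d 0 0 0 0 0)"

lemma matrix_vec_V7: "(g *v V7 a b c d e f k) $ i = g $ i $ 1 * a + g $ i $ 2 * b + g $ i $ 3 * c +
    g $ i $ 4 * d + g $ i $ 5 * e + g $ i $ 6 * f + g $ i $ 7 * (k :: 'k::field)"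
  by (simp add: matrix_vector_mult_def sum_7)

lemma plane_stable_iff: "plane_stable g \<longleftrightarrow> g $ 3 $ 1 = 0 \<and> g $ 4 $ 1 = 0 \<and> g $ 5 $ 1 = 0 \<and> g $ 6 $ 1 = 0 \<and> g $ 7 $ 1 = 0
   \<and> g $ 3 $ 2 = 0 \<and> g $ 4 $ 2 = 0 \<and> g $ 5 $ 2 = 0 \<and> g $ 6 $ 2 = 0 \<and> g $ 7 $ 2 = 0"
  by (auto simp: plane_stable_def vec_eq_iff forall_7 matrix_vec_V7)

lemma plane_stableE:
  assumes "plane_stable g" "g \<in> carrier GL"
  obtains a b c d where "g *v V7 1 0 0 0 0 0 0 = V7 a c 0 0 0 0 0" "g *v V7 0 1 0 0 0 0 0 = V7 b d 0 0 0 0 0"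
    "a * d - b * c \<noteq> 0"
proof -
  obtain a b c d where *: "g *v V7 1 0 0 0 0 0 0 = V7 a c 0 0 0 0 0" "g *v V7 0 1 0 0 0 0 0 = V7 b d 0 0 0 0 0"
    using assms(1) by (auto simp: plane_stable_def)
  have lin: "g *v V7 x y 0 0 0 0 0 = V7 (a * x + b * y) (c * x + d * y) 0 0 0 0 0" for x y
    using * by (auto simp: vec_eq_iff forall_7 matrix_vec_V7)
  have inj: "x = 0 \<and> y = 0" if "a * x + b * y = 0" "c * x + d * y = 0" for x y
  proof -
    have "g *v V7 x y 0 0 0 0 0 = g *v 0" using lin[of x y] that by (simp flip: zero_V7)
    then have "V7 x y 0 0 0 0 0 = 0" using GL_inv_vec(1)[OF assms(2)] by metis
    then show ?thesis by (simp add: zero_V7)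
  qed
  have "a * d - b * c \<noteq> 0"
  proof
    assume "a * d - b * c = 0"
    then have "d = 0 \<and> c = 0" "b = 0 \<and> a = 0"
      using inj[of d "- c"] inj[of b "- a"] by (simp_all add: algebra_simps)
    then show False using inj[of 1 0] by simp
  qed
  with * that show thesis by blast
qed

lemma plane_stable_mult: "plane_stable g \<Longrightarrow> plane_stable h \<Longrightarrow> plane_stable (g ** h)"
proof -
  assume g: "plane_stable g" and h: "plane_stable h"
  obtain a b c d where *: "g *v V7 1 0 0 0 0 0 0 = V7 a c 0 0 0 0 0" "g *v V7 0 1 0 0 0 0 0 = V7 b d 0 0 0 0 0"
    using g by (auto simp: plane_stable_def)
  have lin: "g *v V7 x y 0 0 0 0 0 = V7 (a * x + b * y) (c * x + d * y) 0 0 0 0 0" for x y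
    using * by (auto simp: vec_eq_iff forall_7 matrix_vec_V7)
  show ?thesis using h by (auto simp: plane_stable_def mvm lin)
qed

lemma plane_stable_inv:
  assumes "plane_stable g" "g \<in> carrier GL"
  shows "plane_stable (ginv g)"
proof -
  obtain a b c d where *: "g *v V7 1 0 0 0 0 0 0 = V7 a c 0 0 0 0 0" "g *v V7 0 1 0 0 0 0 0 = V7 b d 0 0 0 0 0"
    "a * d - b * c \<noteq> 0"
    using plane_stableE[OF assms] .
  have lin: "g *v V7 x y 0 0 0 0 0 = V7 (a * x + b * y) (c * x + d * y) 0 0 0 0 0" for x y
    using * by (auto simp: vec_eq_iff forall_7 matrix_vec_V7)
  define D where "D = a * d - b * c"
  have D: "D \<noteq> 0" using *(3) by (simp add: D_def)
  have "g *v V7 (d / D) (- c / D) 0 0 0 0 0 = V7 1 0 0 0 0 0 0" "g *v V7 (- b / D) (a / D) 0 0 0 0 0 = V7 0 1 0 0 0 0 0"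
    using D unfolding lin V7_eq_iff by (simp_all add: divide_simps) (simp_all add: D_def algebra_simps)
  then have "ginv g *v V7 1 0 0 0 0 0 0 = V7 (d / D) (- c / D) 0 0 0 0 0"
    "ginv g *v V7 0 1 0 0 0 0 0 = V7 (- b / D) (a / D) 0 0 0 0 0"
    using GL_inv_vec(1)[OF assms(2)] by metis+
  then show ?thesis unfolding plane_stable_def by blast
qed

text \<open>The first five basis vectors span the orthogonal complement of the plane of the first
  two, so an isometry that preserves the plane preserves this span as well.\<close>

lemma plane_stable_perp:
  assumes "plane_stable g" "g \<in> carrier GL" "ortho g"
  shows "g $ 6 $ 3 = 0" "g $ 6 $ 4 = 0" "g $ 6 $ 5 = 0" "g $ 7 $ 3 = 0" "g $ 7 $ 4 = 0" "g $ 7 $ 5 = 0"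
proof -
  obtain a b c d where *: "g *v V7 1 0 0 0 0 0 0 = V7 a c 0 0 0 0 0" "g *v V7 0 1 0 0 0 0 0 = V7 b d 0 0 0 0 0"
    "a * d - b * c \<noteq> 0"
    using plane_stableE[OF assms(1,2)] .
  have zero: "(g *v V7 0 0 x y z 0 0) $ 6 = 0 \<and> (g *v V7 0 0 x y z 0 0) $ 7 = 0" for x y z
  proof -
    let ?v = "g *v V7 0 0 x y z 0 0"
    have f: "form ?v (V7 a c 0 0 0 0 0) = 0" "form ?v (V7 b d 0 0 0 0 0) = 0"
      using assms(3) unfolding ortho_def *(1)[symmetric] *(2)[symmetric] by simp_all
    then have 1: "?v $ 6 * c + ?v $ 7 * a = 0" "?v $ 6 * d + ?v $ 7 * b = 0"
      by (simp_all add: form_def)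
    have "?v $ 6 * (a * d - b * c) = a * (?v $ 6 * d + ?v $ 7 * b) - b * (?v $ 6 * c + ?v $ 7 * a)"
      "?v $ 7 * (a * d - b * c) = d * (?v $ 6 * c + ?v $ 7 * a) - c * (?v $ 6 * d + ?v $ 7 * b)"
      by (simp_all add: algebra_simps)
    then have "?v $ 6 * (a * d - b * c) = 0" "?v $ 7 * (a * d - b * c) = 0"
      unfolding 1 by simp_all
    then show ?thesis using *(3) by (simp only: mult_eq_0_iff) simp
  qed
  show "g $ 6 $ 3 = 0" "g $ 6 $ 4 = 0" "g $ 6 $ 5 = 0" "g $ 7 $ 3 = 0" "g $ 7 $ 4 = 0" "g $ 7 $ 5 = 0"
    using zero[of 1 0 0] zero[of 0 1 0] zero[of 0 0 1] by (simp_all add: matrix_vec_V7)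
qed

text \<open>This makes \<open>P_tilde\<close> the stabiliser of an isotropic plane and lets its
  cosets be treated as isotropic planes.\<close>

lemma block_triangular_iff:
  assumes "g \<in> carrier GL" "ortho g"
  shows "(\<forall>i j. blk j < blk i \<longrightarrow> g $ i $ j = 0) \<longleftrightarrow> plane_stable g"
proof
  assume "\<forall>i j. blk j < blk i \<longrightarrow> g $ i $ j = 0"
  then show "plane_stable g" by (simp add: plane_stable_iff)
next
  assume "plane_stable g"
  then show "\<forall>i j. blk j < blk i \<longrightarrow> g $ i $ j = 0"
    using plane_stable_perp[OF _ assms] unfolding forall_7 by (simp add: plane_stable_iff)
qed

lemma P_tilde_iff: "p \<in> P_tilde \<longleftrightarrow> p \<in> carrier SO7 \<and> plane_stable p"
  unfolding P_tilde_def using block_triangular_iff[of p] by (auto simp: SO7_iff)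

lemma P_tilde_mult: "p \<in> P_tilde \<Longrightarrow> q \<in> P_tilde \<Longrightarrow> p ** q \<in> P_tilde"
  by (simp add: P_tilde_iff SO7_mult plane_stable_mult)

lemma P_tilde_inv: "p \<in> P_tilde \<Longrightarrow> ginv p \<in> P_tilde"
  by (simp add: P_tilde_iff SO7_inv plane_stable_inv SO7_GL)

lemma P_tilde_SO7: "p \<in> P_tilde \<Longrightarrow> p \<in> carrier SO7"
  by (simp add: P_tilde_iff)

lemma P_tilde_GL: "p \<in> P_tilde \<Longrightarrow> p \<in> carrier GL"
  by (simp add: P_tilde_iff SO7_GL)

definition corner :: "'k::field ^ 7 ^ 7 \<Rightarrow> 'k ^ 2 ^ 2" where
  "corner p = vector [vector [p $ 1 $ 1, p $ 1 $ 2], vector [p $ 2 $ 1, p $ 2 $ 2]]"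

lemma corner_nth [simp]:
  "corner p $ 1 $ 1 = p $ 1 $ 1" "corner p $ 1 $ 2 = p $ 1 $ 2"
  "corner p $ 2 $ 1 = p $ 2 $ 1" "corner p $ 2 $ 2 = p $ 2 $ 2"
  by (simp_all add: corner_def)

lemma corner_GL:
  assumes "plane_stable p" "p \<in> carrier GL"
  shows "corner p \<in> carrier GL"
proof -
  obtain a b c d where "p *v V7 1 0 0 0 0 0 0 = V7 a c 0 0 0 0 0" "p *v V7 0 1 0 0 0 0 0 = V7 b d 0 0 0 0 0"
    "a * d - b * c \<noteq> 0"
    using plane_stableE[OF assms] .
  then show ?thesis by (auto simp: GL2_iff vec_eq_iff forall_7 matrix_vec_V7)
qed

lemma star_nth:
  assumes "a \<in> carrier (GL :: ('k::field ^ 2 ^ 2) monoid)"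
  shows "star a $ 1 $ 1 = a $ 1 $ 1 / det a" "star a $ 1 $ 2 = - a $ 1 $ 2 / det a"
    "star a $ 2 $ 1 = - a $ 2 $ 1 / det a" "star a $ 2 $ 2 = a $ 2 $ 2 / det a"
proof -
  let ?B = "vector [vector [a $ 2 $ 2 / det a, - a $ 2 $ 1 / det a], vector [- a $ 1 $ 2 / det a, a $ 1 $ 1 / det a]] :: 'k ^ 2 ^ 2"
  have nz: "det a \<noteq> 0" using assms by (simp add: GL2_iff det_2)
  have B: "transpose a ** ?B = mat 1" "?B ** transpose a = mat 1"
    using nz by (simp_all add: mat2_eq_iff mat2_mult transpose_def mat_def divide_simps)
      (simp_all add: det_2 algebra_simps)
  then have "\<exists>A'. transpose a ** A' = mat 1 \<and> A' ** transpose a = mat 1" by blast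
  then have "transpose a ** matrix_inv (transpose a) = mat 1"
    unfolding matrix_inv_def by (rule someI2_ex) blast
  then have "(?B ** transpose a) ** matrix_inv (transpose a) = ?B"
    by (simp only: matrix_mul_assoc[symmetric] matrix_mul_rid)
  then have "matrix_inv (transpose a) = ?B"
    by (simp only: B(2) matrix_mul_lid)
  then show "star a $ 1 $ 1 = a $ 1 $ 1 / det a" "star a $ 1 $ 2 = - a $ 1 $ 2 / det a"
    "star a $ 2 $ 1 = - a $ 2 $ 1 / det a" "star a $ 2 $ 2 = a $ 2 $ 2 / det a"
    by (simp_all add: star_def w2_def mat2_mult)
qed

lemma diag3_V7 [simp]:
  "diag3 a b d *v V7 x1 x2 x3 x4 x5 x6 x7 = V7 (a $ 1 $ 1 * x1 + a $ 1 $ 2 * x2) (a $ 2 $ 1 * x1 + a $ 2 $ 2 * x2)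
     (b $ 1 $ 1 * x3 + b $ 1 $ 2 * x4 + b $ 1 $ 3 * x5) (b $ 2 $ 1 * x3 + b $ 2 $ 2 * x4 + b $ 2 $ 3 * x5)
     (b $ 3 $ 1 * x3 + b $ 3 $ 2 * x4 + b $ 3 $ 3 * x5)
     (d $ 1 $ 1 * x6 + d $ 1 $ 2 * x7) (d $ 2 $ 1 * x6 + d $ 2 $ 2 * x7)"
  by (simp add: vec_eq_iff forall_7 matrix_vec_V7 diag3_def vector_7)

lemma det_diag3: "det (diag3 a b d) = det a * det b * det d"
proof -
  let ?A = "diag3 a (mat 1) (mat 1)" and ?B = "diag3 (mat 1) b (mat 1)" and ?D = "diag3 (mat 1) (mat 1) d"
  have "diag3 a b d = ?A ** ?B ** ?D"
    by (rule matrix7_eqI) (simp add: mvm mat_def)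
  moreover have "det ?A = det a"
  proof -
    have "\<forall>i j. i \<notin> {1, 2} \<longrightarrow> ?A $ i $ j = (if i = j then 1 else 0)"
      unfolding forall_7 by (simp add: diag3_def vector_7 mat_def)
    then show ?thesis by (subst det_supported_2[of 1 2]) (auto simp: diag3_def vector_7 det_2)
  qed
  moreover have "det ?B = det b"
  proof -
    have "\<forall>i j. i \<notin> {3, 4, 5} \<longrightarrow> ?B $ i $ j = (if i = j then 1 else 0)"
      unfolding forall_7 by (simp add: diag3_def vector_7 mat_def)
    then show ?thesis by (subst det_supported_3[of 3 4 5]) (auto simp: diag3_def vector_7 det_3)
  qed
  moreover have "det ?D = det d"
  proof -
    have "\<forall>i j. i \<notin> {6, 7} \<longrightarrow> ?D $ i $ j = (if i = j then 1 else 0)"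
      unfolding forall_7 by (simp add: diag3_def vector_7 mat_def)
    then show ?thesis by (subst det_supported_2[of 6 7]) (auto simp: diag3_def vector_7 det_2)
  qed
  ultimately show ?thesis by (simp add: det_mul)
qed

lemma det_star: "a \<in> carrier GL \<Longrightarrow> det a * det (star a) = 1"
  for a :: "'k::field ^ 2 ^ 2"
proof -
  assume a: "a \<in> carrier GL"
  have nz: "det a \<noteq> 0" using a by (simp add: GL2_iff det_2)
  have "det (star a) = (a $ 1 $ 1 * a $ 2 $ 2 - a $ 1 $ 2 * a $ 2 $ 1) / (det a * det a)"
    unfolding det_2[of "star a"] star_nth[OF a] by (simp add: diff_divide_distrib)
  then show ?thesis using nz by (simp flip: det_2)
qed

lemma V7_units:
  "(g *v V7 1 0 0 0 0 0 0) $ i = g $ i $ 1" "(g *v V7 0 1 0 0 0 0 0) $ i = g $ i $ 2"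
  "(g *v V7 0 0 1 0 0 0 0) $ i = g $ i $ 3" "(g *v V7 0 0 0 1 0 0 0) $ i = g $ i $ 4"
  "(g *v V7 0 0 0 0 1 0 0) $ i = g $ i $ 5" "(g *v V7 0 0 0 0 0 1 0) $ i = g $ i $ 6"
  "(g *v V7 0 0 0 0 0 0 1) $ i = g $ i $ 7"
  for g :: "'k::field ^ 7 ^ 7"
  by (simp_all add: matrix_vec_V7)

text \<open>The Levi decomposition is made explicit: the diagonal blocks of p give a Levi element D,
  and \<open>ginv D ** p\<close> is shown to lie in \<open>N_tilde\<close>, so that
  \<open>GL2_part_eq\<close> applies.\<close>

lemma GL2_part_corner:
  fixes p :: "'k::field ^ 7 ^ 7"
  assumes two: "(2 :: 'k) \<noteq> 0" and p: "p \<in> P_tilde"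
  shows "GL2_part p = corner p"
proof -
  have pGL: "p \<in> carrier GL" and po: "ortho p" and pdet: "det p = 1" and ps: "plane_stable p"
    using p by (auto simp: P_tilde_iff SO7_iff)
  define a where "a = corner p"
  define b where "b = (vector [vector [p $ 3 $ 3, p $ 3 $ 4, p $ 3 $ 5], vector [p $ 4 $ 3, p $ 4 $ 4, p $ 4 $ 5],
    vector [p $ 5 $ 3, p $ 5 $ 4, p $ 5 $ 5]] :: 'k ^ 3 ^ 3)"
  define D where "D = diag3 a b (star a)"
  have a: "a \<in> carrier GL" unfolding a_def by (rule corner_GL[OF ps pGL])
  have nz: "det a \<noteq> 0" using a by (simp add: GL2_iff det_2)
  have a_eq: "a $ 1 $ 1 = p $ 1 $ 1" "a $ 1 $ 2 = p $ 1 $ 2" "a $ 2 $ 1 = p $ 2 $ 1" "a $ 2 $ 2 = p $ 2 $ 2"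
    by (simp_all add: a_def)
  have b_eq: "b $ 1 $ 1 = p $ 3 $ 3" "b $ 1 $ 2 = p $ 3 $ 4" "b $ 1 $ 3 = p $ 3 $ 5" "b $ 2 $ 1 = p $ 4 $ 3"
    "b $ 2 $ 2 = p $ 4 $ 4" "b $ 2 $ 3 = p $ 4 $ 5" "b $ 3 $ 1 = p $ 5 $ 3" "b $ 3 $ 2 = p $ 5 $ 4" "b $ 3 $ 3 = p $ 5 $ 5"
    by (simp_all add: b_def)
  note ps_iff = ps[unfolded plane_stable_iff]
  note perp = plane_stable_perp[OF ps pGL po]
  \<comment> \<open>Rows 6 and 7 of p vanish on the middle vectors, so only the middle block enters
    the form there.\<close>
  have mid: "- (b $ 1 $ 1 * x + b $ 1 $ 2 * y + b $ 1 $ 3 * z) * (b $ 3 $ 1 * x' + b $ 3 $ 2 * y' + b $ 3 $ 3 * z')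
     + 2 * (b $ 2 $ 1 * x + b $ 2 $ 2 * y + b $ 2 $ 3 * z) * (b $ 2 $ 1 * x' + b $ 2 $ 2 * y' + b $ 2 $ 3 * z')
     - (b $ 3 $ 1 * x + b $ 3 $ 2 * y + b $ 3 $ 3 * z) * (b $ 1 $ 1 * x' + b $ 1 $ 2 * y' + b $ 1 $ 3 * z')
     = - x * z' + 2 * y * y' - z * x'" for x y z x' y' z'
  proof -
    have "form (p *v V7 0 0 x y z 0 0) (p *v V7 0 0 x' y' z' 0 0) = form (V7 0 0 x y z 0 0) (V7 0 0 x' y' z' 0 0)"
      using po by (simp add: ortho_def)
    then show ?thesis
      unfolding b_eq by (simp add: form_def matrix_vec_V7 perp algebra_simps)
  qed
  \<comment> \<open>The block \<open>star a\<close> is dual to a under the pairing of the first two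
    basis vectors with the last two.\<close>
  have upper: "(a $ 1 $ 1 * x1 + a $ 1 $ 2 * x2) * (star a $ 2 $ 1 * y6 + star a $ 2 $ 2 * y7) +
    (a $ 2 $ 1 * x1 + a $ 2 $ 2 * x2) * (star a $ 1 $ 1 * y6 + star a $ 1 $ 2 * y7) = x1 * y7 + x2 * y6" for x1 x2 y6 y7
    using nz unfolding star_nth[OF a] by (simp add: divide_simps) (simp add: det_2 algebra_simps)
  have Do: "ortho D"
  proof (rule orthoI)
    fix x1 x2 x3 x4 x5 x6 x7 y1 y2 y3 y4 y5 y6 y7 :: 'k
    have "form (D *v V7 x1 x2 x3 x4 x5 x6 x7) (D *v V7 y1 y2 y3 y4 y5 y6 y7) = ((a $ 1 $ 1 * x1 + a $ 1 $ 2 * x2) * (star a $ 2 $ 1 * y6 + star a $ 2 $ 2 * y7) +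
    (a $ 2 $ 1 * x1 + a $ 2 $ 2 * x2) * (star a $ 1 $ 1 * y6 + star a $ 1 $ 2 * y7))
      + (- (b $ 1 $ 1 * x3 + b $ 1 $ 2 * x4 + b $ 1 $ 3 * x5) * (b $ 3 $ 1 * y3 + b $ 3 $ 2 * y4 + b $ 3 $ 3 * y5)
     + 2 * (b $ 2 $ 1 * x3 + b $ 2 $ 2 * x4 + b $ 2 $ 3 * x5) * (b $ 2 $ 1 * y3 + b $ 2 $ 2 * y4 + b $ 2 $ 3 * y5)
     - (b $ 3 $ 1 * x3 + b $ 3 $ 2 * x4 + b $ 3 $ 3 * x5) * (b $ 1 $ 1 * y3 + b $ 1 $ 2 * y4 + b $ 1 $ 3 * y5))
      + ((a $ 1 $ 1 * y1 + a $ 1 $ 2 * y2) * (star a $ 2 $ 1 * x6 + star a $ 2 $ 2 * x7) +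
    (a $ 2 $ 1 * y1 + a $ 2 $ 2 * y2) * (star a $ 1 $ 1 * x6 + star a $ 1 $ 2 * x7))"
      unfolding D_def diag3_V7 form_V7 by (simp add: algebra_simps)
    also have "\<dots> = (x1 * y7 + x2 * y6) + (- x3 * y5 + 2 * x4 * y4 - x5 * y3) + (y1 * x7 + y2 * x6)"
      by (simp only: mid upper)
    finally show "form (D *v V7 x1 x2 x3 x4 x5 x6 x7) (D *v V7 y1 y2 y3 y4 y5 y6 y7) = form (V7 x1 x2 x3 x4 x5 x6 x7) (V7 y1 y2 y3 y4 y5 y6 y7)"
      by (simp add: algebra_simps)
  qed
  have DGL: "D \<in> carrier GL" by (rule ortho_GL[OF two Do])
  have Dps: "plane_stable D" by (simp add: D_def plane_stable_def)
  define n where "n = ginv D ** p"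
  have Dn: "D ** n = p" using DGL by (simp add: n_def)
  have nGL: "n \<in> carrier GL" and no: "ortho n" and nps: "plane_stable n"
    unfolding n_def using DGL Do Dps pGL po ps
    by (auto intro!: GL_mult GL.inv_closed ortho_mult ortho_inv plane_stable_mult plane_stable_inv)
  have nD: "n *v v = ginv D *v (p *v v)" for v by (simp add: n_def mvm)
  have e1: "n *v V7 1 0 0 0 0 0 0 = V7 1 0 0 0 0 0 0"
  proof -
    have "p *v V7 1 0 0 0 0 0 0 = D *v V7 1 0 0 0 0 0 0"
      using ps_iff by (simp add: vec_eq_iff forall_7 D_def a_eq V7_units)
    then show ?thesis using DGL by (simp add: nD)
  qed
  have e2: "n *v V7 0 1 0 0 0 0 0 = V7 0 1 0 0 0 0 0"
  proof -
    have "p *v V7 0 1 0 0 0 0 0 = D *v V7 0 1 0 0 0 0 0"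
      using ps_iff by (simp add: vec_eq_iff forall_7 D_def a_eq V7_units)
    then show ?thesis using DGL by (simp add: nD)
  qed
  obtain a' b' c' d' where Dinv: "ginv D *v V7 1 0 0 0 0 0 0 = V7 a' c' 0 0 0 0 0"
    "ginv D *v V7 0 1 0 0 0 0 0 = V7 b' d' 0 0 0 0 0"
    using plane_stable_inv[OF Dps DGL] by (auto simp: plane_stable_def)
  have plane: "(ginv D *v V7 x y 0 0 0 0 0) $ i = 0" if "blk i = 1" for x y i
  proof -
    have "ginv D *v V7 x y 0 0 0 0 0 = V7 (a' * x + b' * y) (c' * x + d' * y) 0 0 0 0 0"
      using Dinv by (auto simp: vec_eq_iff forall_7 matrix_vec_V7)
    then show ?thesis using exhaust_7[of i] that by auto
  qed
  have mid_col: "(n *v V7 0 0 x y z 0 0) $ i = V7 0 0 x y z 0 0 $ i" if "blk i = 1" for x y z i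
  proof -
    let ?w = "p *v V7 0 0 x y z 0 0"
    \<comment> \<open>On middle vectors p and D differ by a vector of the plane, which the inverse
      of D preserves.\<close>
    have "?w = D *v V7 0 0 x y z 0 0 + V7 (?w $ 1) (?w $ 2) 0 0 0 0 0"
      by (simp add: vec_eq_iff forall_7 D_def b_eq matrix_vec_V7 perp)
    then have "n *v V7 0 0 x y z 0 0 = V7 0 0 x y z 0 0 + ginv D *v V7 (?w $ 1) (?w $ 2) 0 0 0 0 0"
      unfolding nD by (metis matrix_vector_right_distrib GL_inv_vec(1)[OF DGL])
    then show ?thesis using plane[OF that] by simp
  qed
  have low: "n $ 7 $ j = (if j = 7 then 1 else 0)" "n $ 6 $ j = (if j = 6 then 1 else 0)" if "blk j = 2" for j
  proof -
    have j: "j = 6 \<or> j = 7" using exhaust_7[of j] that by auto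
    \<comment> \<open>Pairing with the first and second basis vectors, both fixed by n, reads off
      the coordinates 7 and 6.\<close>
    have f: "form (n *v x) (V7 1 0 0 0 0 0 0) = form x (V7 1 0 0 0 0 0 0)"
      "form (n *v x) (V7 0 1 0 0 0 0 0) = form x (V7 0 1 0 0 0 0 0)" for x
      using no e1 e2 unfolding ortho_def by metis+
    show "n $ 7 $ j = (if j = 7 then 1 else 0)" "n $ 6 $ j = (if j = 6 then 1 else 0)"
      using j f[of "V7 0 0 0 0 0 1 0"] f[of "V7 0 0 0 0 0 0 1"] by (auto simp: form_def V7_units)
  qed
  have blocks: "n $ i $ j = (if i = j then 1 else 0)" if "blk i = blk j" for i j
  proof -
    have col: "n $ i $ 1 = V7 1 0 0 0 0 0 0 $ i" "n $ i $ 2 = V7 0 1 0 0 0 0 0 $ i" for i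
      using arg_cong[OF e1, of "\<lambda>v. v $ i"] arg_cong[OF e2, of "\<lambda>v. v $ i"] by (simp_all add: V7_units)
    have col3: "n $ i $ 3 = V7 0 0 1 0 0 0 0 $ i" "n $ i $ 4 = V7 0 0 0 1 0 0 0 $ i" "n $ i $ 5 = V7 0 0 0 0 1 0 0 $ i"
      if "blk i = 1" for i
      using mid_col[OF that, of 1 0 0] mid_col[OF that, of 0 1 0] mid_col[OF that, of 0 0 1] by (simp_all add: V7_units)
    show ?thesis
      using that exhaust_7[of i] exhaust_7[of j] col[of 1] col[of 2] col3[of 3] col3[of 4] col3[of 5] low[of 6] low[of 7]
      by (elim disjE) (simp_all)
  qed
  have lower: "n $ i $ j = 0" if "blk j < blk i" for i j
    using nps that block_triangular_iff[OF nGL no] by blast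
  have "det n = 1"
    by (rule det_block_unitriangular[of blk]) (use blocks lower in auto)
  then have "det D = 1" using pdet Dn det_mul[of D n] by simp
  then have "det a * det (star a) * det b = 1" by (simp add: D_def det_diag3 mult_ac)
  then have bdet: "det b = 1" using det_star[OF a] by simp
  have "transpose b ** Q3 ** b = Q3"
    using mid[of 1 0 0 1 0 0] mid[of 1 0 0 0 1 0] mid[of 1 0 0 0 0 1] mid[of 0 1 0 1 0 0] mid[of 0 1 0 0 1 0]
      mid[of 0 1 0 0 0 1] mid[of 0 0 1 1 0 0] mid[of 0 0 1 0 1 0] mid[of 0 0 1 0 0 1]
    by (simp add: vec_eq_iff forall_3 matrix_matrix_mult_def sum_3 transpose_def Q3_def algebra_simps)
  then have "b \<in> carrier SO3"
    using bdet by (simp add: SO_def GL_def invertible_det_nz)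
  moreover have "n \<in> N_tilde"
    using nGL no nps \<open>det n = 1\<close> blocks by (simp add: N_tilde_def P_tilde_iff SO7_iff)
  ultimately have "GL2_part (D ** n) = a"
    unfolding D_def using a by (intro GL2_part_eq)
  then show ?thesis by (simp add: Dn a_def)
qed

section \<open>Double cosets\<close>

lemma two_neq_zero:
  assumes "odd CHAR('k::field)"
  shows "(2 :: 'k) \<noteq> 0"
proof
  assume "(2 :: 'k) = 0"
  then have "of_nat 2 = (0 :: 'k)" by simp
  then have "CHAR('k) dvd 2" by (simp only: of_nat_eq_0_iff_char_dvd)
  then have "CHAR('k) \<le> 2" by (rule dvd_imp_le) simp
  moreover have "CHAR('k) \<noteq> 1" by (simp add: CHAR_not_1')
  ultimately show False using assms by (cases "CHAR('k) = 0") (auto simp: le_Suc_eq numeral_2_eq_2)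
qed

section \<open>Orbits of \<open>G2\<close> on isotropic vectors and planes\<close>

definition reach :: "'k::field ^ 7 \<Rightarrow> 'k ^ 7 \<Rightarrow> bool" where
  "reach x y \<longleftrightarrow> (\<exists>h\<in>carrier G2. h *v x = y)"

lemma reach_refl: "reach x x"
  unfolding reach_def by (intro bexI[of _ "mat 1"]) auto

lemma reach_trans: "reach x y \<Longrightarrow> reach y z \<Longrightarrow> reach x z"
  unfolding reach_def by (metis G2_mult matrix_vector_mul_assoc)

lemma reach_x_pos: "reach x (x_pos \<gamma> r *v x)"
  unfolding reach_def using x_pos_G2 by blast

lemma reach_coxeter: "reach x (mpow coxeter k *v x)"
  unfolding reach_def using coxeter_pow_G2 by blast

lemma reach_form: "reach x y \<Longrightarrow> form y y = form x x"
  unfolding reach_def using G2_SO7 by (auto simp: SO7_iff ortho_def)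

text \<open>The fifth basis vector is a highest weight vector.\<close>

definition reach5 :: "'k::field ^ 7 \<Rightarrow> 'k ^ 7 \<Rightarrow> bool" where
  "reach5 x y \<longleftrightarrow> (\<exists>h\<in>carrier G2. h *v V7 0 0 0 0 1 0 0 = V7 0 0 0 0 1 0 0 \<and> h *v x = y)"

lemma reach5_trans: "reach5 x y \<Longrightarrow> reach5 y z \<Longrightarrow> reach5 x z"
  unfolding reach5_def by (metis G2_mult matrix_vector_mul_assoc)

lemma reach5_x_pos: "reach5 x (x_pos \<gamma> r *v x)"
  unfolding reach5_def by (rule bexI[of _ "x_pos \<gamma> r"]) (cases \<gamma>, auto intro: x_pos_G2)

lemma reach5_n_beta: "reach5 x (n_beta *v x)"
  unfolding reach5_def by (rule bexI[of _ "n_beta"]) (auto intro: n_G2)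

lemma reach5_form: "reach5 x y \<Longrightarrow> form y y = form x x"
  unfolding reach5_def using G2_SO7 by (auto simp: SO7_iff ortho_def)

text \<open>A vanishing third coordinate means orthogonality to the fifth basis vector. The first
  nonzero coordinate among 7, 6, 2, 1 serves as pivot: elements fixing the fifth basis vector clear
  the others, and isotropy removes the coordinate paired with a pivot 7 or 6. The two outcomes lead
  to the two orbits of planes.\<close>

lemma isotropic_vector5:
  fixes x :: "'k::field ^ 7"
  assumes two: "(2 :: 'k) \<noteq> 0" and x: "\<And>e. x \<noteq> V7 0 0 0 0 e 0 0" "form x x = 0" "x $ 3 = 0"
  shows "\<exists>c e. c \<noteq> 0 \<and> (reach5 x (V7 c 0 0 0 e 0 0) \<or> reach5 x (V7 0 0 0 0 e 0 c))"
proof -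
  obtain a b c d e f g where x_eq: "x = V7 a b c d e f g" by (rule V7_cases)
  have c: "c = 0" using x(3) by (simp add: x_eq)
  consider "g \<noteq> 0" | "g = 0" "f \<noteq> 0" | "g = 0" "f = 0" by blast
  then show ?thesis
  proof cases
    case 1
    obtain a b d e where 3: "reach5 x (V7 a b 0 d e 0 g)"
      using reach5_x_pos[of x Beta "f / g"] 1 c unfolding x_eq by auto
    obtain a b e where 4: "reach5 x (V7 a b 0 0 e 0 g)"
      using reach5_trans[OF 3 reach5_x_pos[of _ Alpha_Beta "- d / g"]] 1 by auto
    obtain a e where 5: "reach5 x (V7 a 0 0 0 e 0 g)"
      using reach5_trans[OF 4 reach5_x_pos[of _ TwoAlpha_Beta "- b / g"]] 1 by auto
    have "2 * (a * g) = form (V7 a 0 0 0 e 0 g) (V7 a 0 0 0 e 0 g)" by (simp add: mult.commute)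
    then have "a = 0" using reach5_form[OF 5] x(2) two 1 by simp
    then show ?thesis using 5 1 by blast
  next
    case 2
    obtain a b e where 4: "reach5 x (V7 a b 0 0 e f 0)"
      using reach5_x_pos[of x Alpha "- d / f"] 2 c unfolding x_eq by auto
    obtain b e where 5: "reach5 x (V7 0 b 0 0 e f 0)"
      using reach5_trans[OF 4 reach5_x_pos[of _ TwoAlpha_Beta "a / f"]] 2 by auto
    have "2 * (b * f) = form (V7 0 b 0 0 e f 0) (V7 0 b 0 0 e f 0)" by (simp add: mult.commute)
    then have "b = 0" using reach5_form[OF 5] x(2) two 2 by simp
    then have "reach5 x (V7 0 0 0 0 e 0 f)"
      using reach5_trans[OF 5 reach5_n_beta] by auto
    then show ?thesis using 2 by blast
  next
    case 3
    have d: "d = 0" using x(2) two 3 c by (simp add: x_eq)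
    show ?thesis
    proof (cases "b = 0")
      case False
      obtain e where 5: "reach5 x (V7 0 b 0 0 e 0 0)"
        using reach5_x_pos[of x Beta "- a / b"] 3 d c False unfolding x_eq by auto
      have "reach5 x (V7 b 0 0 0 e 0 0)"
        using reach5_trans[OF 5 reach5_n_beta] by auto
      then show ?thesis using False by blast
    next
      case True
      then have x': "x = V7 a 0 0 0 e 0 0" using 3 d c by (simp add: x_eq)
      moreover have "a \<noteq> 0" using x(1)[of e] x' by auto
      moreover have "reach5 x x"
        unfolding reach5_def by (intro bexI[of _ "mat 1"]) auto
      ultimately show ?thesis by blast
    qed
  qed
qed

lemma reach5_reach: "reach5 x y \<Longrightarrow> reach x y"
  by (auto simp: reach5_def reach_def)

text \<open>Thus all isotropic lines form one orbit. If the third coordinate is nonzero, it serves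
  as pivot for clearing the others, and the cube of \<open>coxeter\<close> then exchanges the
  coordinates 3 and 5.\<close>

lemma isotropic_vector:
  fixes x :: "'k::field ^ 7"
  assumes two: "(2 :: 'k) \<noteq> 0" and x: "x \<noteq> 0" "form x x = 0"
  shows "\<exists>c. c \<noteq> 0 \<and> reach x (V7 0 0 0 0 c 0 0)"
proof (cases "x $ 3 = 0")
  case True
  show ?thesis
  proof (cases "\<exists>e. x = V7 0 0 0 0 e 0 0")
    case True
    then obtain e where e: "x = V7 0 0 0 0 e 0 0" by blast
    have "e \<noteq> 0" using x(1) e by (auto simp: zero_V7)
    moreover have "reach x (V7 0 0 0 0 e 0 0)" unfolding e by (rule reach_refl)
    ultimately show ?thesis by blast
  next
    case False
    then have ne: "x \<noteq> V7 0 0 0 0 e 0 0" for e by blast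
    obtain c e where c: "c \<noteq> 0" and r: "reach5 x (V7 c 0 0 0 e 0 0) \<or> reach5 x (V7 0 0 0 0 e 0 c)"
      using isotropic_vector5[OF two ne x(2) True] by blast
    from r show ?thesis
    proof
      assume "reach5 x (V7 c 0 0 0 e 0 0)"
      from reach_trans[OF reach5_reach[OF this] reach_x_pos[of _ Alpha "e / c"]]
      have "reach x (V7 c 0 0 0 0 0 0)" using c by simp
      from reach_trans[OF this reach_coxeter[of _ 5]] c show ?thesis
        by (auto simp: eval_nat_numeral mvm)
    next
      assume "reach5 x (V7 0 0 0 0 e 0 c)"
      from reach_trans[OF reach5_reach[OF this] reach_x_pos[of _ ThreeAlpha_TwoBeta "- e / c"]]
      have "reach x (V7 0 0 0 0 0 0 c)" using c by simp
      from reach_trans[OF this reach_coxeter[of _ 2]] c show ?thesis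
        by (intro exI[of _ "- c"]) (auto simp: eval_nat_numeral mvm)
    qed
  qed
next
  case False
  obtain a b c d e f g where x_eq: "x = V7 a b c d e f g" by (rule V7_cases)
  have c: "c \<noteq> 0" using False by (simp add: x_eq)
  obtain a b d e f where 2: "reach x (V7 a b c d e f 0)"
    using reach_x_pos[of x Alpha "g / c"] c unfolding x_eq by auto
  obtain a b d e where 3: "reach x (V7 a b c d e 0 0)"
    using reach_trans[OF 2 reach_x_pos[of _ Alpha_Beta "- f / c"]] c by auto
  obtain a b e where 4: "reach x (V7 a b c 0 e 0 0)"
    using reach_trans[OF 3 reach_x_pos[of _ TwoAlpha_Beta "d / c"]] c by auto
  obtain a e where 5: "reach x (V7 a 0 c 0 e 0 0)"
    using reach_trans[OF 4 reach_x_pos[of _ ThreeAlpha_Beta "- b / c"]] c by auto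
  obtain e where 6: "reach x (V7 0 0 c 0 e 0 0)"
    using reach_trans[OF 5 reach_x_pos[of _ ThreeAlpha_TwoBeta "- a / c"]] c by auto
  have "- (2 * (c * e)) = form (V7 0 0 c 0 e 0 0) (V7 0 0 c 0 e 0 0)" by (simp add: mult.commute)
  then have "e = 0" using reach_form[OF 6] x(2) two c by simp
  then show ?thesis
    using reach_trans[OF 6 reach_coxeter[of _ 3]] c by (auto simp: eval_nat_numeral mvm)
qed

text \<open>Once x lies on the line of the fifth basis vector, its stabiliser brings y into the
  plane with the first or with the seventh basis vector. In the latter case \<open>coxeter\<close>
  moves the plane to that of the first two.\<close>

lemma isotropic_plane:
  fixes x y :: "'k::field ^ 7"
  assumes two: "(2 :: 'k) \<noteq> 0" and x: "x \<noteq> 0" "form x x = 0" and y: "\<And>c. y \<noteq> c *s x" "form y y = 0" "form x y = 0"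
  shows "\<exists>h\<in>carrier G2. (\<exists>a b c d. h *v x = V7 a c 0 0 0 0 0 \<and> h *v y = V7 b d 0 0 0 0 0) \<or>
     (\<exists>a b c d. h *v x = V7 a 0 0 0 c 0 0 \<and> h *v y = V7 b 0 0 0 d 0 0)"
proof -
  obtain c h where c: "c \<noteq> 0" and h: "h \<in> carrier G2" "h *v x = V7 0 0 0 0 c 0 0"
    using isotropic_vector[OF two x] by (auto simp: reach_def)
  have hGL: "h \<in> carrier GL" using h(1) by (rule G2_GL)
  have ho: "ortho h" using G2_SO7[OF h(1)] by (simp add: SO7_iff)
  let ?y = "h *v y"
  have 1: "?y \<noteq> V7 0 0 0 0 e 0 0" for e
  proof
    assume "?y = V7 0 0 0 0 e 0 0"
    then have "?y = (e / c) *s (h *v x)" using c h by (simp add: vec_eq_iff forall_7)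
    then have "h *v y = h *v ((e / c) *s x)" by (simp add: vec.scale matrix_vector_mult_scaleR vector_scalar_commute)
    then show False using y(1) GL_inv_vec(1)[OF hGL] by metis
  qed
  have 2: "form ?y ?y = 0" using ho y(2) by (simp add: ortho_def)
  have "form (V7 0 0 0 0 c 0 0) ?y = 0" using ho y(3) h(2) unfolding ortho_def by metis
  then have 3: "?y $ 3 = 0" using c by (simp add: form_def)
  obtain k e g where k: "g \<in> carrier G2" "g *v V7 0 0 0 0 1 0 0 = V7 0 0 0 0 1 0 0" 
    "k \<noteq> 0" "g *v ?y = V7 k 0 0 0 e 0 0 \<or> g *v ?y = V7 0 0 0 0 e 0 k"
    using isotropic_vector5[OF two 1 2 3] by (auto simp: reach5_def)
  have "g *v V7 0 0 0 0 c 0 0 = V7 0 0 0 0 c 0 0"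
    using k(2) by (auto simp: vec_eq_iff forall_7 matrix_vec_V7)
  then have gx: "(g ** h) *v x = V7 0 0 0 0 c 0 0" by (simp add: mvm h)
  show ?thesis
  proof (cases "g *v ?y = V7 k 0 0 0 e 0 0")
    case True
    then show ?thesis
      using gx G2_mult[OF k(1) h(1)] by (intro bexI[of _ "g ** h"]) (auto simp: mvm)
  next
    case False
    then have gy: "g *v ?y = V7 0 0 0 0 e 0 k" using k by blast
    have "(mpow coxeter 1 ** (g ** h)) *v x = V7 c 0 0 0 0 0 0" "(mpow coxeter 1 ** (g ** h)) *v y = V7 e k 0 0 0 0 0"
      using gx gy by (simp_all add: mvm)
    moreover have "mpow coxeter 1 ** (g ** h) \<in> carrier G2"
      by (intro G2_mult k h coxeter_pow_G2)
    ultimately show ?thesis by blast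
  qed
qed

text \<open>\<open>gam\<close> maps the plane of the first two basis vectors, which lies in the open orbit, to the
  plane of the first and fifth basis vectors, which lies in the closed orbit.\<close>

definition gam :: "'k::field ^ 7 ^ 7" where
  "gam = (\<chi> i j. if (i, j) \<in> {(1, 1), (2, 5), (4, 4), (5, 2), (7, 7)} then 1
     else if (i, j) \<in> {(3, 6), (6, 3)} then - 1 else 0)"

lemma gam_V7 [simp]: "gam *v V7 a b c d e f g = V7 a e (- f) d b (- c) g"
  by (simp add: vec_eq_iff forall_7 matrix_vec_V7 gam_def)

lemma gam_SO7: "gam \<in> carrier (SO7 :: ('a::field ^ 7 ^ 7) monoid)"
proof -
  define s t where "s = ((\<chi> i j. if i \<in> {2, 5} then (if (i, j) \<in> {(2, 5), (5, 2)} then 1 else 0) else if i = j then 1 else 0) :: 'a ^ 7 ^ 7)"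
    and "t = ((\<chi> i j. if i \<in> {3, 6} then (if (i, j) \<in> {(3, 6), (6, 3)} then - 1 else 0) else if i = j then 1 else 0) :: 'a ^ 7 ^ 7)"
  have "gam = s ** (t :: 'a^7^7)"
  proof (rule matrix7_eqI)
    fix a b c d e f g :: 'a
    have "t *v V7 a b c d e f g = V7 a b (- f) d e (- c) g"
      by (simp add: vec_eq_iff forall_7 matrix_vec_V7 t_def)
    moreover have "s *v V7 a b (- f) d e (- c) g = V7 a e (- f) d b (- c) g"
      by (simp add: vec_eq_iff forall_7 matrix_vec_V7 s_def)
    ultimately show "gam *v V7 a b c d e f g = s ** t *v V7 a b c d e f g"
      by (simp add: mvm)
  qed
  moreover have "det (s :: 'a^7^7) = -1" 
    by (subst det_supported_2[of 2 5]) (auto simp: s_def)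
  moreover have "det (t :: 'a^7^7) = -1" 
    by (subst det_supported_2[of 3 6]) (auto simp: t_def)
  ultimately have "det (gam :: 'a^7^7) = (- 1) * (- 1)" by (metis det_mul)
  then have "det (gam :: 'a^7^7) = 1" by simp
  moreover have "ortho gam" by (rule orthoI) (simp add: algebra_simps)
  moreover have "gam ** gam = (mat 1 :: 'a^7^7)" by (rule matrix7_eqI) (simp add: mvm)
  then have "gam \<in> carrier (GL :: ('a^7^7) monoid)" unfolding GL_def invertible_def by auto
  ultimately show ?thesis by (simp add: SO7_iff)
qed

text \<open>The coset of g modulo \<open>P_tilde\<close> corresponds to the image under the inverse
  of g of the plane of the first two basis vectors, so double cosets are orbits of planes.\<close>

lemma double_cosets:
  fixes g :: "'k::field ^ 7 ^ 7"
  assumes two: "(2 :: 'k) \<noteq> 0" and g: "g \<in> carrier SO7"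
  obtains p h where "p \<in> P_tilde" "h \<in> carrier G2" "g = p ** h \<or> g = p ** gam ** h"
proof -
  define g' where "g' = ginv g"
  have g': "g' \<in> carrier SO7" "g' \<in> carrier GL" "ortho g'"
    using SO7_inv[OF g] by (auto simp: g'_def SO7_iff)
  let ?e1 = "V7 1 0 0 0 0 0 (0::'k)" and ?e2 = "V7 0 1 0 0 0 0 (0::'k)"
  have inj: "u = v" if "g' *v u = g' *v v" for u v
    using that GL_inv_vec(1)[OF g'(2)] by metis
  have "g' *v ?e1 \<noteq> 0"
  proof
    assume "g' *v ?e1 = 0"
    then have "g' *v ?e1 = g' *v 0" by simp
    from inj[OF this] show False by (simp add: zero_V7)
  qed
  moreover have "g' *v ?e2 \<noteq> c *s (g' *v ?e1)" for c
  proof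
    assume "g' *v ?e2 = c *s (g' *v ?e1)"
    then have "g' *v ?e2 = g' *v (c *s ?e1)" by (simp add: vec.scale vector_scalar_commute)
    from inj[OF this] show False by (simp add: vec_eq_iff forall_7)
  qed
  ultimately obtain h where h: "h \<in> carrier G2"
    "(\<exists>a b c d. h *v (g' *v ?e1) = V7 a c 0 0 0 0 0 \<and> h *v (g' *v ?e2) = V7 b d 0 0 0 0 0) \<or>
     (\<exists>a b c d. h *v (g' *v ?e1) = V7 a 0 0 0 c 0 0 \<and> h *v (g' *v ?e2) = V7 b 0 0 0 d 0 0)"
    using isotropic_plane[OF two, of "g' *v ?e1" "g' *v ?e2"] g'(3) by (auto simp: ortho_def)
  have hGL: "h \<in> carrier GL" using h(1) by (rule G2_GL)
  have hS: "h \<in> carrier SO7" using h(1) by (rule G2_SO7)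
  have gGL: "g \<in> carrier GL" using g by (simp add: SO7_GL)
  from h(2) show thesis
  proof
    assume "\<exists>a b c d. h *v (g' *v ?e1) = V7 a c 0 0 0 0 0 \<and> h *v (g' *v ?e2) = V7 b d 0 0 0 0 0"
    then have "h ** g' \<in> P_tilde"
      using hS g'(1) by (auto simp: P_tilde_iff SO7_mult plane_stable_def mvm)
    then have "ginv (h ** g') \<in> P_tilde" by (rule P_tilde_inv)
    moreover have "g = ginv (h ** g') ** h"
    proof -
      have "ginv (h ** g') = ginv g' ** ginv h"
        using GL.inv_mult_group[OF hGL g'(2)] by simp
      then show ?thesis using gGL hGL by (simp add: g'_def flip: matrix_mul_assoc)
    qed
    ultimately show thesis using that h(1) by blast
  next
    assume "\<exists>a b c d. h *v (g' *v ?e1) = V7 a 0 0 0 c 0 0 \<and> h *v (g' *v ?e2) = V7 b 0 0 0 d 0 0"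
    then have "gam ** h ** g' \<in> P_tilde"
      using SO7_mult[OF SO7_mult[OF gam_SO7 hS] g'(1)] by (auto simp: P_tilde_iff plane_stable_def mvm)
    then have "ginv (gam ** h ** g') \<in> P_tilde" by (rule P_tilde_inv)
    moreover have "g = ginv (gam ** h ** g') ** gam ** h"
    proof -
      have gh: "gam ** h \<in> carrier GL" by (rule GL_mult[OF SO7_GL[OF gam_SO7] hGL])
      have "ginv (gam ** h ** g') = ginv g' ** ginv (gam ** h)"
        using GL.inv_mult_group[OF gh g'(2)] by simp
      then have "ginv (gam ** h ** g') ** (gam ** h) = g"
        using gGL gh by (simp add: g'_def flip: matrix_mul_assoc)
      then show ?thesis by (simp add: matrix_mul_assoc)
    qed
    ultimately show thesis using that h(1) by blast
  qed
qed

lemma RS_not_Alpha_fix: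
  "n \<in> RS (- {Alpha}) \<Longrightarrow> n *v V7 1 0 0 0 0 0 0 = V7 1 0 0 0 0 0 0 \<and> n *v V7 0 0 0 0 1 0 0 = V7 0 0 0 0 1 0 0"
proof (induction rule: RS_induct)
  case (x_pos \<gamma> r)
  then show ?case by (cases \<gamma> rule: pos_root.exhaust) auto
qed (simp_all add: mvm)

lemma corner_one_iff: "corner p = mat 1 \<longleftrightarrow> p $ 1 $ 1 = 1 \<and> p $ 1 $ 2 = 0 \<and> p $ 2 $ 1 = 0 \<and> p $ 2 $ 2 = 1"
  by (simp add: mat2_eq_iff mat_def)

lemma P_tilde_fix:
  assumes "p \<in> carrier SO7" "p *v V7 1 0 0 0 0 0 0 = V7 1 0 0 0 0 0 0" "p *v V7 0 1 0 0 0 0 0 = V7 0 1 0 0 0 0 0"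
  shows "p \<in> P_tilde" "corner p = mat 1"
proof -
  show "p \<in> P_tilde" using assms by (auto simp: P_tilde_iff plane_stable_def)
  show "corner p = mat 1"
    using assms(2,3) unfolding corner_one_iff by (simp add: vec_eq_iff forall_7 V7_units)
qed

text \<open>The subgroup fixes the first and fifth basis vectors. As \<open>gam\<close> interchanges
  the second and fifth ones, the conjugate fixes the plane of the first two pointwise.\<close>

lemma gam_conj_P_tilde:
  assumes "n \<in> RS (- {Alpha})"
  shows "\<exists>p\<in>P_tilde. corner p = mat 1 \<and> gam ** n = p ** gam"
proof
  have gam2: "gam ** gam = (mat 1 :: 'a^7^7)" by (rule matrix7_eqI) (simp add: mvm)
  let ?p = "gam ** n ** gam"
  have "?p \<in> carrier SO7" by (intro SO7_mult gam_SO7 G2_SO7 RS_G2[OF assms])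
  moreover have "?p *v V7 1 0 0 0 0 0 0 = V7 1 0 0 0 0 0 0" "?p *v V7 0 1 0 0 0 0 0 = V7 0 1 0 0 0 0 0"
    using RS_not_Alpha_fix[OF assms] by (simp_all add: mvm)
  ultimately show "?p \<in> P_tilde" "corner ?p = mat 1 \<and> gam ** n = ?p ** gam"
    using P_tilde_fix gam2 by (auto simp flip: matrix_mul_assoc)
qed

lemma corner_mult:
  assumes "plane_stable q"
  shows "corner (p ** q) = corner p ** corner q"
  using assms by (simp add: plane_stable_iff mat2_eq_iff mat2_mult) (simp add: matrix_matrix_mult_def sum_7)

lemma corner_x_Beta: "x_pos Beta r \<in> P_tilde" "corner (x_pos Beta r) = n2 r"
proof -
  have "x_pos Beta r *v V7 1 0 0 0 0 0 0 = V7 1 0 0 0 0 0 0" "x_pos Beta r *v V7 0 1 0 0 0 0 0 = V7 r 1 0 0 0 0 0"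
    by simp_all
  then show "x_pos Beta r \<in> P_tilde" "corner (x_pos Beta r) = n2 r"
    unfolding P_tilde_iff plane_stable_def mat2_eq_iff
    by (auto simp: x_pos_SO7 vec_eq_iff forall_7 V7_units simp del: x_pos_V7)
qed

lemma n_beta_P_tilde: "n_beta \<in> P_tilde"
  by (simp add: P_tilde_iff n_SO7 plane_stable_def)

lemma torus_P_tilde: "a \<noteq> 0 \<Longrightarrow> b \<noteq> 0 \<Longrightarrow> torus a b \<in> P_tilde"
  by (simp add: P_tilde_iff G2_SO7 torus_G2 plane_stable_def)

lemma U3_P_tilde:
  assumes "u \<in> RS U3"
  shows "u \<in> P_tilde" "corner u = mat 1"
proof -
  have "u *v V7 1 0 0 0 0 0 0 = V7 1 0 0 0 0 0 0 \<and> u *v V7 0 1 0 0 0 0 0 = V7 0 1 0 0 0 0 0"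
    using assms
  proof (induction rule: RS_induct)
    case (x_pos \<gamma> r)
    then show ?case by auto
  qed (simp_all add: mvm)
  then show "u \<in> P_tilde" "corner u = mat 1"
    using P_tilde_fix[OF G2_SO7[OF RS_G2[OF assms]]] by auto
qed

text \<open>An element of \<open>P_tilde\<close> keeps the first basis vector in the plane of the
  first two, and upper unipotent elements create no coordinates 3, 6 or 7 from it. Each of the three
  nontrivial families of relevant torus normaliser elements produces one of these coordinates, so
  only the identity remains.\<close>

lemma G2_P_tilde_relevant:
  fixes \<psi> :: "'k::field \<Rightarrow> complex"
  assumes \<psi>: "nontrivial_additive_char \<psi>" and g: "g \<in> carrier G2" "g \<in> P_tilde" "\<not> irr \<psi> g"
  shows "g \<in> carrier U_G2" "corner g = n2 (g $ 1 $ 2)" "psi_U \<psi> g = \<psi> (g $ 1 $ 2)"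
proof -
  obtain u n u' where u: "u \<in> carrier U_G2" "n \<in> N_T" "u' \<in> carrier U_G2" "g = u ** n ** u'"
    using bruhat_cases[OF g(1)] .
  have rk: "rk 1 = 1" "rk 2 = 2" "rk 3 = 6" "rk 4 = 3" "rk 5 = 0" "rk 6 = 4" "rk 7 = 5"
    by (simp_all add: rk_def)
  have stable: "g $ 3 $ 1 = 0" "g $ 4 $ 1 = 0" "g $ 5 $ 1 = 0" "g $ 6 $ 1 = 0" "g $ 7 $ 1 = 0"
    using g(2) by (auto simp: P_tilde_iff plane_stable_iff)
  let ?e1 = "V7 1 0 0 0 0 0 (0::'k)"
  define v where "v = ginv u"
  have v: "unitri v" unfolding v_def by (intro unitri_U_G2 RS_inv u)
  have ge: "g *v ?e1 = V7 (g $ 1 $ 1) (g $ 2 $ 1) 0 0 0 0 0"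
    using stable by (simp add: vec_eq_iff forall_7 matrix_vec_V7)
  have low: "(v *v (g *v ?e1)) $ i = 0" if "i \<in> {3, 6, 7}" for i
    unfolding ge using that v rk by (auto simp: matrix_vec_V7 unitri_def)
  have u'e: "u' *v ?e1 = V7 1 0 0 0 (u' $ 5 $ 1) 0 0"
    using unitri_U_G2[OF u(3)] rk by (simp add: vec_eq_iff forall_7 V7_units unitri_def)
  have "v ** g = n ** u'" using u RS_GL[OF u(1)] by (simp add: v_def flip: matrix_mul_assoc)
  then have "v *v (g *v ?e1) = n *v V7 1 0 0 0 (u' $ 5 $ 1) 0 0"
    by (metis matrix_vector_mul_assoc u'e)
  then have nz: "(n *v V7 1 0 0 0 (u' $ 5 $ 1) 0 0) $ i = 0" if "i \<in> {3, 6, 7}" for i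
    using low[OF that] by simp
  have "\<not> irr \<psi> n" using irr_U_mult[OF \<psi> _ u(1,3)] g(3) u(4) by blast
  then have n: "n = mat 1"
  proof -
    have "n \<noteq> mpow coxeter 3 ** torus a b" "n \<noteq> mpow coxeter 3 ** n_alpha ** torus a b"
      "n \<noteq> mpow coxeter 2 ** n_alpha ** torus a b" if "a \<noteq> 0" "b \<noteq> 0" for a b
      using that nz[of 3] nz[of 6] nz[of 7] by (auto simp: mvm eval_nat_numeral)
    then show ?thesis using N_T_relevant[OF \<psi> u(2)] \<open>\<not> irr \<psi> n\<close> by blast
  qed
  show gU: "g \<in> carrier U_G2" using u n RS_mult[OF u(1,3)] by simp
  show "corner g = n2 (g $ 1 $ 2)"
    using unitri_U_G2[OF gU] rk by (simp add: mat2_eq_iff unitri_def)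
  show "psi_U \<psi> g = \<psi> (g $ 1 $ 2)"
    using psi_U_eq[OF \<psi> gU] stable by simp
qed

section \<open>Restriction of the induced representation\<close>

locale generic_pair =
  fixes \<psi> :: "'k::{field, finite} \<Rightarrow> complex"
    and \<pi> :: "('k ^ 7 ^ 7, 'w::ab_group_add) rep"
    and \<tau> :: "('k ^ 2 ^ 2, 'v::ab_group_add) rep"
  assumes two: "(2 :: 'k) \<noteq> 0"
    and psi: "nontrivial_additive_char \<psi>"
    and irr_\<pi>: "irreducible_rep G2 \<pi>" and gen_\<pi>: "generic_G2 \<psi> \<pi>" and cusp: "cuspidal_G2 \<pi>"
    and irr_\<tau>: "irreducible_rep GL \<tau>" and gen_\<tau>: "generic_GL2 \<tau>"
begin

sublocale P: twisted G2 \<pi> "carrier U_G2" "psi_U \<psi>"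
  by (rule twisted_U_G2[OF psi]) (use irr_\<pi> in \<open>simp add: irreducible_rep_def\<close>)

sublocale T: twisted GL \<tau> "range n2" "\<lambda>n. \<psi> (n $ 1 $ 2)"
  by (rule twisted_N_GL2[OF psi]) (use irr_\<tau> in \<open>simp add: irreducible_rep_def\<close>)

abbreviation I where "I \<equiv> vspace (I_rep \<tau>)"

lemma I_iff: "f \<in> I \<longleftrightarrow> (\<forall>g\<in>carrier SO7. f g \<in> vspace \<tau>) \<and> (\<forall>g. g \<notin> carrier SO7 \<longrightarrow> f g = 0) \<and>
    (\<forall>p\<in>P_tilde. \<forall>g\<in>carrier SO7. f (p ** g) = act \<tau> (corner p) (f g))"
  by (auto simp: I_rep_def induced_rep_def tensor_one_SO3_def GL2_part_corner[OF two])

lemma act_I: "act (I_rep \<tau>) h f g = (if g \<in> carrier SO7 then f (g ** h) else 0)"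
  by (simp add: I_rep_def induced_rep_def)

lemma smult_I: "smult (I_rep \<tau>) c f g = smult \<tau> c (f g)"
  by (simp add: I_rep_def induced_rep_def tensor_one_SO3_def)

text \<open>For s in \<open>SO7\<close>, the element of the induced space supported on the coset of
  s with value v at s.\<close>

definition delta :: "'k ^ 7 ^ 7 \<Rightarrow> 'v \<Rightarrow> 'k ^ 7 ^ 7 \<Rightarrow> 'v" where
  "delta s v x = (if x \<in> carrier SO7 \<and> x ** ginv s \<in> P_tilde then act \<tau> (corner (x ** ginv s)) v else 0)"

lemma corner_mat_1: "corner (mat 1) = mat 1"
  unfolding corner_one_iff by (simp add: mat_def)

lemma corner_P_GL: "p \<in> P_tilde \<Longrightarrow> corner p \<in> carrier GL"
  by (rule corner_GL) (auto simp: P_tilde_iff SO7_GL)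

lemma corner_P_mult: "q \<in> P_tilde \<Longrightarrow> corner (p ** q) = corner p ** corner q"
  by (rule corner_mult) (simp add: P_tilde_iff)

lemma act_corner_mult:
  "p \<in> P_tilde \<Longrightarrow> q \<in> P_tilde \<Longrightarrow> v \<in> vspace \<tau> \<Longrightarrow>
     act \<tau> (corner (p ** q)) v = act \<tau> (corner p) (act \<tau> (corner q) v)"
  using T.act_mult[OF corner_P_GL corner_P_GL] by (simp add: corner_P_mult)

lemma P_tilde_left: "p \<in> P_tilde \<Longrightarrow> p ** q \<in> P_tilde \<longleftrightarrow> q \<in> P_tilde"
  using P_tilde_mult[OF P_tilde_inv, of p "p ** q"] P_tilde_mult[of p q] by (auto simp: P_tilde_GL)

lemma P_tilde_right: "p \<in> P_tilde \<Longrightarrow> q ** p \<in> P_tilde \<longleftrightarrow> q \<in> P_tilde"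
  using P_tilde_mult[OF _ P_tilde_inv, of "q ** p" p] P_tilde_mult[of q p]
  by (auto simp: P_tilde_GL simp flip: matrix_mul_assoc)

lemma SO7_left: "p \<in> carrier SO7 \<Longrightarrow> p ** q \<in> carrier SO7 \<longleftrightarrow> q \<in> carrier SO7"
  using SO7_mult[OF SO7_inv, of p "p ** q"] SO7_mult[of p q] by (auto simp: SO7_GL)

lemma SO7_right: "p \<in> carrier SO7 \<Longrightarrow> q ** p \<in> carrier SO7 \<longleftrightarrow> q \<in> carrier SO7"
  using SO7_mult[OF _ SO7_inv, of "q ** p" p] SO7_mult[of q p]
  by (auto simp: SO7_GL simp flip: matrix_mul_assoc)

lemma delta_in_I: 
  assumes "v \<in> vspace \<tau>"
  shows "delta s v \<in> I"
  unfolding I_iff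
proof (intro conjI ballI allI impI)
  fix p g :: "'k ^ 7 ^ 7" assume p: "p \<in> P_tilde" and g: "g \<in> carrier SO7"
  have "p ** g ** ginv s = p ** (g ** ginv s)" by (simp add: matrix_mul_assoc)
  then show "delta s v (p ** g) = act \<tau> (corner p) (delta s v g)"
    using p g assms by (auto simp: delta_def SO7_left P_tilde_SO7 P_tilde_left act_corner_mult corner_P_GL)
qed (auto simp: delta_def assms corner_P_GL)

lemma GL_inv_mult: "x \<in> carrier GL \<Longrightarrow> y \<in> carrier GL \<Longrightarrow> ginv (x ** y) = ginv y ** ginv x"
  for x y :: "'k ^ 7 ^ 7"
  using GL.inv_mult_group[of x y] by simp

lemma act_delta:
  assumes "s \<in> carrier SO7" "h \<in> carrier SO7"
  shows "act (I_rep \<tau>) h (delta s v) = delta (s ** ginv h) v"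
proof
  fix x :: "'k ^ 7 ^ 7"
  have "x ** ginv (s ** ginv h) = x ** h ** ginv s"
    using assms by (simp add: GL_inv_mult SO7_GL SO7_inv matrix_mul_assoc)
  then show "act (I_rep \<tau>) h (delta s v) x = delta (s ** ginv h) v x"
    using assms by (auto simp: act_I delta_def SO7_right)
qed

lemma delta_P:
  assumes "p \<in> P_tilde" "s \<in> carrier SO7" "v \<in> vspace \<tau>"
  shows "delta (p ** s) v = delta s (act \<tau> (corner (ginv p)) v)"
proof
  fix x :: "'k ^ 7 ^ 7"
  have "x ** ginv (p ** s) = x ** ginv s ** ginv p"
    using assms by (simp add: GL_inv_mult SO7_GL P_tilde_GL matrix_mul_assoc)
  then show "delta (p ** s) v x = delta s (act \<tau> (corner (ginv p)) v) x"
    using assms by (auto simp: delta_def P_tilde_right P_tilde_inv act_corner_mult)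
qed

lemma finite_matrix_set [simp]: "finite (A :: ('k ^ 7 ^ 7) set)"
  by (rule finite_subset[OF subset_UNIV finite])

lemma sum_fun_apply: "(\<Sum>i\<in>A. F i) x = (\<Sum>i\<in>A. F i x)" for F :: "'i \<Rightarrow> 'a \<Rightarrow> 'b::ab_group_add"
  by (induction A rule: infinite_finite_induct) (auto simp: zero_fun_def)

text \<open>The sum runs over the whole group instead of coset representatives, so each coset
  contributes once for every element of \<open>P_tilde\<close>; hence the factor.\<close>

lemma delta_expansion:
  assumes f: "f \<in> I"
  shows "(\<Sum>s\<in>carrier SO7. delta s (f s)) = smult (I_rep \<tau>) (of_nat (card (P_tilde :: ('k ^ 7 ^ 7) set))) f"
proof
  fix x :: "'k ^ 7 ^ 7"
  show "(\<Sum>s\<in>carrier SO7. delta s (f s)) x = smult (I_rep \<tau>) (of_nat (card (P_tilde :: ('k ^ 7 ^ 7) set))) f x"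
  proof (cases "x \<in> carrier SO7")
    case x: True
    let ?A = "{s :: 'k ^ 7 ^ 7. s \<in> carrier SO7 \<and> x ** ginv s \<in> P_tilde}"
    have "(\<Sum>s\<in>carrier SO7. delta s (f s) x) = (\<Sum>s\<in>carrier SO7. if s \<in> ?A then f x else 0)"
    proof (rule sum.cong[OF refl])
      fix s :: "'k ^ 7 ^ 7" assume s: "s \<in> carrier SO7"
      have "x = x ** ginv s ** s" using s by (simp add: SO7_GL flip: matrix_mul_assoc)
      then have "act \<tau> (corner (x ** ginv s)) (f s) = f x" if "x ** ginv s \<in> P_tilde"
        using f that s unfolding I_iff by metis
      then show "delta s (f s) x = (if s \<in> ?A then f x else 0)"
        using s x by (auto simp: delta_def)
    qed
    also have "\<dots> = (\<Sum>s\<in>?A. f x)" by (rule sum.mono_neutral_cong_right) auto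
    also have "\<dots> = smult \<tau> (of_nat (card ?A)) (f x)" by (rule T.vs.sum_constant_scale)
    also have "card ?A = card (P_tilde :: ('k ^ 7 ^ 7) set)"
    proof (rule bij_betw_same_card[of "\<lambda>s. x ** ginv s"], rule bij_betw_byWitness[where f' = "\<lambda>p. ginv p ** x"])
      show "\<forall>s\<in>?A. ginv (x ** ginv s) ** x = s"
        using x by (auto simp: GL_inv_mult SO7_GL SO7_inv simp flip: matrix_mul_assoc)
      show "\<forall>p\<in>P_tilde. x ** ginv (ginv p ** x) = p"
        using x by (auto simp: GL_inv_mult SO7_GL P_tilde_GL P_tilde_inv)
      show "(\<lambda>p. ginv p ** x) ` P_tilde \<subseteq> ?A"
        using x by (auto simp: GL_inv_mult SO7_GL P_tilde_GL P_tilde_inv SO7_mult[OF SO7_inv[OF P_tilde_SO7]])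
    qed auto
    finally show ?thesis by (simp add: sum_fun_apply smult_I)
  next
    case False
    then show ?thesis using f by (simp add: sum_fun_apply smult_I delta_def I_iff)
  qed
qed

lemma smult_I_closed: "f \<in> I \<Longrightarrow> smult (I_rep \<tau>) c f \<in> I"
  by (auto simp: I_iff smult_I T.act_scale corner_P_GL)

lemma add_I_closed: "f \<in> I \<Longrightarrow> f' \<in> I \<Longrightarrow> f + f' \<in> I"
  by (auto simp: I_iff T.act_add corner_P_GL)

lemma act_I_closed:
  assumes "f \<in> I" "h \<in> carrier SO7"
  shows "act (I_rep \<tau>) h f \<in> I"
  unfolding I_iff
proof (intro conjI ballI allI impI)
  fix p g :: "'k ^ 7 ^ 7" assume p: "p \<in> P_tilde" and g: "g \<in> carrier SO7"
  have "p ** g ** h = p ** (g ** h)" by (simp add: matrix_mul_assoc)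
  then show "act (I_rep \<tau>) h f (p ** g) = act \<tau> (corner p) (act (I_rep \<tau>) h f g)"
    using assms p g SO7_mult[OF g assms(2)] by (auto simp: act_I I_iff SO7_left P_tilde_SO7)
qed (use assms in \<open>auto simp: act_I I_iff SO7_mult\<close>)

section \<open>Intertwining maps and their two orbit components\<close>

abbreviation Hom where "Hom \<equiv> hom_space G2 (I_rep \<tau>) \<pi>"

lemma Hom_V: "T \<in> Hom \<Longrightarrow> f \<in> I \<Longrightarrow> T f \<in> vspace \<pi>"
  by (auto simp: hom_space_def)

lemma Hom_add: "T \<in> Hom \<Longrightarrow> f \<in> I \<Longrightarrow> f' \<in> I \<Longrightarrow> T (f + f') = T f + T f'"
  by (auto simp: hom_space_def linear_on_def)

lemma Hom_smult: "T \<in> Hom \<Longrightarrow> f \<in> I \<Longrightarrow> T (smult (I_rep \<tau>) c f) = smult \<pi> c (T f)"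
  by (auto simp: hom_space_def linear_on_def)

lemma Hom_act: "T \<in> Hom \<Longrightarrow> f \<in> I \<Longrightarrow> g \<in> carrier G2 \<Longrightarrow> T (act (I_rep \<tau>) g f) = act \<pi> g (T f)"
  by (auto simp: hom_space_def)

lemma zero_I: "0 \<in> I"
  by (auto simp: I_iff corner_P_GL)

lemma Hom_zero: "T \<in> Hom \<Longrightarrow> T 0 = 0"
  using Hom_add[of T 0 0] zero_I by simp

lemma Hom_sum: "T \<in> Hom \<Longrightarrow> finite A \<Longrightarrow> (\<And>i. i \<in> A \<Longrightarrow> F i \<in> I) \<Longrightarrow> T (\<Sum>i\<in>A. F i) = (\<Sum>i\<in>A. T (F i)) \<and> (\<Sum>i\<in>A. F i) \<in> I"
  by (rotate_tac 1, induction A rule: finite_induct) (auto simp: Hom_zero Hom_add zero_I add_I_closed)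

lemma Hom_eq_0:
  assumes T: "T \<in> Hom" and delta: "\<And>s v. s \<in> carrier SO7 \<Longrightarrow> v \<in> vspace \<tau> \<Longrightarrow> T (delta s v) = 0"
  shows "T = 0"
proof
  fix f
  show "T f = 0 f"
  proof (cases "f \<in> I")
    case True
    let ?c = "of_nat (card (P_tilde :: ('k ^ 7 ^ 7) set)) :: complex"
    have V: "f s \<in> vspace \<tau>" if "s \<in> carrier SO7" for s using True that by (simp add: I_iff)
    have "smult \<pi> ?c (T f) = T (\<Sum>s\<in>carrier SO7. delta s (f s))"
      unfolding delta_expansion[OF True] by (simp add: Hom_smult[OF T True])
    also have "\<dots> = (\<Sum>s\<in>carrier SO7. T (delta s (f s)))"
      using Hom_sum[OF T, of "carrier SO7" "\<lambda>s. delta s (f s)"] V by (simp add: delta_in_I)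
    also have "\<dots> = 0" by (rule sum.neutral) (use delta V in blast)
    finally have "smult \<pi> ?c (T f) = 0" .
    moreover have "mat 1 \<in> (P_tilde :: ('k ^ 7 ^ 7) set)" by (simp add: P_tilde_iff plane_stable_def)
    then have "?c \<noteq> 0" by auto
    ultimately show ?thesis by simp
  next
    case False
    then show ?thesis using T by (simp add: hom_space_def)
  qed
qed

lemma fixed_by_generators:
  assumes "v \<in> vspace \<pi>" "\<And>\<gamma> r. \<gamma> \<in> S \<Longrightarrow> act \<pi> (x_pos \<gamma> r) v = v" "n \<in> RS S"
  shows "act \<pi> n v = v"
  using assms(3)
proof (induction rule: RS_induct)
  case one
  show ?case using P.act_one[OF assms(1)] by simp
next
  case (mult n m)
  then show ?case using P.act_mult[of n m v] assms(1) by (simp add: RS_G2)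
qed (rule assms(2))

lemma cuspidal_zero:
  assumes "v \<in> vspace \<pi>" "\<delta> \<in> {Alpha, Beta}" "\<And>n. n \<in> RS (- {\<delta>}) \<Longrightarrow> act \<pi> n v = v"
  shows "v = 0"
proof -
  have one: "ginv (mat 1 :: 'k ^ 7 ^ 7) = mat 1" using GL.inv_one[where 'k='k and 'n=7] by simp
  have "{v \<in> vspace \<pi>. \<forall>n\<in>RS (- {\<delta>}). act \<pi> (mat 1 \<otimes>\<^bsub>G2\<^esub> n \<otimes>\<^bsub>G2\<^esub> inv\<^bsub>G2\<^esub> (mat 1)) v = v} = {0}"
    using cusp[unfolded cuspidal_G2_def, THEN bspec[of _ _ "{\<delta>}"], THEN bspec[of _ _ "mat 1"]] assms(2)
    by auto
  then show ?thesis
    using assms(1,3) one by (auto simp: G2_inv_GL)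
qed

text \<open>The closed orbit: the unipotent radical with Levi root \<alpha> fixes
  \<open>delta gam v\<close>, so the value of T is a vector that cuspidality kills.\<close>

lemma Hom_gam:
  assumes T: "T \<in> Hom" and v: "v \<in> vspace \<tau>"
  shows "T (delta gam v) = 0"
proof (rule cuspidal_zero[of _ Alpha])
  show "T (delta gam v) \<in> vspace \<pi>" using T v by (simp add: Hom_V delta_in_I)
  fix n :: "'k ^ 7 ^ 7" assume n: "n \<in> RS (- {Alpha})"
  obtain p where p: "p \<in> P_tilde" "corner p = mat 1" "gam ** ginv n = p ** gam"
    using gam_conj_P_tilde[OF RS_inv[OF n]] by blast
  have "corner (ginv p) ** corner p = corner (ginv p ** p)" using p by (simp add: corner_P_mult)
  also have "\<dots> = mat 1" using p by (simp add: P_tilde_GL corner_mat_1)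
  finally have c: "corner (ginv p) = mat 1" by (simp add: p(2))
  have "act (I_rep \<tau>) n (delta gam v) = delta (p ** gam) v"
    using act_delta[OF gam_SO7 G2_SO7[OF RS_G2[OF n]]] p(3) by simp
  also have "\<dots> = delta gam v"
    using delta_P[OF p(1) gam_SO7 v] T.act_one[OF v] by (simp add: c)
  finally show "act \<pi> n (T (delta gam v)) = T (delta gam v)"
    using Hom_act[OF T delta_in_I[OF v, of gam] RS_G2[OF n]] by simp
qed simp

text \<open>The open-orbit component of T, a map from \<tau> to \<pi> equivariant under
  \<open>G2\<close> intersected with \<open>P_tilde\<close>.\<close>

definition L where "L T v = T (delta (mat 1) v)"

lemma L_V: "T \<in> Hom \<Longrightarrow> v \<in> vspace \<tau> \<Longrightarrow> L T v \<in> vspace \<pi>"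
  by (simp add: L_def Hom_V delta_in_I)

lemma delta_scale: "v \<in> vspace \<tau> \<Longrightarrow> delta s (smult \<tau> c v) = smult (I_rep \<tau>) c (delta s v)"
  by (rule ext) (simp add: delta_def smult_I T.act_scale corner_P_GL)

lemma delta_add: "v \<in> vspace \<tau> \<Longrightarrow> w \<in> vspace \<tau> \<Longrightarrow> delta s (v + w) = delta s v + delta s w"
  by (rule ext) (simp add: delta_def T.act_add corner_P_GL)

lemma L_add: "T \<in> Hom \<Longrightarrow> v \<in> vspace \<tau> \<Longrightarrow> w \<in> vspace \<tau> \<Longrightarrow> L T (v + w) = L T v + L T w"
  by (simp add: L_def delta_add Hom_add delta_in_I)

lemma L_scale: "T \<in> Hom \<Longrightarrow> v \<in> vspace \<tau> \<Longrightarrow> L T (smult \<tau> c v) = smult \<pi> c (L T v)"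
  by (simp add: L_def delta_scale Hom_smult delta_in_I)

lemma L_zero: "T \<in> Hom \<Longrightarrow> L T 0 = 0"
  using L_add[of T 0 0] by simp

lemma L_sum: "T \<in> Hom \<Longrightarrow> (\<And>i. i \<in> A \<Longrightarrow> F i \<in> vspace \<tau>) \<Longrightarrow> L T (\<Sum>i\<in>A. F i) = (\<Sum>i\<in>A. L T (F i))"
  by (induction A rule: infinite_finite_induct) (auto simp: L_zero L_add)

lemma L_act:
  assumes T: "T \<in> Hom" and h: "h \<in> carrier G2" "h \<in> P_tilde" and v: "v \<in> vspace \<tau>"
  shows "L T (act \<tau> (corner h) v) = act \<pi> h (L T v)"
proof -
  have "act (I_rep \<tau>) h (delta (mat 1) v) = delta (ginv h ** mat 1) v"
    using act_delta[OF mat_1_SO7 G2_SO7[OF h(1)]] by simp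
  also have "\<dots> = delta (mat 1) (act \<tau> (corner (ginv (ginv h))) v)"
    by (rule delta_P[OF P_tilde_inv[OF h(2)] mat_1_SO7 v])
  finally show ?thesis
    using Hom_act[OF T delta_in_I[OF v, of "mat 1"] h(1)] h(1) by (simp add: L_def G2_GL)
qed

text \<open>Every \<open>delta s v\<close> is a translate by \<open>G2\<close> of one at
  \<open>mat 1\<close> or \<open>gam\<close>, and the latter is already killed by
  \<open>Hom_gam\<close>.\<close>

lemma L_eq_0:
  assumes T: "T \<in> Hom" and L: "\<And>v. v \<in> vspace \<tau> \<Longrightarrow> L T v = 0"
  shows "T = 0"
proof (rule Hom_eq_0[OF T])
  fix s :: "'k ^ 7 ^ 7" and v assume s: "s \<in> carrier SO7" and v: "v \<in> vspace \<tau>"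
  obtain p h where ph: "p \<in> P_tilde" "h \<in> carrier G2" "s = p ** h \<or> s = p ** gam ** h"
    using double_cosets[OF two s] by blast
  have hS: "ginv h \<in> carrier SO7" "ginv h \<in> carrier G2" "ginv (ginv h) = h"
    using ph(2) by (auto simp: G2_SO7 G2_inv G2_GL)
  have *: "T (delta (p ** (c ** h)) v) = 0" if c: "c \<in> carrier SO7" and zero: "\<And>v. v \<in> vspace \<tau> \<Longrightarrow> T (delta c v) = 0" for c
  proof -
    let ?v = "act \<tau> (corner (ginv p)) v"
    have v': "?v \<in> vspace \<tau>" using v ph(1) by (simp add: corner_P_GL P_tilde_inv)
    have "delta (p ** (c ** h)) v = delta (c ** h) ?v"
      using c ph v by (intro delta_P) (auto intro: SO7_mult G2_SO7)
    also have "\<dots> = act (I_rep \<tau>) (ginv h) (delta c ?v)"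
      using act_delta[OF c hS(1)] hS(3) by simp
    finally show ?thesis
      using Hom_act[OF T delta_in_I[OF v'] hS(2)] zero[OF v'] hS(2) by simp
  qed
  from ph(3) show "T (delta s v) = 0"
  proof
    assume "s = p ** h"
    then show ?thesis using *[of "mat 1"] L by (simp add: L_def)
  next
    assume "s = p ** gam ** h"
    then have "s = p ** (gam ** h)" by (simp add: matrix_mul_assoc)
    then show ?thesis using *[OF gam_SO7 Hom_gam[OF T]] by simp
  qed
qed

text \<open>The map from v to \<open>P.e (L T v)\<close> transforms under \<open>n2 x\<close> by
  \<psi>, so up to a nonzero scalar it factors through \<open>T.e\<close>, whose image is the line
  of w.\<close>

lemma e_L_zero:
  assumes T: "T \<in> Hom" and w: "w \<in> T.W" "w \<noteq> 0" and zero: "P.e (L T w) = 0" and v: "v \<in> vspace \<tau>"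
  shows "P.e (L T v) = 0"
proof -
  have e_L: "P.e (L T (act \<tau> (n2 x) v)) = smult \<pi> (\<psi> x) (P.e (L T v))" for x
    using L_act[OF T x_pos_G2 corner_x_Beta(1) v] P.e_act[OF x_pos_RS[of Beta UNIV x] L_V[OF T v]]
    by (simp add: corner_x_Beta psi_U_x_pos[OF psi])
  have "P.e (L T (T.e v)) = (\<Sum>n\<in>range (n2 :: 'k \<Rightarrow> _). P.e (L T v))"
  proof -
    have V: "smult \<tau> (1 / \<psi> (n $ 1 $ 2)) (act \<tau> n v) \<in> vspace \<tau>" if "n \<in> range n2" for n
      using that v n2_GL by auto
    have "P.e (L T (T.e v)) = (\<Sum>n\<in>range n2. P.e (L T (smult \<tau> (1 / \<psi> (n $ 1 $ 2)) (act \<tau> n v))))"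
      unfolding T.e_def using V by (simp add: L_sum[OF T] L_V[OF T] P.e_sum)
    also have "\<dots> = (\<Sum>n\<in>range (n2 :: 'k \<Rightarrow> _). P.e (L T v))"
      by (rule sum.cong[OF refl]) (auto simp: L_scale[OF T] L_V[OF T] v n2_GL P.e_scale e_L psi_nz[OF psi])
    finally show ?thesis .
  qed
  also have "\<dots> = smult \<pi> (of_nat (card (range (n2 :: 'k \<Rightarrow> _)))) (P.e (L T v))"
    by (rule P.vs.sum_constant_scale)
  finally have 1: "P.e (L T (T.e v)) = smult \<pi> (of_nat (card (range (n2 :: 'k \<Rightarrow> _)))) (P.e (L T v))" .
  obtain c where "T.e v = smult \<tau> c w"
    using GL2_whittaker_unique[OF psi irr_\<tau> w T.e_in_W[OF v]] by blast
  then have "P.e (L T (T.e v)) = 0"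
    using w zero by (simp add: L_scale[OF T] T.W_V P.e_scale L_V[OF T])
  then show ?thesis using 1 T.card_U by simp
qed

end

section \<open>Vanishing of Whittaker projections\<close>

text \<open>Here h is the inverse of g; the statement moves u through g from left to right.\<close>

lemma right_conj:
  assumes "conj_into h S S" "h ** g = mat 1" "g ** h = mat 1" "u \<in> RS S"
  shows "\<exists>u'\<in>RS S. u ** g = g ** u'"
proof -
  obtain u' where u': "u' \<in> RS S" "h ** u = u' ** h" using conj_intoD[OF assms(1,4)] by blast
  have "u ** g = g ** (h ** u) ** g" using assms(3) by (simp add: matrix_mul_assoc)
  also have "\<dots> = g ** u'" unfolding u'(2) using assms(2) by (simp flip: matrix_mul_assoc)
  finally show ?thesis using u'(1) by blast
qed

lemma right_conj_U3:
  assumes "u \<in> RS U3"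
  shows "\<exists>u'\<in>RS U3. u ** x_pos Alpha r = x_pos Alpha r ** u'"
    "\<exists>u'\<in>RS U3. u ** x_pos Beta r = x_pos Beta r ** u'"
    "\<exists>u'\<in>RS U3. u ** x_pos Alpha_Beta r = x_pos Alpha_Beta r ** u'"
    "\<exists>u'\<in>RS U3. u ** n_beta = n_beta ** u'"
    "a \<noteq> 0 \<Longrightarrow> b \<noteq> 0 \<Longrightarrow> \<exists>u'\<in>RS U3. u ** torus a b = torus a b ** u'"
proof -
  have inv: "x_pos \<gamma> (- r) ** x_pos \<gamma> r = mat 1" "x_pos \<gamma> r ** x_pos \<gamma> (- r) = mat 1" for \<gamma>
    using x_pos_inverse[of \<gamma> "- r"] x_pos_inverse[of \<gamma> r] by simp_all
  show "\<exists>u'\<in>RS U3. u ** x_pos Alpha r = x_pos Alpha r ** u'"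
    "\<exists>u'\<in>RS U3. u ** x_pos Beta r = x_pos Beta r ** u'"
    "\<exists>u'\<in>RS U3. u ** x_pos Alpha_Beta r = x_pos Alpha_Beta r ** u'"
    using right_conj[OF conj_into_U3(1) inv assms] right_conj[OF conj_into_U3(2) inv assms]
      right_conj[OF conj_into_U3(3) inv assms] by blast+
  have "n_beta ** n_beta ** n_beta ** n_beta = (mat 1 :: 'a ^ 7 ^ 7)" "n_beta ** (n_beta ** n_beta ** n_beta) = (mat 1 :: 'a ^ 7 ^ 7)"
    by (rule matrix7_eqI; simp add: mvm)+
  then show "\<exists>u'\<in>RS U3. u ** n_beta = n_beta ** u'"
    using right_conj[OF conj_into_mult[OF conj_into_mult[OF conj_into_U3(4) conj_into_U3(4)] conj_into_U3(4)] _ _ assms] by blast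
  show "\<exists>u'\<in>RS U3. u ** torus a b = torus a b ** u'" if "a \<noteq> 0" "b \<noteq> 0"
    using right_conj[OF conj_into_torus[of "1 / a" "1 / b" U3] _ _ assms, of "torus a b"] that
    by (simp add: torus_mult torus_one)
qed

context generic_pair
begin

text \<open>Encoded by the properties that the stability of \<open>K\<close> requires: closure under
  products, an action on the values of \<open>L T\<close> through \<tau>, and normalising the
  radical. The set is larger than the Levi subgroup, as it also contains
  \<open>RS U3\<close>.\<close>

definition Levi :: "('k ^ 7 ^ 7) set" where
  "Levi = {p \<in> carrier G2. p \<in> P_tilde \<and> conj_into p (- {Beta}) (- {Beta})}"

lemma Levi_mult: "p \<in> Levi \<Longrightarrow> q \<in> Levi \<Longrightarrow> p ** q \<in> Levi"
  by (auto simp: Levi_def G2_mult P_tilde_mult intro: conj_into_mult)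

lemma Levi_members:
  "mat 1 \<in> Levi" "x_pos Beta r \<in> Levi" "n_beta \<in> Levi" "a \<noteq> 0 \<Longrightarrow> b \<noteq> 0 \<Longrightarrow> torus a b \<in> Levi"
proof -
  have "mat 1 \<in> (P_tilde :: ('k ^ 7 ^ 7) set)" by (simp add: P_tilde_iff plane_stable_def)
  then show "mat 1 \<in> Levi" "x_pos Beta r \<in> Levi" "n_beta \<in> Levi" "a \<noteq> 0 \<Longrightarrow> b \<noteq> 0 \<Longrightarrow> torus a b \<in> Levi"
    by (auto simp: Levi_def corner_x_Beta n_beta_P_tilde torus_P_tilde x_pos_G2 n_G2 torus_G2
        conj_into_x_Beta conj_into_n_beta conj_into_torus conj_into_member)
qed

lemma Levi_G2: "p \<in> Levi \<Longrightarrow> p \<in> carrier G2"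
  by (simp add: Levi_def)

text \<open>A space stable under the parabolic subgroup with Levi root \<open>\<beta>\<close>; it turns out to be zero.\<close>

definition K where
  "K = {y \<in> vspace \<pi>. (\<forall>u\<in>RS U3. act \<pi> u y = y) \<and>
     (\<forall>r\<in>RS (- {Beta}). \<forall>p\<in>Levi. P.e (act \<pi> (r ** p) y) = 0)}"

lemma act_mult: "g \<in> carrier G2 \<Longrightarrow> h \<in> carrier G2 \<Longrightarrow> v \<in> vspace \<pi> \<Longrightarrow> act \<pi> (g ** h) v = act \<pi> g (act \<pi> h v)"
  using P.act_mult by simp

lemma K_V: "y \<in> K \<Longrightarrow> y \<in> vspace \<pi>"
  by (simp add: K_def)

lemma K_U3: "y \<in> K \<Longrightarrow> u \<in> RS U3 \<Longrightarrow> act \<pi> u y = y"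
  by (simp add: K_def)

lemma K_e: "y \<in> K \<Longrightarrow> P.e y = 0"
  unfolding K_def using Levi_members(1) RS_one P.act_one by (force dest!: bspec[of _ _ "mat 1"])

lemma K_add: "x \<in> K \<Longrightarrow> y \<in> K \<Longrightarrow> x + y \<in> K"
  by (auto simp: K_def P.act_add RS_G2 Levi_G2 G2_mult P.e_add)

lemma K_scale: "x \<in> K \<Longrightarrow> smult \<pi> c x \<in> K"
  by (auto simp: K_def P.act_scale RS_G2 Levi_G2 G2_mult P.e_scale)

lemma K_sum: "finite A \<Longrightarrow> (\<And>i. i \<in> A \<Longrightarrow> f i \<in> K) \<Longrightarrow> sum f A \<in> K"
proof (induction A rule: finite_induct)
  case empty
  then show ?case by (simp add: K_def RS_G2 Levi_G2 G2_mult)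
qed (simp add: K_add)

text \<open>An element of \<open>Levi\<close> acts on \<open>L T v\<close> through \<tau>, and the
  remaining unipotent factor only contributes a scalar to the Whittaker projection, which vanishes
  by assumption.\<close>

lemma L_in_K:
  assumes T: "T \<in> Hom" and zero: "\<And>v. v \<in> vspace \<tau> \<Longrightarrow> P.e (L T v) = 0" and v: "v \<in> vspace \<tau>"
  shows "L T v \<in> K"
  unfolding K_def
proof (intro CollectI conjI ballI)
  have one: "act \<tau> (mat 1) v = v" using T.act_one[OF v] by simp
  fix u :: "'k ^ 7 ^ 7" assume u: "u \<in> RS U3"
  have "act \<pi> u (L T v) = L T (act \<tau> (corner u) v)"
    by (rule L_act[OF T RS_G2[OF u] U3_P_tilde(1)[OF u] v, symmetric])
  then show "act \<pi> u (L T v) = L T v"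
    unfolding U3_P_tilde(2)[OF u] one .
next
  have LV: "L T v \<in> vspace \<pi>" by (rule L_V[OF T v])
  then show "L T v \<in> vspace \<pi>" .
  fix r p :: "'k ^ 7 ^ 7" assume r: "r \<in> RS (- {Beta})" and p: "p \<in> Levi"
  let ?v = "act \<tau> (corner p) v"
  have pG: "p \<in> carrier G2" "p \<in> P_tilde" using p by (auto simp: Levi_def)
  have v': "?v \<in> vspace \<tau>" using T.act_closed[OF corner_P_GL[OF pG(2)] v] .
  have "act \<pi> (r ** p) (L T v) = act \<pi> r (L T ?v)"
    unfolding act_mult[OF RS_G2[OF r] pG(1) LV] L_act[OF T pG v] ..
  then have "P.e (act \<pi> (r ** p) (L T v)) = smult \<pi> (psi_U \<psi> r) (P.e (L T ?v))"
    using P.e_act[OF RS_mono[OF r subset_UNIV] L_V[OF T v']] by (simp only:)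
  then show "P.e (act \<pi> (r ** p) (L T v)) = 0"
    unfolding zero[OF v'] by simp
qed

lemma K_act_Levi:
  assumes y: "y \<in> K" and l: "l \<in> Levi" and conj: "\<And>u. u \<in> RS U3 \<Longrightarrow> \<exists>u'\<in>RS U3. u ** l = l ** u'"
  shows "act \<pi> l y \<in> K"
  unfolding K_def
proof (intro CollectI conjI ballI)
  show "act \<pi> l y \<in> vspace \<pi>" using y l by (simp add: K_V Levi_G2)
  fix u :: "'k ^ 7 ^ 7" assume u: "u \<in> RS U3"
  obtain u' where u': "u' \<in> RS U3" "u ** l = l ** u'" using conj[OF u] by blast
  have "act \<pi> u (act \<pi> l y) = act \<pi> l (act \<pi> u' y)"
    using act_mult[OF RS_G2[OF u] Levi_G2[OF l] K_V[OF y]] act_mult[OF Levi_G2[OF l] RS_G2[OF u'(1)] K_V[OF y]] u'(2) by simp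
  then show "act \<pi> u (act \<pi> l y) = act \<pi> l y" using K_U3[OF y u'(1)] by simp
next
  fix r p :: "'k ^ 7 ^ 7" assume r: "r \<in> RS (- {Beta})" and p: "p \<in> Levi"
  have "act \<pi> (r ** p) (act \<pi> l y) = act \<pi> (r ** (p ** l)) y"
    using act_mult[OF G2_mult[OF RS_G2[OF r] Levi_G2[OF p]] Levi_G2[OF l] K_V[OF y]] by (simp add: matrix_mul_assoc)
  then show "P.e (act \<pi> (r ** p) (act \<pi> l y)) = 0"
    using y r Levi_mult[OF p l] by (simp add: K_def)
qed

lemma K_act_RS:
  assumes y: "y \<in> K" and x: "x \<in> RS (- {Beta})" and conj: "\<And>u. u \<in> RS U3 \<Longrightarrow> \<exists>u'\<in>RS U3. u ** x = x ** u'"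
  shows "act \<pi> x y \<in> K"
  unfolding K_def
proof (intro CollectI conjI ballI)
  have xG: "x \<in> carrier G2" by (rule RS_G2[OF x])
  show "act \<pi> x y \<in> vspace \<pi>" using y xG by (simp add: K_V)
  fix u :: "'k ^ 7 ^ 7" assume u: "u \<in> RS U3"
  obtain u' where u': "u' \<in> RS U3" "u ** x = x ** u'" using conj[OF u] by blast
  have "act \<pi> u (act \<pi> x y) = act \<pi> x (act \<pi> u' y)"
    using act_mult[OF RS_G2[OF u] xG K_V[OF y]] act_mult[OF xG RS_G2[OF u'(1)] K_V[OF y]] u'(2) by simp
  then show "act \<pi> u (act \<pi> x y) = act \<pi> x y" using K_U3[OF y u'(1)] by simp
next
  fix r p :: "'k ^ 7 ^ 7" assume r: "r \<in> RS (- {Beta})" and p: "p \<in> Levi"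
  obtain x' where x': "x' \<in> RS (- {Beta})" "p ** x = x' ** p"
    using p x conj_intoD[of p "- {Beta}" "- {Beta}" x] by (auto simp: Levi_def)
  have "r ** p ** x = r ** x' ** p" using x'(2) by (metis matrix_mul_assoc)
  then have "act \<pi> (r ** p) (act \<pi> x y) = act \<pi> (r ** x' ** p) y"
    using act_mult[OF G2_mult[OF RS_G2[OF r] Levi_G2[OF p]] RS_G2[OF x] K_V[OF y]] by simp
  then show "P.e (act \<pi> (r ** p) (act \<pi> x y)) = 0"
    using y p RS_mult[OF r x'(1)] by (simp add: K_def)
qed

lemma K_stable:
  assumes "y \<in> K"
  shows "act \<pi> (x_pos Alpha r) y \<in> K" "act \<pi> (x_pos Alpha_Beta r) y \<in> K" "act \<pi> (x_pos Beta r) y \<in> K"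
    "act \<pi> n_beta y \<in> K" "a \<noteq> 0 \<Longrightarrow> b \<noteq> 0 \<Longrightarrow> act \<pi> (torus a b) y \<in> K"
proof -
  show "act \<pi> (x_pos Alpha r) y \<in> K" "act \<pi> (x_pos Alpha_Beta r) y \<in> K"
    by (rule K_act_RS[OF assms x_pos_RS]; simp add: right_conj_U3)+
  show "act \<pi> (x_pos Beta r) y \<in> K" "act \<pi> n_beta y \<in> K"
    by (rule K_act_Levi[OF assms Levi_members(2) right_conj_U3(2)] K_act_Levi[OF assms Levi_members(3) right_conj_U3(4)]; assumption)+
  show "act \<pi> (torus a b) y \<in> K" if "a \<noteq> 0" "b \<noteq> 0"
    by (rule K_act_Levi[OF assms Levi_members(4)[OF that] right_conj_U3(5)[OF _ that]])
qed

section \<open>Fourier analysis along root subgroups on \<open>K\<close>\<close>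

definition eig :: "pos_root \<Rightarrow> 'k \<Rightarrow> 'w \<Rightarrow> bool" where
  "eig \<gamma> c y \<longleftrightarrow> (\<forall>s. act \<pi> (x_pos \<gamma> s) y = smult \<pi> (\<psi> (c * s)) y)"

definition proj :: "pos_root \<Rightarrow> 'k \<Rightarrow> 'w \<Rightarrow> 'w" where
  "proj \<gamma> c y = (\<Sum>r\<in>UNIV. smult \<pi> (\<psi> (- (c * r))) (act \<pi> (x_pos \<gamma> r) y))"

lemma exists_proj:
  assumes "y \<in> vspace \<pi>" "y \<noteq> 0"
  shows "\<exists>c. proj \<gamma> c y \<noteq> 0"
  unfolding proj_def
  using assms P.act_one[OF assms(1)] by (intro fourier_nonzero[OF psi P.vs.vector_space_axioms]) (simp add: x_pos_zero)

lemma eig_proj: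
  assumes "y \<in> vspace \<pi>"
  shows "eig \<gamma> c (proj \<gamma> c y)"
  unfolding eig_def
proof
  fix s
  have "act \<pi> (x_pos \<gamma> s) (proj \<gamma> c y) = (\<Sum>r\<in>UNIV. smult \<pi> (\<psi> (- (c * r))) (act \<pi> (x_pos \<gamma> (s + r)) y))"
    unfolding proj_def using assms act_mult[OF x_pos_G2 x_pos_G2 assms, of \<gamma> s \<gamma>, unfolded x_pos_add]
    by (simp add: P.act_sum P.act_scale x_pos_G2)
  also have "\<dots> = (\<Sum>r\<in>UNIV. smult \<pi> (\<psi> (- (c * (r - s)))) (act \<pi> (x_pos \<gamma> r) y))"
    by (rule sum.reindex_bij_witness[of _ "\<lambda>r. r - s" "\<lambda>r. s + r"]) auto
  also have "\<dots> = smult \<pi> (\<psi> (c * s)) (proj \<gamma> c y)"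
    unfolding proj_def P.vs.scale_sum_right
  proof (rule sum.cong[OF refl])
    fix r
    have "- (c * (r - s)) = c * s + - (c * r)" by (simp add: algebra_simps)
    then show "smult \<pi> (\<psi> (- (c * (r - s)))) (act \<pi> (x_pos \<gamma> r) y) =
      smult \<pi> (\<psi> (c * s)) (smult \<pi> (\<psi> (- (c * r))) (act \<pi> (x_pos \<gamma> r) y))"
      by (simp only: psi_simps(2)[OF psi] P.vs.scale_scale)
  qed
  finally show "act \<pi> (x_pos \<gamma> s) (proj \<gamma> c y) = smult \<pi> (\<psi> (c * s)) (proj \<gamma> c y)" .
qed

lemma eig_sum:
  assumes "\<And>r. f r \<in> vspace \<pi>" "\<And>r. eig \<gamma> c (f r)"
  shows "eig \<gamma> c (\<Sum>r\<in>(UNIV :: 'k set). smult \<pi> (d r) (f r))"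
  using assms by (simp add: eig_def P.act_sum P.act_scale x_pos_G2 P.vs.scale_sum_right mult.commute)

text \<open>Eigenvalues are transported by moving \<open>x_pos \<gamma> s\<close> through g; only
  the action of \<open>z s\<close> on y has to be known, so factors of z acting trivially may be
  ignored.\<close>

lemma eig_transfer:
  assumes y: "y \<in> vspace \<pi>" and g: "g \<in> carrier G2"
    and z: "\<And>s. z s \<in> carrier G2" "\<And>s. x_pos \<gamma> s ** g = g ** z s" "\<And>s. act \<pi> (z s) y = smult \<pi> (\<psi> (c * s)) y"
  shows "eig \<gamma> c (act \<pi> g y)"
  unfolding eig_def
proof
  fix s
  have "act \<pi> (x_pos \<gamma> s) (act \<pi> g y) = act \<pi> g (act \<pi> (z s) y)"
    using act_mult[OF x_pos_G2 g y, of \<gamma> s] act_mult[OF g z(1) y, of s] by (simp add: z(2))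
  then show "act \<pi> (x_pos \<gamma> s) (act \<pi> g y) = smult \<pi> (\<psi> (c * s)) (act \<pi> g y)"
    using y g by (simp add: z(3) P.act_scale)
qed

lemma K_act_U3: "y \<in> K \<Longrightarrow> u \<in> RS U3 \<Longrightarrow> g \<in> carrier G2 \<Longrightarrow> act \<pi> (g ** u) y = act \<pi> g y"
  by (simp add: act_mult RS_G2 K_V K_U3)

text \<open>The commutators of \<alpha> and \<alpha>+\<beta> lie in \<open>RS U3\<close>, so on
  \<open>K\<close> these root subgroups commute and can be diagonalised together.\<close>

lemma eig_Alpha_Alpha_Beta:
  assumes y: "y \<in> K" and e: "eig Alpha c y"
  shows "eig Alpha c (act \<pi> (x_pos Alpha_Beta r) y)"
proof -
  define u where "u s = x_pos TwoAlpha_Beta (- 2 * s * r) ** x_pos ThreeAlpha_Beta (- 3 * s\<^sup>2 * r) ** x_pos ThreeAlpha_TwoBeta (3 * s * r\<^sup>2)" for s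
  have u: "u s \<in> RS U3" for s unfolding u_def by (intro RS_mult x_pos_RS) auto
  show ?thesis
  proof (rule eig_transfer[where z = "\<lambda>s. u s ** x_pos Alpha s"])
    fix s
    show "x_pos Alpha s ** x_pos Alpha_Beta r = x_pos Alpha_Beta r ** (u s ** x_pos Alpha s)"
      unfolding conj_Alpha u_def by (simp add: matrix_mul_assoc)
    have "act \<pi> (u s ** x_pos Alpha s) y = act \<pi> (u s) (act \<pi> (x_pos Alpha s) y)"
      by (rule act_mult[OF RS_G2[OF u] x_pos_G2 K_V[OF y]])
    also have "\<dots> = act \<pi> (x_pos Alpha s) y" by (rule K_U3[OF K_stable(1)[OF y] u])
    also have "\<dots> = smult \<pi> (\<psi> (c * s)) y" using e by (simp add: eig_def)
    finally show "act \<pi> (u s ** x_pos Alpha s) y = smult \<pi> (\<psi> (c * s)) y" .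
  qed (use y in \<open>auto intro!: G2_mult x_pos_G2 RS_G2[OF u] K_V\<close>)
qed

lemma eig_Alpha_Beta_Beta:
  assumes "y \<in> K" "eig Alpha_Beta d y"
  shows "eig Alpha_Beta d (act \<pi> (x_pos Beta r) y)"
proof (rule eig_transfer[where z = "\<lambda>s. x_pos Alpha_Beta s"])
  fix s
  show "x_pos Alpha_Beta s ** x_pos Beta r = x_pos Beta r ** x_pos Alpha_Beta s"
    by (simp add: conj_Beta(2))
qed (use assms in \<open>auto intro!: x_pos_G2 K_V simp: eig_def\<close>)

text \<open>Modulo \<open>U3\<close>, the commutator of \<beta> and \<alpha> is an \<alpha>+\<beta>
  element; a nontrivial character on \<alpha>+\<beta> thus lets \<beta> shift the character on
  \<alpha>.\<close>

lemma eig_Alpha_Beta_shift: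
  assumes y: "y \<in> K" and e: "eig Alpha c y" "eig Alpha_Beta d y"
  shows "eig Alpha (c - d * x) (act \<pi> (x_pos Beta x) y)"
proof -
  define u where "u s = x_pos TwoAlpha_Beta (- x * s\<^sup>2) ** x_pos ThreeAlpha_Beta (x * s ^ 3) ** x_pos ThreeAlpha_TwoBeta (- 2 * x\<^sup>2 * s ^ 3)" for s
  have u: "u s \<in> RS U3" for s unfolding u_def by (intro RS_mult x_pos_RS) auto
  show ?thesis
  proof (rule eig_transfer[where z = "\<lambda>s. x_pos Alpha s ** x_pos Alpha_Beta (- x * s) ** u s"])
    fix s
    have "x_pos Beta (- x) ** x_pos Alpha s = x_pos Alpha s ** x_pos Alpha_Beta (- x * s) ** u s ** x_pos Beta (- x)"
      unfolding conj_Beta(1) u_def by (simp add: matrix_mul_assoc)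
    then have "x_pos Beta x ** (x_pos Beta (- x) ** x_pos Alpha s) ** x_pos Beta x =
      x_pos Beta x ** (x_pos Alpha s ** x_pos Alpha_Beta (- x * s) ** u s ** x_pos Beta (- x)) ** x_pos Beta x"
      by (rule arg_cong[of _ _ "\<lambda>m. x_pos Beta x ** m ** x_pos Beta x"])
    then have "(x_pos Beta x ** x_pos Beta (- x)) ** (x_pos Alpha s ** x_pos Beta x) =
      x_pos Beta x ** (x_pos Alpha s ** x_pos Alpha_Beta (- x * s) ** u s) ** (x_pos Beta (- x) ** x_pos Beta x)"
      by (simp only: matrix_mul_assoc)
    then show "x_pos Alpha s ** x_pos Beta x = x_pos Beta x ** (x_pos Alpha s ** x_pos Alpha_Beta (- x * s) ** u s)"
      by (simp add: x_pos_add x_pos_zero)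
    have "c * s + d * (- x * s) = (c - d * x) * s" by (simp add: algebra_simps)
    then have psi_eq: "\<psi> (d * (- x * s)) * \<psi> (c * s) = \<psi> ((c - d * x) * s)"
      by (metis psi_simps(2)[OF psi] mult.commute)
    have "act \<pi> (x_pos Alpha s ** x_pos Alpha_Beta (- x * s) ** u s) y = act \<pi> (x_pos Alpha s ** x_pos Alpha_Beta (- x * s)) y"
      by (rule K_act_U3[OF y u]) (intro G2_mult x_pos_G2)
    also have "\<dots> = act \<pi> (x_pos Alpha s) (act \<pi> (x_pos Alpha_Beta (- x * s)) y)"
      by (rule act_mult[OF x_pos_G2 x_pos_G2 K_V[OF y]])
    also have "\<dots> = smult \<pi> (\<psi> (d * (- x * s)) * \<psi> (c * s)) y"
      using e y by (simp only: eig_def P.act_scale[OF x_pos_G2 K_V] P.vs.scale_scale)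
    finally show "act \<pi> (x_pos Alpha s ** x_pos Alpha_Beta (- x * s) ** u s) y = smult \<pi> (\<psi> ((c - d * x) * s)) y"
      unfolding psi_eq .
  qed (use y in \<open>auto intro!: G2_mult x_pos_G2 RS_G2[OF u] K_V\<close>)
qed

lemma eig_n_beta:
  assumes y: "y \<in> K" and e: "eig Alpha c y" "eig Alpha_Beta d y"
  shows "eig Alpha (- d) (act \<pi> n_beta y)" "eig Alpha_Beta c (act \<pi> n_beta y)"
proof -
  show "eig Alpha (- d) (act \<pi> n_beta y)"
  proof (rule eig_transfer[where z = "\<lambda>s. x_pos Alpha_Beta (- s)"])
    fix s :: 'k
    show "x_pos Alpha s ** n_beta = n_beta ** x_pos Alpha_Beta (- s)" by (simp add: n_beta_x_pos)
    show "act \<pi> (x_pos Alpha_Beta (- s)) y = smult \<pi> (\<psi> (- d * s)) y" using e by (simp add: eig_def)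
  qed (use y in \<open>auto intro!: x_pos_G2 n_G2 K_V\<close>)
  show "eig Alpha_Beta c (act \<pi> n_beta y)"
  proof (rule eig_transfer[where z = "\<lambda>s. x_pos Alpha s"])
    fix s
    show "x_pos Alpha_Beta s ** n_beta = n_beta ** x_pos Alpha s" by (simp add: n_beta_x_pos)
  qed (use y e in \<open>auto intro!: x_pos_G2 n_G2 K_V simp: eig_def\<close>)
qed

lemma eig_torus:
  assumes y: "y \<in> K" and ab: "a \<noteq> 0" "b \<noteq> 0"
  shows "eig Alpha c y \<Longrightarrow> eig Alpha (c / a) (act \<pi> (torus a b) y)"
    "eig Beta c y \<Longrightarrow> eig Beta (c / b) (act \<pi> (torus a b) y)"
    "eig Alpha_Beta 0 y \<Longrightarrow> eig Alpha_Beta 0 (act \<pi> (torus a b) y)"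
proof -
  show "eig Alpha (c / a) (act \<pi> (torus a b) y)" if "eig Alpha c y"
    by (rule eig_transfer[where z = "\<lambda>s. x_pos Alpha (s / a)"])
      (use that ab y torus_x_pos[OF ab] in \<open>auto intro!: x_pos_G2 torus_G2 K_V simp: eig_def\<close>)
  show "eig Beta (c / b) (act \<pi> (torus a b) y)" if "eig Beta c y"
    by (rule eig_transfer[where z = "\<lambda>s. x_pos Beta (s / b)"])
      (use that ab y torus_x_pos[OF ab] in \<open>auto intro!: x_pos_G2 torus_G2 K_V simp: eig_def\<close>)
  show "eig Alpha_Beta 0 (act \<pi> (torus a b) y)" if "eig Alpha_Beta 0 y"
    by (rule eig_transfer[where z = "\<lambda>s. x_pos Alpha_Beta (s / (a * b))"])
      (use that ab y torus_x_pos[OF ab] in \<open>auto intro!: x_pos_G2 torus_G2 K_V simp: eig_def\<close>)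
qed

text \<open>Together with \<open>U3\<close>, triviality along \<alpha>+\<beta> and one simple root
  gives invariance under a whole unipotent radical, and cuspidality applies.\<close>

lemma K_trivial_eig:
  assumes y: "y \<in> K" and "eig Alpha_Beta 0 y" and e: "eig \<delta> 0 y" and \<delta>: "{\<delta>, \<delta>'} = {Alpha, Beta}"
  shows "y = 0"
proof (rule cuspidal_zero[of _ \<delta>'])
  show "act \<pi> n y = y" if "n \<in> RS (- {\<delta>'})" for n
  proof (rule fixed_by_generators[OF K_V[OF y] _ that])
    fix \<gamma> r assume "\<gamma> \<in> - {\<delta>'}"
    then have "\<gamma> = \<delta> \<or> \<gamma> = Alpha_Beta \<or> \<gamma> \<in> U3" using \<delta> by (cases \<gamma>) auto
    then show "act \<pi> (x_pos \<gamma> r) y = y"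
      using assms K_U3[OF y x_pos_RS, of \<gamma> r] by (auto simp: eig_def psi_simps[OF psi])
  qed
qed (use y \<delta> in \<open>auto simp: K_V\<close>)

lemma K_zero:
  assumes "y \<in> K"
  shows "y = 0"
proof (rule ccontr)
  assume "y \<noteq> 0"
  obtain c where c: "proj Alpha c y \<noteq> 0"
    using exists_proj[OF K_V[OF assms] \<open>y \<noteq> 0\<close>] by blast
  define y1 where "y1 = proj Alpha c y"
  have y1: "y1 \<in> K" "y1 \<noteq> 0" "eig Alpha c y1"
    using c assms by (auto simp: y1_def eig_proj K_V proj_def intro!: K_sum K_scale K_stable eig_proj[unfolded proj_def])
  obtain d where d: "proj Alpha_Beta d y1 \<noteq> 0"
    using exists_proj[OF K_V[OF y1(1)] y1(2)] by blast
  define y2 where "y2 = proj Alpha_Beta d y1"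
  have y2: "y2 \<in> K" "y2 \<noteq> 0" "eig Alpha_Beta d y2"
    using d y1 by (auto simp: y2_def K_V proj_def intro!: K_sum K_scale K_stable eig_proj[unfolded proj_def])
  have y2': "eig Alpha c y2"
    unfolding y2_def proj_def using y1
    by (intro eig_sum eig_Alpha_Alpha_Beta) (auto simp: K_V x_pos_G2)
  obtain y3 c' where y3: "y3 \<in> K" "y3 \<noteq> 0" "eig Alpha c' y3" "eig Alpha_Beta 0 y3"
  proof (cases "d = 0")
    case True
    then show ?thesis using that y2 y2' by blast
  next
    case False
    \<comment> \<open>The parameter \<open>c / d\<close> shifts the character on \<alpha> to
      zero.\<close>
    let ?x = "act \<pi> (x_pos Beta (c / d)) y2"
    have x: "?x \<in> K" "?x \<noteq> 0" "eig Alpha 0 ?x" "eig Alpha_Beta d ?x"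
      using y2 y2' False eig_Alpha_Beta_shift[OF y2(1) y2' y2(3), of "c / d"]
      by (auto simp: K_stable P.act_eq_0 x_pos_G2 K_V eig_Alpha_Beta_Beta)
    \<comment> \<open>The reflection in \<beta> exchanges \<alpha> and \<alpha>+\<beta>, so the zero
      moves to \<alpha>+\<beta> and \<open>- d\<close> appears on \<alpha>.\<close>
    show ?thesis
      using that[of "act \<pi> n_beta ?x" "- d"] x eig_n_beta[OF x(1,3,4)]
      by (auto simp: K_stable P.act_eq_0 n_G2 K_V)
  qed
  have c': "c' \<noteq> 0" using K_trivial_eig[OF y3(1,4), of Alpha Beta] y3 by auto
  \<comment> \<open>Torus elements rescale the characters on the simple roots; this one makes the
    character on \<alpha> equal to \<psi>.\<close>
  define y4 where "y4 = act \<pi> (torus c' 1) y3"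
  have y4: "y4 \<in> K" "y4 \<noteq> 0" "eig Alpha 1 y4" "eig Alpha_Beta 0 y4"
    using y3 c' eig_torus(1)[OF y3(1) c' one_neq_zero y3(3)] eig_torus(3)[OF y3(1) c' one_neq_zero y3(4)]
    by (auto simp: y4_def K_stable P.act_eq_0 torus_G2 K_V)
  obtain b where b: "proj Beta b y4 \<noteq> 0"
    using exists_proj[OF K_V[OF y4(1)] y4(2)] by blast
  define y5 where "y5 = proj Beta b y4"
  have y5: "y5 \<in> K" "y5 \<noteq> 0" "eig Beta b y5"
    using b y4 by (auto simp: y5_def K_V proj_def intro!: K_sum K_scale K_stable eig_proj[unfolded proj_def])
  \<comment> \<open>Since the character on \<alpha>+\<beta> is trivial, translation by \<beta> no
    longer shifts the one on \<alpha>, and expanding along \<beta> preserves it.\<close>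
  have y5': "eig Alpha 1 y5" "eig Alpha_Beta 0 y5"
    unfolding y5_def proj_def using y4 eig_Alpha_Beta_shift[OF y4(1,3,4)]
    by (auto intro!: eig_sum eig_Alpha_Beta_Beta simp: K_V x_pos_G2)
  have b0: "b \<noteq> 0" using K_trivial_eig[OF y5(1) y5'(2), of Beta Alpha] y5 by auto
  define y6 where "y6 = act \<pi> (torus 1 b) y5"
  have y6: "y6 \<in> K" "y6 \<noteq> 0" "eig Alpha 1 y6" "eig Beta 1 y6" "eig Alpha_Beta 0 y6"
    using y5 y5' b0 eig_torus(1)[OF y5(1) one_neq_zero b0 y5'(1)] eig_torus(2)[OF y5(1) one_neq_zero b0 y5(3)]
      eig_torus(3)[OF y5(1) one_neq_zero b0 y5'(2)]
    by (auto simp: y6_def K_stable P.act_eq_0 torus_G2 K_V)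
  have "act \<pi> u y6 = smult \<pi> (psi_U \<psi> u) y6" if "u \<in> carrier U_G2" for u
    using that
  proof (induction rule: RS_induct)
    case one
    show ?case using P.act_one[OF K_V[OF y6(1)]] by (simp add: psi_U_one[OF psi])
  next
    case (x_pos \<gamma> r)
    consider "\<gamma> = Alpha" | "\<gamma> = Beta" | "\<gamma> = Alpha_Beta" | "\<gamma> \<in> U3" by (cases \<gamma>) auto
    then show ?case
      using y6 K_U3[OF y6(1) x_pos_RS, of \<gamma> r]
      by cases (auto simp: eig_def psi_U_x_pos[OF psi] psi_simps[OF psi])
  next
    case (mult u v)
    then show ?case
      by (simp add: act_mult RS_G2 K_V[OF y6(1)] P.act_scale psi_U_mult[OF psi] mult.commute)
  qed
  \<comment> \<open>A Whittaker vector is multiplied by the order of \<open>U_G2\<close> under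
    \<open>P.e\<close>, whereas \<open>P.e\<close> kills \<open>K\<close>.\<close>
  then have "y6 \<in> P.W" using y6 by (simp add: P.W_def K_V)
  then show False using P.e_W[of y6] K_e[OF y6(1)] y6(2) P.card_U by simp
qed

end

section \<open>The intertwining space\<close>

context generic_pair
begin

text \<open>Vanishing at w spreads to all of \<tau>, which puts the values of \<open>L T\<close>
  into the zero space \<open>K\<close>. The map T is therefore determined by one vector on the
  Whittaker line of \<pi>.\<close>

lemma Hom_determined:
  assumes T: "T \<in> Hom" and w: "w \<in> T.W" "w \<noteq> 0" and zero: "P.e (L T w) = 0"
  shows "T = 0"
  using L_eq_0[OF T] K_zero[OF L_in_K[OF T]] e_L_zero[OF T w zero] by blast

text \<open>Averaging turns the Whittaker functional into a Whittaker vector: l of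
  \<open>P.e v\<close> is the order of \<open>U_G2\<close> times \<open>l v\<close>.\<close>

lemma exists_W_\<pi>: "\<exists>w\<in>P.W. w \<noteq> 0"
proof -
  have "0 \<in> hom_space U_G2 \<pi> (char_rep (psi_U \<psi>))"
    by (auto simp: hom_space_def char_rep_def linear_on_def)
  then obtain l where l: "l \<in> hom_space U_G2 \<pi> (char_rep (psi_U \<psi>))" "l \<noteq> 0"
    using gen_\<pi> unfolding generic_G2_def by blast
  obtain v where "l v \<noteq> 0" using l(2) by (auto simp: fun_eq_iff)
  then have v: "v \<in> vspace \<pi>" "l v \<noteq> 0" using l(1) by (auto simp: hom_space_def)
  have add: "l (x + y) = l x + l y" and scale: "l (smult \<pi> c x) = c * l x"
    and act: "u \<in> carrier U_G2 \<Longrightarrow> l (act \<pi> u x) = psi_U \<psi> u * l x"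
    if "x \<in> vspace \<pi>" "y \<in> vspace \<pi>" for x y c u
    using l(1) that by (auto simp: hom_space_def linear_on_def char_rep_def)
  have "l 0 = 0" using scale[of 0 0 0] by simp
  then have sum: "l (sum f A) = (\<Sum>i\<in>A. l (f i))" if "\<And>i. i \<in> A \<Longrightarrow> f i \<in> vspace \<pi>" for f and A :: "('k ^ 7 ^ 7) set"
    using that by (induction A rule: infinite_finite_induct) (auto simp: add)
  have "l (P.e v) = (\<Sum>u\<in>carrier U_G2. l (smult \<pi> (1 / psi_U \<psi> u) (act \<pi> u v)))"
    unfolding P.e_def using v by (intro sum) (auto simp: RS_G2)
  also have "\<dots> = (\<Sum>u\<in>carrier (U_G2 :: ('k ^ 7 ^ 7) monoid). l v)"
    using v by (intro sum.cong refl) (simp add: scale act RS_G2 psi_U_nz[OF psi])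
  also have "\<dots> \<noteq> 0" using v P.card_U by simp
  finally have "P.e v \<noteq> 0" using \<open>l 0 = 0\<close> by auto
  then show ?thesis using P.e_in_W[OF v(1)] by blast
qed

lemma exists_Hom:
  obtains T v where "T \<in> Hom" "v \<in> T.W" "P.e (L T v) \<noteq> 0"
proof -
  obtain l where l: "\<And>v w. v \<in> vspace \<tau> \<Longrightarrow> w \<in> vspace \<tau> \<Longrightarrow> l (v + w) = l v + l w"
    "\<And>c v. v \<in> vspace \<tau> \<Longrightarrow> l (smult \<tau> c v) = c * l v"
    "\<And>x v. v \<in> vspace \<tau> \<Longrightarrow> l (act \<tau> (n2 x) v) = \<psi> x * l v" and "\<exists>v\<in>vspace \<tau>. l v \<noteq> 0"
    by (rule GL2_whittaker_functional[OF psi T.rep gen_\<tau>]) (rule that; assumption)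
  then obtain v0 where v0: "v0 \<in> vspace \<tau>" "l v0 \<noteq> 0" by blast
  have l0: "l 0 = 0" using l(2)[of 0 0] by simp
  have lsum: "l (sum f A) = (\<Sum>i\<in>A. l (f i))" if "\<And>i. i \<in> A \<Longrightarrow> f i \<in> vspace \<tau>" for f and A :: "('k ^ 2 ^ 2) set"
    using that by (induction A rule: infinite_finite_induct) (auto simp: l l0)
  define v where "v = T.e v0"
  have v: "v \<in> T.W" "v \<in> vspace \<tau>" using v0 by (auto simp: v_def T.e_in_W)
  have "l v = (\<Sum>n\<in>range n2. l (smult \<tau> (1 / \<psi> (n $ 1 $ 2)) (act \<tau> n v0)))"
    unfolding v_def T.e_def using v0 n2_GL by (intro lsum) auto
  also have "\<dots> = (\<Sum>n\<in>range (n2 :: 'k \<Rightarrow> _). l v0)"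
    using v0 n2_GL by (intro sum.cong refl) (auto simp: l psi_nz[OF psi])
  also have "\<dots> \<noteq> 0" using v0 T.card_U by simp
  finally have lv: "l v \<noteq> 0" .
  obtain w where w: "w \<in> P.W" "w \<noteq> 0" using exists_W_\<pi> by blast
  have wV: "w \<in> vspace \<pi>" by (rule P.W_V[OF w(1)])
  \<comment> \<open>Pairing the values of f with l and w; substituting g by \<open>g ** h\<close> in
    the sum shows that T intertwines.\<close>
  define T where "T f = (if f \<in> I then \<Sum>g\<in>carrier G2. smult \<pi> (l (f g)) (act \<pi> (ginv g) w) else 0)" for f
  have fV: "f g \<in> vspace \<tau>" if "f \<in> I" "g \<in> carrier G2" for f g
    using that G2_SO7 by (auto simp: I_iff)
  have gw: "act \<pi> (ginv g) w \<in> vspace \<pi>" if "g \<in> carrier G2" for g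
    using P.act_closed[OF G2_inv[OF that] wV] .
  have T: "T \<in> Hom"
    unfolding hom_space_def
  proof (intro CollectI conjI ballI allI impI)
    show "T ` I \<subseteq> vspace \<pi>" using gw by (auto simp: T_def)
    show "linear_on I (smult (I_rep \<tau>)) (smult \<pi>) T"
      using fV by (auto simp: linear_on_def T_def add_I_closed smult_I_closed l smult_I P.vs.scale_left_distrib
          sum.distrib P.vs.scale_sum_right)
    fix h :: "'k ^ 7 ^ 7" and f assume h: "h \<in> carrier G2" and f: "f \<in> I"
    have hf: "act (I_rep \<tau>) h f \<in> I" by (rule act_I_closed[OF f G2_SO7[OF h]])
    have "act \<pi> h (T f) = (\<Sum>g\<in>carrier G2. smult \<pi> (l (f g)) (act \<pi> h (act \<pi> (ginv g) w)))"
      using f h gw by (simp add: T_def P.act_sum P.act_scale)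
    also have "\<dots> = (\<Sum>g\<in>carrier G2. smult \<pi> (l (f g)) (act \<pi> (h ** ginv g) w))"
      by (rule sum.cong[OF refl]) (use act_mult[OF h G2_inv wV] in simp)
    also have "\<dots> = (\<Sum>g\<in>carrier G2. smult \<pi> (l (f (g \<otimes>\<^bsub>G2\<^esub> h))) (act \<pi> (h ** ginv (g \<otimes>\<^bsub>G2\<^esub> h)) w))"
      by (rule P.sum_right_mult[OF h, symmetric])
    also have "\<dots> = (\<Sum>g\<in>carrier G2. smult \<pi> (l (act (I_rep \<tau>) h f g)) (act \<pi> (ginv g) w))"
      by (rule sum.cong[OF refl]) (use h in \<open>simp add: GL_inv_mult G2_GL G2_SO7 act_I\<close>)
    also have "\<dots> = T (act (I_rep \<tau>) h f)" using hf by (simp add: T_def)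
    finally show "T (act (I_rep \<tau>) h f) = act \<pi> h (T f)" ..
  qed (simp add: T_def)
  \<comment> \<open>Outside \<open>P_tilde\<close> the function \<open>delta (mat 1) v\<close>
    vanishes, and for irrelevant g so does the projection of the translate of w. Only this set
    contributes to the Whittaker projection of \<open>L T v\<close>.\<close>
  let ?A = "{g \<in> carrier G2. g \<in> P_tilde \<and> \<not> irr \<psi> g}"
  have irr_inv: "irr \<psi> (ginv g)" if g: "g \<in> carrier G2" and "irr \<psi> g" for g
  proof -
    obtain x y where xy: "x \<in> carrier U_G2" "y \<in> carrier U_G2" "g ** x = y ** g" "psi_U \<psi> x \<noteq> psi_U \<psi> y"
      using \<open>irr \<psi> g\<close> by (auto simp: irr_def[OF psi])
    have "ginv g ** y = ginv g ** (y ** g) ** ginv g"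
      using g by (simp add: G2_GL flip: matrix_mul_assoc)
    also have "\<dots> = x ** ginv g"
      unfolding xy(3)[symmetric] using g by (simp add: G2_GL matrix_mul_assoc)
    finally show ?thesis unfolding irr_def[OF psi] using xy by metis
  qed
  have irr_iff: "P.irrelevant g \<longleftrightarrow> irr \<psi> g" for g
    by (simp add: P.irrelevant_def irr_def[OF psi])
  have summand: "P.e (smult \<pi> (l (delta (mat 1) v g)) (act \<pi> (ginv g) w)) =
      (if g \<in> ?A then smult \<pi> (of_nat (card (carrier (U_G2 :: ('k ^ 7 ^ 7) monoid))) * l v) w else 0)"
    if g: "g \<in> carrier G2" for g
  proof -
    have one: "ginv (mat 1 :: 'k ^ 7 ^ 7) = mat 1" using GL.inv_one[where 'k='k and 'n=7] by simp
    have d: "delta (mat 1) v g = (if g \<in> P_tilde then act \<tau> (corner g) v else 0)"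
      using G2_SO7[OF g] by (simp add: delta_def one)
    consider "g \<notin> P_tilde" | "g \<in> P_tilde" "irr \<psi> g" | "g \<in> ?A" using g by blast
    then show ?thesis
    proof cases
      case 1
      then show ?thesis by (simp add: d l0)
    next
      case 2
      then have "P.e (act \<pi> (ginv g) w) = 0"
        using P.e_irrelevant[OF G2_inv[OF g] _ w(1)] irr_inv[OF g] irr_iff by blast
      then show ?thesis using 2 by (simp add: P.e_scale[OF gw[OF g]])
    next
      case 3
      then have rel: "g \<in> carrier U_G2" "corner g = n2 (g $ 1 $ 2)" "psi_U \<psi> g = \<psi> (g $ 1 $ 2)"
        using G2_P_tilde_relevant[OF psi g] by auto
      have "psi_U \<psi> (ginv g) = 1 / \<psi> (g $ 1 $ 2)"
        using P.\<theta>_inv[OF rel(1)] rel(3) by (simp add: G2_inv_GL[OF g])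
      then have "act \<pi> (ginv g) w = smult \<pi> (1 / \<psi> (g $ 1 $ 2)) w"
        using P.act_W[OF w(1) RS_inv[OF rel(1)]] by simp
      \<comment> \<open>This character value cancels the inverse one from the action on w, so all
        contributing summands are equal.\<close>
      moreover have "l (delta (mat 1) v g) = \<psi> (g $ 1 $ 2) * l v"
        using 3 by (simp add: d rel(2) l(3) v)
      ultimately show ?thesis
        using 3 by (simp add: P.e_scale wV P.e_W[OF w(1)] psi_nz[OF psi] mult.commute)
    qed
  qed
  have "P.e (L T v) = (\<Sum>g\<in>carrier G2. P.e (smult \<pi> (l (delta (mat 1) v g)) (act \<pi> (ginv g) w)))"
    unfolding L_def T_def using v gw by (simp add: delta_in_I P.e_sum)
  also have "\<dots> = (\<Sum>g\<in>?A. smult \<pi> (of_nat (card (carrier (U_G2 :: ('k ^ 7 ^ 7) monoid))) * l v) w)"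
    by (rule sum.mono_neutral_cong_right) (use summand in auto)
  also have "\<dots> = smult \<pi> (of_nat (card ?A)) (smult \<pi> (of_nat (card (carrier (U_G2 :: ('k ^ 7 ^ 7) monoid))) * l v) w)"
    by (rule P.vs.sum_constant_scale)
  finally have eq: "P.e (L T v) = smult \<pi> (of_nat (card ?A)) (smult \<pi> (of_nat (card (carrier (U_G2 :: ('k ^ 7 ^ 7) monoid))) * l v) w)" .
  have "mat 1 \<in> ?A"
    by (auto simp: irr_def[OF psi] P_tilde_iff plane_stable_def)
  then have "card ?A \<noteq> 0" by (metis (no_types, lifting) card_0_eq empty_iff finite_matrix_set)
  then have "P.e (L T v) \<noteq> 0" using eq lv w(2) P.card_U by simp
  then show thesis using that T v by blast
qed

lemma hom_dim_eq_1: "hom_dim G2 (I_rep \<tau>) \<pi> = 1"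
proof -
  obtain T v where T: "T \<in> Hom" "v \<in> T.W" "P.e (L T v) \<noteq> 0" using exists_Hom .
  have vV: "v \<in> vspace \<tau>" by (rule T.W_V[OF T(2)])
  have v0: "v \<noteq> 0" using T(3) L_zero[OF T(1)] by auto
  have T0: "T \<noteq> 0" using T(3) by (auto simp: L_def)
  interpret hs: vector_space "\<lambda>c (S :: ('k ^ 7 ^ 7 \<Rightarrow> 'v) \<Rightarrow> 'w) x. smult \<pi> c (S x)"
    by unfold_locales (auto simp: fun_eq_iff P.vs.scale_right_distrib P.vs.scale_left_distrib)
  have "S \<in> hs.span {T}" if S: "S \<in> Hom" for S
  proof -
    \<comment> \<open>Both projections lie on the Whittaker line of \<pi>, so some difference
      \<open>S - c T\<close> has vanishing projection at v and is zero by
      \<open>Hom_determined\<close>.\<close>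
    obtain c where c: "P.e (L S v) = smult \<pi> c (P.e (L T v))"
      using G2_whittaker_unique[OF psi irr_\<pi> P.e_in_W[OF L_V[OF T(1) vV]] T(3) P.e_in_W[OF L_V[OF S vV]]] by blast
    let ?D = "\<lambda>f. S f - smult \<pi> c (T f)"
    have D: "?D \<in> Hom"
      unfolding hom_space_def
    proof (intro CollectI conjI ballI allI impI)
      show "?D ` I \<subseteq> vspace \<pi>"
        using S T(1) by (auto simp: Hom_V intro!: P.vs.subspace_diff[OF P.subspace_V])
      show "linear_on I (smult (I_rep \<tau>)) (smult \<pi>) ?D"
        using S T(1) by (auto simp: linear_on_def Hom_add Hom_smult P.vs.scale_right_distrib
            P.vs.scale_right_diff_distrib mult.commute)
      fix g :: "'k ^ 7 ^ 7" and f assume "g \<in> carrier G2" "f \<in> I"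
      moreover have "act \<pi> g (x - smult \<pi> c y) = act \<pi> g x - smult \<pi> c (act \<pi> g y)"
        if "g \<in> carrier G2" "x \<in> vspace \<pi>" "y \<in> vspace \<pi>" for g x y
        using P.act_add[of g x "smult \<pi> (- c) y"] P.act_scale[of g y "- c"] P.scale_V[of y "- c"] that by simp
      ultimately show "?D (act (I_rep \<tau>) g f) = act \<pi> g (?D f)"
        using S T(1) by (simp add: Hom_act Hom_V)
    qed (use S T(1) in \<open>simp add: hom_space_def\<close>)
    have "P.e (x - smult \<pi> c y) = P.e x - smult \<pi> c (P.e y)" if "x \<in> vspace \<pi>" "y \<in> vspace \<pi>" for x y
      using P.e_add[of x "smult \<pi> (- c) y"] P.e_scale[of y "- c"] P.scale_V[of y "- c"] that by simp
    then have "P.e (L ?D v) = 0"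
      using c L_V[OF S vV] L_V[OF T(1) vV] by (simp add: L_def)
    then have "?D = 0" by (rule Hom_determined[OF D T(2) v0])
    then have "S = (\<lambda>x. smult \<pi> c (T x))" by (simp add: fun_eq_iff)
    then show ?thesis using hs.span_scale[OF hs.span_base[of T "{T}"], of c] by simp
  qed
  then have "hs.dim Hom = 1"
    using T(1) T0 by (intro hs.dim_unique[of "{T}"]) (auto simp: hs.dependent_single)
  then show ?thesis by (simp add: hom_dim_def)
qed

end

theorem proposition1p5:
  fixes \<psi> :: "'k::{field, finite} \<Rightarrow> complex"
    and \<pi> :: "('k ^ 7 ^ 7, 'w::ab_group_add) rep"
    and \<tau> :: "('k ^ 2 ^ 2, 'v::ab_group_add) rep"
  assumes "odd CHAR('k)"
    and "nontrivial_additive_char \<psi>"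
    and "irreducible_rep G2 \<pi>" and "generic_G2 \<psi> \<pi>" and "cuspidal_G2 \<pi>"
    and "irreducible_rep GL \<tau>" and "generic_GL2 \<tau>"
  shows "hom_dim G2 (I_rep \<tau>) \<pi> = 1"
proof -
  interpret generic_pair \<psi> \<pi> \<tau>
    using assms two_neq_zero by unfold_locales
  show ?thesis by (rule hom_dim_eq_1)
qed

end
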